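(* Let $r\ge 4$. Let $U=U(\mathfrak{sl}_2)$ be the universal enveloping algebra of $\mathfrak{sl}_2(\mathbb C)$, and let $V_1$ be the irreducible $U$-module of dimension three. Let $B_r(3)$ be the complex $r$-string Brauer algebra with parameter $3$, and let $$\eta:B_r(3)\longrightarrow \mathrm{End}_{U(\mathfrak{sl}_2)}(V_1^{\otimes r})=:E(r)$$ be the canonical surjective algebra homomorphism. Then the kernel of $\eta$ is the two-sided ideal of $B_r(3)$ generated by the element $$\Phi=Fe_2F-F-\tfrac14Fe_2e_{1,4}F,\qquad F=(1-s_1)(1-s_3),\quad e_{1,4}=s_1s_3e_2s_3s_1.$$
   Context: $B_r(\delta)$ is the $\mathbb C$-algebra with generators $s_1,\dots,s_{r-1},e_1,\dots,e_{r-1}$ and relations $s_i^2=1$, $e_i^2=\delta e_i$, $s_ie_i=e_is_i=e_i$ for all $i$; $s_is_j=s_js_i$, $s_ie_j=e_js_i$, $e_ie_j=e_je_i$ if $|i-j|\ge2$; and $s_is_{i+1}s_i=s_{i+1}s_is_{i+1}$, $e_ie_{i\pm1}e_i=e_i$, $s_ie_{i+1}e_i=s_{i+1}e_i$, $e_{i+1}e_is_{i+1}=e_{i+1}s_i$ for all applicable $i$. Equivalently it is the usual diagram algebra with closed loops evaluated to $\delta$; here $\delta=3$. The homomorphism $\eta$: let $(\cdot,\cdot)$ be a nondegenerate symmetric $\mathfrak{sl}_2$-invariant bilinear form on $V_1$, and let $\{b_k\},\{b_k'\}$ be dual bases of $V_1$ with respect to it. Then $\eta(s_i)$ interchanges the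 $i$-th and $(i+1)$-st tensor factors, and $\eta(e_i)$ acts on the $i$-th and $(i+1)$-st tensor factors by $v\otimes w\mapsto (v,w)\sum_k b_k\otimes b_k'$. It is known that $\eta$ is surjective. *)

theory Defs
  imports
    "HOL-Analysis.Analysis"
    "HOL-Algebra.QuotRing"
    "HOL-Library.Poly_Mapping"
    "HOL-Library.Function_Algebras"
begin

section \<open>Algebras given by generators and relations\<close>

text \<open>The free monoid, written additively so that \<open>'g fword \<Rightarrow>\<^sub>0 complex\<close> with its convolution
  product is the free associative complex algebra on \<open>'g\<close>.  The wrapper type keeps the
  monoid structure off the type of lists.\<close>

datatype 'g fword = FWord (letters: "'g list")

instantiation fword :: (type) monoid_add
begin

definition zero_fword :: "'g fword" where "zero_fword = FWord []"

definition plus_fword :: "'g fword \<Rightarrow> 'g fword \<Rightarrow> 'g fword"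
  where "plus_fword u v = FWord (letters u @ letters v)"

instance
  by standard (auto simp: zero_fword_def plus_fword_def)

end

lemma letters_zero [simp]: "letters 0 = []"
  by (simp add: zero_fword_def)

lemma letters_plus [simp]: "letters (u + v) = letters u @ letters v"
  by (simp add: plus_fword_def)

type_synonym 'g ncpoly = "'g fword \<Rightarrow>\<^sub>0 complex"

definition gen :: "'g \<Rightarrow> 'g ncpoly"
  where "gen g = Poly_Mapping.single (FWord [g]) 1"

definition const :: "complex \<Rightarrow> 'g ncpoly"
  where "const c = Poly_Mapping.single 0 c"

definition free_algebra :: "'g set \<Rightarrow> 'g ncpoly ring"
  where "free_algebra G =
    \<lparr>carrier = {p. \<forall>w\<in>Poly_Mapping.keys p. set (letters w) \<subseteq> G},
     mult = (*), one = 1, zero = 0, add = (+)\<rparr>"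

text \<open>A relation \<open>u = v\<close> is given by its relator \<open>u - v\<close>.\<close>

definition presented_algebra :: "'g set \<Rightarrow> 'g ncpoly set \<Rightarrow> 'g ncpoly set ring"
  where "presented_algebra G R = free_algebra G Quot genideal (free_algebra G) R"

definition presented_class :: "'g set \<Rightarrow> 'g ncpoly set \<Rightarrow> 'g ncpoly \<Rightarrow> 'g ncpoly set"
  where "presented_class G R p = genideal (free_algebra G) R +>\<^bsub>free_algebra G\<^esub> p"


section \<open>Endomorphism algebras and evaluation of noncommutative polynomials\<close>

definition lin_End :: "(complex \<Rightarrow> 'v \<Rightarrow> 'v) \<Rightarrow> 'v::ab_group_add set \<Rightarrow> ('v \<Rightarrow> 'v) ring"
  where "lin_End scl W =
    \<lparr>carrier = {f \<in> W \<rightarrow>\<^sub>E W. \<forall>x\<in>W. \<forall>y\<in>W. \<forall>c.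
                 f (x + y) = f x + f y \<and> f (scl c x) = scl c (f x)},
     mult = compose W, one = (\<lambda>x\<in>W. x), zero = (\<lambda>x\<in>W. 0), add = (\<lambda>f g. \<lambda>x\<in>W. f x + g x)\<rparr>"

text \<open>The word \<open>g\<^sub>1 \<dots> g\<^sub>n\<close> is evaluated to \<open>\<phi> g\<^sub>1 \<circ> \<dots> \<circ> \<phi> g\<^sub>n\<close>, so this is the
  homomorphism from the free algebra to \<^const>\<open>lin_End\<close> extending \<open>\<phi>\<close>.\<close>

definition free_eval ::
    "(complex \<Rightarrow> 'v \<Rightarrow> 'v) \<Rightarrow> 'v::ab_group_add set \<Rightarrow> ('g \<Rightarrow> 'v \<Rightarrow> 'v) \<Rightarrow> 'g ncpoly \<Rightarrow> 'v \<Rightarrow> 'v"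
  where "free_eval scl W \<phi> p =
    (\<lambda>x\<in>W. \<Sum>w\<in>Poly_Mapping.keys p. scl (Poly_Mapping.lookup p w) (foldr \<phi> (letters w) x))"

text \<open>The induced map on residue classes, meaningful when \<open>\<phi>\<close> satisfies the relations; see
  \<open>presented_lift_hom\<close> below.\<close>

definition presented_lift ::
    "(complex \<Rightarrow> 'v \<Rightarrow> 'v) \<Rightarrow> 'v::ab_group_add set \<Rightarrow> ('g \<Rightarrow> 'v \<Rightarrow> 'v) \<Rightarrow> 'g ncpoly set \<Rightarrow> 'v \<Rightarrow> 'v"
  where "presented_lift scl W \<phi> X = the_elem (free_eval scl W \<phi> ` X)"


section \<open>The Brauer algebra\<close>

datatype brauer_gen = GenS nat | GenE nat

abbreviation sg :: "nat \<Rightarrow> brauer_gen ncpoly" where "sg i \<equiv> gen (GenS i)"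
abbreviation eg :: "nat \<Rightarrow> brauer_gen ncpoly" where "eg i \<equiv> gen (GenE i)"

definition brauer_gens :: "nat \<Rightarrow> brauer_gen set"
  where "brauer_gens r = GenS ` {1..<r} \<union> GenE ` {1..<r}"

inductive_set brauer_relators :: "nat \<Rightarrow> complex \<Rightarrow> brauer_gen ncpoly set"
  for r :: nat and \<delta> :: complex
where
  ss: "i \<in> {1..<r} \<Longrightarrow> sg i * sg i - 1 \<in> brauer_relators r \<delta>"
| ee: "i \<in> {1..<r} \<Longrightarrow> eg i * eg i - const \<delta> * eg i \<in> brauer_relators r \<delta>"
| se: "i \<in> {1..<r} \<Longrightarrow> sg i * eg i - eg i \<in> brauer_relators r \<delta>"
| es: "i \<in> {1..<r} \<Longrightarrow> eg i * sg i - eg i \<in> brauer_relators r \<delta>"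
| ss_far: "\<lbrakk>i \<in> {1..<r}; j \<in> {1..<r}; i + 2 \<le> j \<or> j + 2 \<le> i\<rbrakk>
    \<Longrightarrow> sg i * sg j - sg j * sg i \<in> brauer_relators r \<delta>"
| se_far: "\<lbrakk>i \<in> {1..<r}; j \<in> {1..<r}; i + 2 \<le> j \<or> j + 2 \<le> i\<rbrakk>
    \<Longrightarrow> sg i * eg j - eg j * sg i \<in> brauer_relators r \<delta>"
| ee_far: "\<lbrakk>i \<in> {1..<r}; j \<in> {1..<r}; i + 2 \<le> j \<or> j + 2 \<le> i\<rbrakk>
    \<Longrightarrow> eg i * eg j - eg j * eg i \<in> brauer_relators r \<delta>"
| sss: "\<lbrakk>i \<in> {1..<r}; i + 1 \<in> {1..<r}\<rbrakk>
    \<Longrightarrow> sg i * sg (i + 1) * sg i - sg (i + 1) * sg i * sg (i + 1) \<in> brauer_relators r \<delta>"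
| eee: "\<lbrakk>i \<in> {1..<r}; j \<in> {1..<r}; j = i + 1 \<or> i = j + 1\<rbrakk>
    \<Longrightarrow> eg i * eg j * eg i - eg i \<in> brauer_relators r \<delta>"
| see: "\<lbrakk>i \<in> {1..<r}; i + 1 \<in> {1..<r}\<rbrakk>
    \<Longrightarrow> sg i * eg (i + 1) * eg i - sg (i + 1) * eg i \<in> brauer_relators r \<delta>"
| ees: "\<lbrakk>i \<in> {1..<r}; i + 1 \<in> {1..<r}\<rbrakk>
    \<Longrightarrow> eg (i + 1) * eg i * sg (i + 1) - eg (i + 1) * sg i \<in> brauer_relators r \<delta>"

definition brauer_algebra :: "nat \<Rightarrow> complex \<Rightarrow> brauer_gen ncpoly set ring"
  where "brauer_algebra r \<delta> = presented_algebra (brauer_gens r) (brauer_relators r \<delta>)"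

definition brauer_class :: "nat \<Rightarrow> complex \<Rightarrow> brauer_gen ncpoly \<Rightarrow> brauer_gen ncpoly set"
  where "brauer_class r \<delta> = presented_class (brauer_gens r) (brauer_relators r \<delta>)"

definition brauer_Phi :: "nat \<Rightarrow> brauer_gen ncpoly set"
  where "brauer_Phi r =
    (let F = (1 - sg 1) * (1 - sg 3);
         e14 = sg 1 * sg 3 * eg 2 * sg 3 * sg 1
     in brauer_class r 3 (F * eg 2 * F - F - const (1/4) * F * eg 2 * e14 * F))"


section \<open>The universal enveloping algebra of \<open>sl\<^sub>2\<close> and its modules\<close>

definition sl2 :: "(complex^2^2) set"
  where "sl2 = {A. trace A = 0}"

inductive_set Usl2_relators :: "(complex^2^2) ncpoly set"
where
  add: "\<lbrakk>A \<in> sl2; B \<in> sl2\<rbrakk> \<Longrightarrow> gen (A + B) - (gen A + gen B) \<in> Usl2_relators"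
| scale: "A \<in> sl2 \<Longrightarrow> gen (\<chi> i j. c * A $ i $ j) - const c * gen A \<in> Usl2_relators"
| bracket: "\<lbrakk>A \<in> sl2; B \<in> sl2\<rbrakk>
    \<Longrightarrow> gen (A ** B - B ** A) - (gen A * gen B - gen B * gen A) \<in> Usl2_relators"

definition Usl2 :: "(complex^2^2) ncpoly set ring"
  where "Usl2 = presented_algebra sl2 Usl2_relators"

definition Usl2_class :: "(complex^2^2) ncpoly \<Rightarrow> (complex^2^2) ncpoly set"
  where "Usl2_class = presented_class sl2 Usl2_relators"

text \<open>A \<open>U(sl\<^sub>2)\<close>-module structure on the subspace \<open>W\<close>: a unital homomorphism of complex
  algebras from \<^const>\<open>Usl2\<close> to \<open>End W\<close>.\<close>

definition Usl2_module ::
    "(complex \<Rightarrow> 'v \<Rightarrow> 'v) \<Rightarrow> 'v::ab_group_add set \<Rightarrow> ((complex^2^2) ncpoly set \<Rightarrow> 'v \<Rightarrow> 'v) \<Rightarrow> bool"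
  where "Usl2_module scl W \<rho> \<longleftrightarrow>
    vector_space scl \<and> module.subspace scl W \<and>
    \<rho> \<in> ring_hom Usl2 (lin_End scl W) \<and>
    (\<forall>c. \<rho> (Usl2_class (const c)) = (\<lambda>x\<in>W. scl c x))"

definition irreducible_Usl2_module ::
    "(complex \<Rightarrow> 'v \<Rightarrow> 'v) \<Rightarrow> 'v::ab_group_add set \<Rightarrow> ((complex^2^2) ncpoly set \<Rightarrow> 'v \<Rightarrow> 'v) \<Rightarrow> bool"
  where "irreducible_Usl2_module scl W \<rho> \<longleftrightarrow>
    Usl2_module scl W \<rho> \<and> W \<noteq> {0} \<and>
    (\<forall>W'. module.subspace scl W' \<and> W' \<subseteq> W \<and> (\<forall>u\<in>carrier Usl2. \<forall>x\<in>W'. \<rho> u x \<in> W')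
      \<longrightarrow> W' = {0} \<or> W' = W)"

definition Usl2_End ::
    "(complex \<Rightarrow> 'v \<Rightarrow> 'v) \<Rightarrow> 'v::ab_group_add set \<Rightarrow> ((complex^2^2) ncpoly set \<Rightarrow> 'v \<Rightarrow> 'v)
      \<Rightarrow> ('v \<Rightarrow> 'v) ring"
  where "Usl2_End scl W \<rho> =
    (lin_End scl W)
      \<lparr>carrier := {f \<in> carrier (lin_End scl W).
         \<forall>u\<in>carrier Usl2. \<forall>x\<in>W. f (\<rho> u x) = \<rho> u (f x)}\<rparr>"


section \<open>Tensor powers of \<open>\<complex>\<^sup>3\<close>\<close>

text \<open>A tensor in the \<open>r\<close>-th tensor power of \<open>\<complex>\<^sup>3\<close> is given by its coordinates, indexed by the
  words of length \<open>r\<close> over the three-element type.  Tensor factors are numbered from \<open>0\<close>.\<close>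

type_synonym tensor = "3 list \<Rightarrow> complex"

definition tensor_power :: "nat \<Rightarrow> tensor set"
  where "tensor_power r = {t. \<forall>w. t w \<noteq> 0 \<longrightarrow> length w = r}"

definition tensor_scale :: "complex \<Rightarrow> tensor \<Rightarrow> tensor"
  where "tensor_scale c t = (\<lambda>w. c * t w)"

definition pure_tensor :: "(complex^3) list \<Rightarrow> tensor"
  where "pure_tensor vs =
    (\<lambda>w. if length w = length vs then \<Prod>k<length vs. (vs ! k) $ (w ! k) else 0)"

text \<open>The operators \<open>on_factor\<close>, \<open>swap_factors\<close>, \<open>contract_factors\<close> are described by their
  effect on pure tensors in \<open>on_factor_pure\<close>, \<open>swap_factors_pure\<close>, \<open>contract_factors_pure\<close>
  below.\<close>

definition on_factor :: "nat \<Rightarrow> (complex^3 \<Rightarrow> complex^3) \<Rightarrow> tensor \<Rightarrow> tensor"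
  where "on_factor k f t =
    (\<lambda>w. if k < length w then \<Sum>a\<in>UNIV. (f (axis a 1)) $ (w ! k) * t (w[k := a]) else 0)"

definition swap_factors :: "nat \<Rightarrow> tensor \<Rightarrow> tensor"
  where "swap_factors k t = (\<lambda>w. t (w[k := w ! (k + 1), k + 1 := w ! k]))"

definition contract_factors ::
    "(complex^3 \<Rightarrow> complex^3 \<Rightarrow> complex) \<Rightarrow> (3 \<Rightarrow> complex^3) \<Rightarrow> (3 \<Rightarrow> complex^3)
      \<Rightarrow> nat \<Rightarrow> tensor \<Rightarrow> tensor"
  where "contract_factors \<beta> b b' k t =
    (\<lambda>w. (\<Sum>a\<in>UNIV. \<Sum>c\<in>UNIV. \<beta> (axis a 1) (axis c 1) * t (w[k := a, k + 1 := c])) *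
         (\<Sum>j\<in>UNIV. b j $ (w ! k) * b' j $ (w ! (k + 1))))"

text \<open>The action of \<^const>\<open>Usl2\<close> through the iterated coproduct: \<open>A \<in> sl\<^sub>2\<close> acts by
  \<open>\<Sum>\<^sub>k 1 \<otimes> \<dots> \<otimes> A \<otimes> \<dots> \<otimes> 1\<close>.\<close>

definition tensor_action ::
    "((complex^2^2) ncpoly set \<Rightarrow> complex^3 \<Rightarrow> complex^3) \<Rightarrow> nat
      \<Rightarrow> (complex^2^2) ncpoly set \<Rightarrow> tensor \<Rightarrow> tensor"
  where "tensor_action \<pi> r =
    presented_lift tensor_scale (tensor_power r)
      (\<lambda>A t. \<Sum>k<r. on_factor k (\<pi> (Usl2_class (gen A))) t)"

definition tensor_End ::
    "((complex^2^2) ncpoly set \<Rightarrow> complex^3 \<Rightarrow> complex^3) \<Rightarrow> nat \<Rightarrow> (tensor \<Rightarrow> tensor) ring"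
  where "tensor_End \<pi> r = Usl2_End tensor_scale (tensor_power r) (tensor_action \<pi> r)"


section \<open>The homomorphism \<open>\<eta>\<close>\<close>

definition invariant_form ::
    "((complex^2^2) ncpoly set \<Rightarrow> complex^3 \<Rightarrow> complex^3) \<Rightarrow> (complex^3 \<Rightarrow> complex^3 \<Rightarrow> complex) \<Rightarrow> bool"
  where "invariant_form \<pi> \<beta> \<longleftrightarrow>
    (\<forall>v. Vector_Spaces.linear (*s) (*) (\<beta> v)) \<and>
    (\<forall>w. Vector_Spaces.linear (*s) (*) (\<lambda>v. \<beta> v w)) \<and>
    (\<forall>v w. \<beta> v w = \<beta> w v) \<and>
    (\<forall>v. (\<forall>w. \<beta> v w = 0) \<longrightarrow> v = 0) \<and>
    (\<forall>A\<in>sl2. \<forall>v w. \<beta> (\<pi> (Usl2_class (gen A)) v) w + \<beta> v (\<pi> (Usl2_class (gen A)) w) = 0)"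

definition basis_family :: "(3 \<Rightarrow> complex^3) \<Rightarrow> bool"
  where "basis_family b \<longleftrightarrow> inj b \<and> vec.independent (range b) \<and> vec.span (range b) = UNIV"

definition dual_bases ::
    "(complex^3 \<Rightarrow> complex^3 \<Rightarrow> complex) \<Rightarrow> (3 \<Rightarrow> complex^3) \<Rightarrow> (3 \<Rightarrow> complex^3) \<Rightarrow> bool"
  where "dual_bases \<beta> b b' \<longleftrightarrow>
    basis_family b \<and> basis_family b' \<and> (\<forall>j k. \<beta> (b j) (b' k) = (if j = k then 1 else 0))"

text \<open>Brauer generators are numbered from \<open>1\<close>, tensor factors from \<open>0\<close>.  That \<open>eta\<close> is a
  homomorphism into \<^const>\<open>tensor_End\<close> with these values on generators is
  \<open>eta_well_defined\<close> below.\<close>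

fun eta_gen ::
    "(complex^3 \<Rightarrow> complex^3 \<Rightarrow> complex) \<Rightarrow> (3 \<Rightarrow> complex^3) \<Rightarrow> (3 \<Rightarrow> complex^3)
      \<Rightarrow> brauer_gen \<Rightarrow> tensor \<Rightarrow> tensor"
  where
    "eta_gen \<beta> b b' (GenS i) = swap_factors (i - 1)"
  | "eta_gen \<beta> b b' (GenE i) = contract_factors \<beta> b b' (i - 1)"

definition eta ::
    "(complex^3 \<Rightarrow> complex^3 \<Rightarrow> complex) \<Rightarrow> (3 \<Rightarrow> complex^3) \<Rightarrow> (3 \<Rightarrow> complex^3) \<Rightarrow> nat
      \<Rightarrow> brauer_gen ncpoly set \<Rightarrow> tensor \<Rightarrow> tensor"
  where "eta \<beta> b b' r = presented_lift tensor_scale (tensor_power r) (eta_gen \<beta> b b')"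


section \<open>Presented algebras: basic facts and universal property\<close>

lemma free_algebra_carrierI: "(\<And>w. w \<in> Poly_Mapping.keys p \<Longrightarrow> set (letters w) \<subseteq> G) \<Longrightarrow> p \<in> carrier (free_algebra G)"
  by (simp add: free_algebra_def)

lemma free_algebra_simps [simp]:
  "mult (free_algebra G) = (*)" "one (free_algebra G) = 1"
  "zero (free_algebra G) = 0" "add (free_algebra G) = (+)"
  by (simp_all add: free_algebra_def)

lemma free_algebra_closed [simp]:
  "1 \<in> carrier (free_algebra G)" "0 \<in> carrier (free_algebra G)"
  "const c \<in> carrier (free_algebra G)"
  "g \<in> G \<Longrightarrow> gen g \<in> carrier (free_algebra G)"
  "p \<in> carrier (free_algebra G) \<Longrightarrow> - p \<in> carrier (free_algebra G)"
  "\<lbrakk>p \<in> carrier (free_algebra G); q \<in> carrier (free_algebra G)\<rbrakk> \<Longrightarrow> p + q \<in> carrier (free_algebra G)"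
  "\<lbrakk>p \<in> carrier (free_algebra G); q \<in> carrier (free_algebra G)\<rbrakk> \<Longrightarrow> p * q \<in> carrier (free_algebra G)"
proof -
  show "1 \<in> carrier (free_algebra G)" "0 \<in> carrier (free_algebra G)"
    by (auto intro!: free_algebra_carrierI)
  show "const c \<in> carrier (free_algebra G)"
    by (rule free_algebra_carrierI) (auto simp: const_def split: if_splits)
  show "gen g \<in> carrier (free_algebra G)" if "g \<in> G"
    using that by (intro free_algebra_carrierI) (auto simp: gen_def)
  show "- p \<in> carrier (free_algebra G)" if "p \<in> carrier (free_algebra G)"
    using that by (simp add: free_algebra_def)
  show "p + q \<in> carrier (free_algebra G)" if "p \<in> carrier (free_algebra G)" "q \<in> carrier (free_algebra G)"
    using that keys_add[of p q] by (fastforce simp: free_algebra_def)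
  show "p * q \<in> carrier (free_algebra G)" if "p \<in> carrier (free_algebra G)" "q \<in> carrier (free_algebra G)"
    using that keys_mult[of p q] by (fastforce simp: free_algebra_def)
qed

lemma free_algebra_diff [simp]:
  "\<lbrakk>p \<in> carrier (free_algebra G); q \<in> carrier (free_algebra G)\<rbrakk> \<Longrightarrow> p - q \<in> carrier (free_algebra G)"
  using free_algebra_closed(5,6) by (metis uminus_add_conv_diff add.commute)

lemma ring_free_algebra: "ring (free_algebra G)"
proof (rule ringI)
  show "abelian_group (free_algebra G)"
  proof (rule abelian_groupI)
    fix x assume "x \<in> carrier (free_algebra G)"
    then show "\<exists>y\<in>carrier (free_algebra G). y \<oplus>\<^bsub>free_algebra G\<^esub> x = \<zero>\<^bsub>free_algebra G\<^esub>"
      by (intro bexI[of _ "- x"]) auto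
  qed (auto simp: algebra_simps)
  show "Group.monoid (free_algebra G)"
    by (rule monoidI) (auto simp: algebra_simps)
qed (auto simp: algebra_simps)

locale free_rep =
  fixes scl :: "complex \<Rightarrow> 'v::ab_group_add \<Rightarrow> 'v" and W :: "'v set"
    and G :: "'g set" and \<phi> :: "'g \<Rightarrow> 'v \<Rightarrow> 'v"
  assumes vs: "vector_space scl" and sub: "module.subspace scl W"
    and \<phi>_W: "\<And>g x. \<lbrakk>g \<in> G; x \<in> W\<rbrakk> \<Longrightarrow> \<phi> g x \<in> W"
    and \<phi>_add: "\<And>g x y. \<lbrakk>g \<in> G; x \<in> W; y \<in> W\<rbrakk> \<Longrightarrow> \<phi> g (x + y) = \<phi> g x + \<phi> g y"
    and \<phi>_scl: "\<And>g x c. \<lbrakk>g \<in> G; x \<in> W\<rbrakk> \<Longrightarrow> \<phi> g (scl c x) = scl c (\<phi> g x)"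
begin

sublocale V: vector_space scl by (rule vs)

abbreviation FA where "FA \<equiv> free_algebra G"
abbreviation ev where "ev \<equiv> free_eval scl W \<phi>"

lemma W_closed [simp, intro]:
  "0 \<in> W" "\<lbrakk>x \<in> W; y \<in> W\<rbrakk> \<Longrightarrow> x + y \<in> W" "x \<in> W \<Longrightarrow> scl c x \<in> W"
  using sub V.subspace_0 V.subspace_add V.subspace_scale by blast+

lemma W_sum: "(\<And>i. i \<in> I \<Longrightarrow> f i \<in> W) \<Longrightarrow> sum f I \<in> W"
  by (rule V.subspace_sum[OF sub])

lemma word:
  assumes "set gs \<subseteq> G"
  shows "x \<in> W \<Longrightarrow> foldr \<phi> gs x \<in> W"
    and "\<lbrakk>x \<in> W; y \<in> W\<rbrakk> \<Longrightarrow> foldr \<phi> gs (x + y) = foldr \<phi> gs x + foldr \<phi> gs y"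
    and "x \<in> W \<Longrightarrow> foldr \<phi> gs (scl c x) = scl c (foldr \<phi> gs x)"
proof -
  have 1: "foldr \<phi> gs x \<in> W" if "x \<in> W" for x
    using assms that by (induction gs) (auto intro: \<phi>_W)
  show "x \<in> W \<Longrightarrow> foldr \<phi> gs x \<in> W" by (rule 1)
  show "\<lbrakk>x \<in> W; y \<in> W\<rbrakk> \<Longrightarrow> foldr \<phi> gs (x + y) = foldr \<phi> gs x + foldr \<phi> gs y"
    using assms
  proof (induction gs)
    case (Cons g gs)
    have "foldr \<phi> gs z \<in> W" if "z \<in> W" for z
      using Cons.prems that by (induction gs) (auto intro: \<phi>_W)
    then show ?case using Cons by (simp add: \<phi>_add)
  qed simp
  show "x \<in> W \<Longrightarrow> foldr \<phi> gs (scl c x) = scl c (foldr \<phi> gs x)"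
    using assms
  proof (induction gs)
    case (Cons g gs)
    have "foldr \<phi> gs z \<in> W" if "z \<in> W" for z
      using Cons.prems that by (induction gs) (auto intro: \<phi>_W)
    then show ?case using Cons by (simp add: \<phi>_scl)
  qed simp
qed

lemma ev_superset:
  assumes "finite K" "Poly_Mapping.keys p \<subseteq> K" "x \<in> W"
  shows "ev p x = (\<Sum>w\<in>K. scl (Poly_Mapping.lookup p w) (foldr \<phi> (letters w) x))"
proof -
  have "(\<Sum>w\<in>Poly_Mapping.keys p. scl (Poly_Mapping.lookup p w) (foldr \<phi> (letters w) x)) =
    (\<Sum>w\<in>K. scl (Poly_Mapping.lookup p w) (foldr \<phi> (letters w) x))"
    by (rule sum.mono_neutral_left) (use assms in \<open>auto simp: in_keys_iff\<close>)
  then show ?thesis using assms(3) by (simp add: free_eval_def)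
qed

lemma ev_add [simp]: "x \<in> W \<Longrightarrow> ev (p + q) x = ev p x + ev q x"
proof -
  assume x: "x \<in> W"
  let ?K = "Poly_Mapping.keys p \<union> Poly_Mapping.keys q"
  have "ev (p + q) x = (\<Sum>w\<in>?K. scl (Poly_Mapping.lookup (p + q) w) (foldr \<phi> (letters w) x))"
    using keys_add[of p q] x by (intro ev_superset) auto
  also have "\<dots> = ev p x + ev q x"
    using x by (simp add: ev_superset[of ?K] lookup_add V.scale_left_distrib sum.distrib)
  finally show ?thesis .
qed

lemma ev_single: "x \<in> W \<Longrightarrow> ev (Poly_Mapping.single w c) x = scl c (foldr \<phi> (letters w) x)"
  by (simp add: ev_superset[of "{w}"])

lemma ev_zero [simp]: "x \<in> W \<Longrightarrow> ev 0 x = 0"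
  by (simp add: free_eval_def)

lemma ev_one [simp]: "x \<in> W \<Longrightarrow> ev 1 x = x"
  using ev_single[of x 0 1] by simp

lemma ev_const [simp]: "x \<in> W \<Longrightarrow> ev (const c) x = scl c x"
  using ev_single[of x 0 c] by (simp add: const_def)

lemma ev_gen [simp]: "x \<in> W \<Longrightarrow> ev (gen g) x = \<phi> g x"
  using ev_single[of x "FWord [g]" 1] by (simp add: gen_def)

lemma ev_uminus [simp]: "x \<in> W \<Longrightarrow> ev (- p) x = - ev p x"
  using ev_add[of x p "- p"] by (simp add: eq_neg_iff_add_eq_0 add.commute)

lemma ev_diff [simp]: "x \<in> W \<Longrightarrow> ev (p - q) x = ev p x - ev q x"
  using ev_add[of x p "- q"] by simp

lemma ev_sum: "x \<in> W \<Longrightarrow> ev (\<Sum>i\<in>I. f i) x = (\<Sum>i\<in>I. ev (f i) x)"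
  by (induction I rule: infinite_finite_induct) auto

lemma ev_W [simp, intro]: "\<lbrakk>p \<in> carrier FA; x \<in> W\<rbrakk> \<Longrightarrow> ev p x \<in> W"
  by (simp add: free_eval_def free_algebra_def) (intro W_sum W_closed word; blast)

lemma ev_lin:
  assumes "p \<in> carrier FA" "x \<in> W" 
  shows "y \<in> W \<Longrightarrow> ev p (x + y) = ev p x + ev p y" "ev p (scl c x) = scl c (ev p x)"
proof -
  have *: "set (letters w) \<subseteq> G" if "w \<in> Poly_Mapping.keys p" for w
    using assms(1) that by (simp add: free_algebra_def)
  show "y \<in> W \<Longrightarrow> ev p (x + y) = ev p x + ev p y"
    using assms(2)
    by (simp add: free_eval_def word[OF *] V.scale_right_distrib sum.distrib cong: sum.cong)
  show "ev p (scl c x) = scl c (ev p x)"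
    using assms(2)
    by (simp add: free_eval_def word[OF *] V.scale_sum_right mult.commute cong: sum.cong)
qed

lemma poly_decomp: "p = (\<Sum>w\<in>Poly_Mapping.keys p. Poly_Mapping.single w (Poly_Mapping.lookup p w))"
  by (rule poly_mapping_eqI) (simp add: lookup_sum lookup_single when_def in_keys_iff)

lemma ev_zero_arg: "p \<in> carrier FA \<Longrightarrow> ev p 0 = 0"
  using ev_lin(2)[of p 0 0] by simp

lemma ev_arg_sum:
  assumes "p \<in> carrier FA"
  shows "(\<And>i. i \<in> I \<Longrightarrow> f i \<in> W) \<Longrightarrow> ev p (\<Sum>i\<in>I. f i) = (\<Sum>i\<in>I. ev p (f i))"
  by (induction I rule: infinite_finite_induct) (auto simp: ev_zero_arg ev_lin W_sum assms)

lemma ev_mult [simp]: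
  assumes p: "p \<in> carrier FA" and q: "q \<in> carrier FA" and x: "x \<in> W"
  shows "ev (p * q) x = ev p (ev q x)"
proof -
  have q': "set (letters w) \<subseteq> G" if "w \<in> Poly_Mapping.keys q" for w
    using q that by (simp add: free_algebra_def)
  have p': "set (letters w) \<subseteq> G" if "w \<in> Poly_Mapping.keys p" for w
    using p that by (simp add: free_algebra_def)
  have "p * q = (\<Sum>w\<in>Poly_Mapping.keys p. \<Sum>v\<in>Poly_Mapping.keys q.
      Poly_Mapping.single (w + v) (Poly_Mapping.lookup p w * Poly_Mapping.lookup q v))"
    by (subst poly_decomp[of p], subst poly_decomp[of q]) (simp add: sum_product mult_single)
  then have "ev (p * q) x = (\<Sum>w\<in>Poly_Mapping.keys p. \<Sum>v\<in>Poly_Mapping.keys q.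
      scl (Poly_Mapping.lookup p w * Poly_Mapping.lookup q v) (foldr \<phi> (letters w) (foldr \<phi> (letters v) x)))"
    using x by (simp add: ev_sum ev_single)
  also have "\<dots> = (\<Sum>v\<in>Poly_Mapping.keys q. scl (Poly_Mapping.lookup q v) (ev p (foldr \<phi> (letters v) x)))"
    using x by (subst sum.swap) (simp add: free_eval_def word(1)[OF q'] V.scale_sum_right mult.commute cong: sum.cong)
  also have "\<dots> = (\<Sum>v\<in>Poly_Mapping.keys q. ev p (scl (Poly_Mapping.lookup q v) (foldr \<phi> (letters v) x)))"
    using x by (intro sum.cong refl) (simp add: ev_lin p word(1)[OF q'])
  also have "\<dots> = ev p (ev q x)"
    using x by (subst ev_arg_sum[symmetric]) (auto simp: p free_eval_def intro!: word(1) dest: q')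
  finally show ?thesis .
qed

lemma ring_lin_End: "ring (lin_End scl W)"
proof (rule ringI)
  show "abelian_group (lin_End scl W)"
  proof (rule abelian_groupI)
    fix f assume "f \<in> carrier (lin_End scl W)"
    then show "\<exists>y\<in>carrier (lin_End scl W). y \<oplus>\<^bsub>lin_End scl W\<^esub> f = \<zero>\<^bsub>lin_End scl W\<^esub>"
      using V.subspace_neg[OF sub]
      by (intro bexI[of _ "\<lambda>x\<in>W. - f x"]) (auto simp: lin_End_def PiE_def Pi_def algebra_simps)
  qed (auto simp: lin_End_def PiE_def Pi_def V.scale_right_distrib add_ac extensional_def)
  show "Group.monoid (lin_End scl W)"
    by (rule monoidI) (auto simp: lin_End_def PiE_def Pi_def compose_def extensional_def fun_eq_iff)
qed (auto simp: lin_End_def PiE_def Pi_def compose_def extensional_def fun_eq_iff)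

lemma ev_hom: "ev \<in> ring_hom FA (lin_End scl W)"
proof (rule ring_hom_memI)
  have out: "ev p x = undefined" if "x \<notin> W" for p x
    using that by (simp add: free_eval_def)
  show "ev p \<in> carrier (lin_End scl W)" if "p \<in> carrier FA" for p
    using that by (auto simp: lin_End_def ev_lin out)
  show "ev (p \<otimes>\<^bsub>FA\<^esub> q) = ev p \<otimes>\<^bsub>lin_End scl W\<^esub> ev q" if "p \<in> carrier FA" "q \<in> carrier FA" for p q
    using that by (auto simp: lin_End_def compose_def fun_eq_iff out)
  show "ev (p \<oplus>\<^bsub>FA\<^esub> q) = ev p \<oplus>\<^bsub>lin_End scl W\<^esub> ev q" for p q
    by (auto simp: lin_End_def fun_eq_iff out)
  show "ev \<one>\<^bsub>FA\<^esub> = \<one>\<^bsub>lin_End scl W\<^esub>"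
    by (auto simp: lin_End_def fun_eq_iff out)
qed

lemma ev_hom_ring: "ring_hom_ring FA (lin_End scl W) ev"
  by (intro ring_hom_ringI2 ring_free_algebra ring_lin_End ev_hom)

end

lemma presented_class_hom:
  assumes "R \<subseteq> carrier (free_algebra G)"
  shows "presented_class G R \<in> ring_hom (free_algebra G) (presented_algebra G R)"
    and "ring (presented_algebra G R)"
    and "carrier (presented_algebra G R) = presented_class G R ` carrier (free_algebra G)"
    and "p \<in> R \<Longrightarrow> presented_class G R p = \<zero>\<^bsub>presented_algebra G R\<^esub>"
proof -
  interpret ring "free_algebra G" by (rule ring_free_algebra)
  interpret ideal "genideal (free_algebra G) R" "free_algebra G"
    by (rule genideal_ideal[OF assms])
  show "presented_class G R \<in> ring_hom (free_algebra G) (presented_algebra G R)"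
    using rcos_ring_hom unfolding presented_class_def[abs_def] presented_algebra_def .
  show "ring (presented_algebra G R)"
    unfolding presented_algebra_def by (rule quotient_is_ring)
  show "carrier (presented_algebra G R) = presented_class G R ` carrier (free_algebra G)"
    by (auto simp: presented_algebra_def FactRing_def A_RCOSETS_def' presented_class_def)
  show "presented_class G R p = \<zero>\<^bsub>presented_algebra G R\<^esub>" if "p \<in> R"
  proof -
    have "p \<in> genideal (free_algebra G) R"
      using that genideal_self[OF assms] by blast
    from a_rcos_const[OF this] show ?thesis
      by (simp add: presented_algebra_def FactRing_def presented_class_def)
  qed
qed

lemma presented_class_simps:
  assumes "R \<subseteq> carrier (free_algebra G)"
    and "p \<in> carrier (free_algebra G)" "q \<in> carrier (free_algebra G)"
  shows "presented_class G R (p + q) = presented_class G R p \<oplus>\<^bsub>presented_algebra G R\<^esub> presented_class G R q"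
    and "presented_class G R (p * q) = presented_class G R p \<otimes>\<^bsub>presented_algebra G R\<^esub> presented_class G R q"
    and "presented_class G R 1 = \<one>\<^bsub>presented_algebra G R\<^esub>"
  using ring_hom_add[OF presented_class_hom(1)[OF assms(1)] assms(2,3)]
    ring_hom_mult[OF presented_class_hom(1)[OF assms(1)] assms(2,3)]
    ring_hom_one[OF presented_class_hom(1)[OF assms(1)]]
  by simp_all

lemma presented_class_eqI:
  assumes R: "R \<subseteq> carrier (free_algebra G)" and "p - q \<in> R"
    and p: "p \<in> carrier (free_algebra G)" and q: "q \<in> carrier (free_algebra G)"
  shows "presented_class G R p = presented_class G R q"
proof -
  interpret A: ring "presented_algebra G R" by (rule presented_class_hom(2)[OF R])
  have mem: "presented_class G R q \<in> carrier (presented_algebra G R)"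
    using presented_class_hom(3)[OF R] q by auto
  have "presented_class G R p = presented_class G R ((p - q) + q)" by simp
  also have "\<dots> = presented_class G R (p - q) \<oplus>\<^bsub>presented_algebra G R\<^esub> presented_class G R q"
    by (rule presented_class_simps(1)[OF R]) (use p q in auto)
  also have "\<dots> = presented_class G R q"
    using mem by (simp add: presented_class_hom(4)[OF R assms(2)])
  finally show ?thesis .
qed

text \<open>The universal property of a presented algebra.\<close>

lemma (in free_rep) presented_lift_hom:
  assumes R: "R \<subseteq> carrier (free_algebra G)"
    and kill: "\<And>p x. \<lbrakk>p \<in> R; x \<in> W\<rbrakk> \<Longrightarrow> free_eval scl W \<phi> p x = 0"
  shows "p \<in> carrier (free_algebra G) \<Longrightarrow>
      presented_lift scl W \<phi> (presented_class G R p) = free_eval scl W \<phi> p"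
    and "presented_lift scl W \<phi> \<in> ring_hom (presented_algebra G R) (lin_End scl W)"
proof -
  interpret ring "free_algebra G" by (rule ring_free_algebra)
  interpret I: ideal "genideal (free_algebra G) R" "free_algebra G"
    by (rule genideal_ideal[OF R])
  interpret h: ring_hom_ring "free_algebra G" "lin_End scl W" ev
    by (rule ev_hom_ring)
  have "R \<subseteq> a_kernel FA (lin_End scl W) ev"
  proof
    fix p assume p: "p \<in> R"
    have "ev p = (\<lambda>x\<in>W. 0)"
      using kill[OF p] by (auto simp: fun_eq_iff free_eval_def)
    moreover have "\<zero>\<^bsub>lin_End scl W\<^esub> = (\<lambda>x\<in>W. 0)"
      by (simp only: lin_End_def ring_record_simps)
    ultimately have "ev p = \<zero>\<^bsub>lin_End scl W\<^esub>"
      by (simp only:)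
    then show "p \<in> a_kernel FA (lin_End scl W) ev"
      unfolding a_kernel_def' by (intro CollectI conjI subsetD[OF R p])
  qed
  then have ker: "genideal FA R \<subseteq> a_kernel FA (lin_End scl W) ev"
    by (rule genideal_minimal[OF h.kernel_is_ideal])
  have lift: "presented_lift scl W \<phi> (presented_class G R p) = free_eval scl W \<phi> p"
    if p: "p \<in> carrier FA" for p
  proof -
    have 1: "ev q = ev p" if "q \<in> presented_class G R p" for q
    proof -
      from that obtain h where h: "h \<in> genideal FA R" "q = h + p"
        unfolding presented_class_def a_r_coset_def' free_algebra_simps by blast
      then have "ev q = ev h \<oplus>\<^bsub>lin_End scl W\<^esub> ev p"
        using h.hom_add[OF I.a_Hcarr[OF h(1)] p] by (simp only: free_algebra_simps h(2))
      also have "ev h = \<zero>\<^bsub>lin_End scl W\<^esub>"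
        using h(1) ker unfolding a_kernel_def' by blast
      finally show ?thesis by (simp only: h.S.l_zero[OF h.hom_closed[OF p]])
    qed
    have "p \<in> presented_class G R p"
      unfolding presented_class_def by (rule I.a_rcos_self[OF p])
    with 1 have "ev ` presented_class G R p = {ev p}" by blast
    then show ?thesis by (simp only: presented_lift_def the_elem_eq)
  qed
  then show "p \<in> carrier (free_algebra G) \<Longrightarrow>
      presented_lift scl W \<phi> (presented_class G R p) = free_eval scl W \<phi> p" .
  let ?A = "presented_algebra G R" and ?L = "presented_lift scl W \<phi>"
  show "?L \<in> ring_hom ?A (lin_End scl W)"
  proof (rule ring_hom_memI)
    show "?L X \<in> carrier (lin_End scl W)" if "X \<in> carrier ?A" for X
      using that h.hom_closed lift unfolding presented_class_hom(3)[OF R] by force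
    show "?L (X \<otimes>\<^bsub>?A\<^esub> Y) = ?L X \<otimes>\<^bsub>lin_End scl W\<^esub> ?L Y"
      "?L (X \<oplus>\<^bsub>?A\<^esub> Y) = ?L X \<oplus>\<^bsub>lin_End scl W\<^esub> ?L Y"
      if XY: "X \<in> carrier ?A" "Y \<in> carrier ?A" for X Y
    proof -
      obtain p q where "p \<in> carrier FA" "q \<in> carrier FA"
        "X = presented_class G R p" "Y = presented_class G R q"
        using XY unfolding presented_class_hom(3)[OF R] by blast
      then show "?L (X \<otimes>\<^bsub>?A\<^esub> Y) = ?L X \<otimes>\<^bsub>lin_End scl W\<^esub> ?L Y"
        "?L (X \<oplus>\<^bsub>?A\<^esub> Y) = ?L X \<oplus>\<^bsub>lin_End scl W\<^esub> ?L Y"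
        using h.hom_mult[of p q] h.hom_add[of p q] lift[of "p * q"] lift[of "p + q"] lift[of p] lift[of q]
        by (simp_all only: presented_class_simps[OF R] free_algebra_simps free_algebra_closed)
    qed
    show "?L \<one>\<^bsub>?A\<^esub> = \<one>\<^bsub>lin_End scl W\<^esub>"
      using h.hom_one lift[of 1] presented_class_simps(3)[OF R, of 0 0]
      by (simp only: free_algebra_simps free_algebra_closed)
  qed
qed


section \<open>Operators on tensors\<close>

lemma vector_space_tensor: "vector_space tensor_scale"
  by standard (auto simp: tensor_scale_def fun_eq_iff algebra_simps)

lemma subspace_tensor_power: "module.subspace tensor_scale (tensor_power r)"
proof -
  interpret vector_space tensor_scale by (rule vector_space_tensor)
  show ?thesis
    by (rule subspaceI) (auto simp: tensor_power_def tensor_scale_def, metis add.right_neutral)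
qed

lemma tensor_powerD: "t \<in> tensor_power r \<Longrightarrow> length w \<noteq> r \<Longrightarrow> t w = 0"
  by (auto simp: tensor_power_def)

lemma tensor_powerI: "(\<And>w. length w \<noteq> r \<Longrightarrow> t w = 0) \<Longrightarrow> t \<in> tensor_power r"
  by (auto simp: tensor_power_def)

lemma pure_tensor_in: "length vs = r \<Longrightarrow> pure_tensor vs \<in> tensor_power r"
  by (auto simp: tensor_power_def pure_tensor_def)

lemma pure_tensor_Nil [simp]: "pure_tensor [] [] = 1"
  by (simp add: pure_tensor_def)

lemma pure_tensor_Cons [simp]: "pure_tensor (v # vs) (x # w) = v $ x * pure_tensor vs w"
  by (auto simp: pure_tensor_def prod.lessThan_Suc_shift simp del: prod.lessThan_Suc)

lemma pure_tensor_append: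
  "length u = length vs \<Longrightarrow> pure_tensor (vs @ ws) (u @ w) = pure_tensor vs u * pure_tensor ws w"
  by (induction u vs rule: list_induct2) auto

lemma pure_tensor_neq_length: "length w \<noteq> length vs \<Longrightarrow> pure_tensor vs w = 0"
  by (simp add: pure_tensor_def)

lemma split1: "k < length w \<Longrightarrow> \<exists>u x v. w = u @ x # v \<and> length u = k"
  by (metis id_take_nth_drop length_take min.absorb4)

lemma split2: "k + 1 < length w \<Longrightarrow> \<exists>u x y v. w = u @ x # y # v \<and> length u = k"
proof -
  assume a: "k + 1 < length w"
  then obtain u x v where w: "w = u @ x # v" "length u = k" using split1[of k w] by auto
  with a obtain y v' where "v = y # v'" by (cases v) auto
  with w show ?thesis by blast
qed

lemma split3: "k + 2 < length w \<Longrightarrow> \<exists>u x y z v. w = u @ x # y # z # v \<and> length u = k"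
proof -
  assume a: "k + 2 < length w"
  then obtain u x y v where w: "w = u @ x # y # v" "length u = k" using split2[of k w] by auto
  with a obtain z v' where "v = z # v'" by (cases v) auto
  with w show ?thesis by blast
qed

lemma on_factor_at: "length u = k \<Longrightarrow>
    on_factor k f t (u @ x # v) = (\<Sum>a\<in>UNIV. f (axis a 1) $ x * t (u @ a # v))"
  by (auto simp: on_factor_def)

lemma swap_factors_at: "length u = k \<Longrightarrow> swap_factors k t (u @ x # y # v) = t (u @ y # x # v)"
  by (auto simp: swap_factors_def list_update_append nth_append)

lemma contract_factors_at: "length u = k \<Longrightarrow>
    contract_factors \<beta> b b' k t (u @ x # y # v) =
    (\<Sum>a\<in>UNIV. \<Sum>c\<in>UNIV. \<beta> (axis a 1) (axis c 1) * t (u @ a # c # v)) * (\<Sum>j\<in>UNIV. b j $ x * b' j $ y)"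
  by (auto simp: contract_factors_def list_update_append nth_append)

lemma vec3_expand: "(v::complex^3) = (\<Sum>a\<in>UNIV. v $ a *s axis a 1)"
  using basis_expansion[of v] by simp

lemma linear_expand:
  assumes "Vector_Spaces.linear (*s) scl f"
  shows "f (v::complex^3) = (\<Sum>a\<in>UNIV. scl (v $ a) (f (axis a 1)))"
proof -
  interpret Vector_Spaces.linear "(*s)" scl f by (rule assms)
  show ?thesis by (subst vec3_expand) (simp add: sum scale)
qed

lemma on_factor_pure:
  assumes f: "Vector_Spaces.linear (*s) (*s) f" and k: "k < length vs"
  shows "on_factor k f (pure_tensor vs) = pure_tensor (vs[k := f (vs ! k)])"
proof
  fix w :: "3 list"
  obtain us v ws where vs: "vs = us @ v # ws" "length us = k" using split1[OF k] by auto
  show "on_factor k f (pure_tensor vs) w = pure_tensor (vs[k := f (vs ! k)]) w"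
  proof (cases "length w = length vs")
    case True
    with k obtain u x v' where w: "w = u @ x # v'" "length u = k" using split1[of k w] by auto
    have "f v $ x = (\<Sum>a\<in>UNIV. v $ a * f (axis a 1) $ x)"
      by (subst linear_expand[OF f]) simp
    then show ?thesis
      by (simp add: w vs on_factor_at pure_tensor_append sum_distrib_left sum_distrib_right mult_ac
          list_update_append nth_append)
  qed (simp add: pure_tensor_neq_length on_factor_def)
qed

lemma swap_factors_pure:
  assumes k: "k + 1 < length vs"
  shows "swap_factors k (pure_tensor vs) = pure_tensor (vs[k := vs ! (k + 1), k + 1 := vs ! k])"
proof
  fix w :: "3 list"
  obtain us v v' ws where vs: "vs = us @ v # v' # ws" "length us = k" using split2[OF k] by auto
  show "swap_factors k (pure_tensor vs) w = pure_tensor (vs[k := vs ! (k + 1), k + 1 := vs ! k]) w"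
  proof (cases "length w = length vs")
    case True
    with k obtain u x y z where w: "w = u @ x # y # z" "length u = k" using split2[of k w] by auto
    show ?thesis
      by (simp add: w vs swap_factors_at pure_tensor_append list_update_append nth_append mult_ac)
  qed (simp add: pure_tensor_neq_length swap_factors_def)
qed

lemma sum_apply: "(\<Sum>i\<in>I. F i) x = (\<Sum>i\<in>I. F i x)"
  by (induction I rule: infinite_finite_induct) auto

lemma contract_factors_pure:
  assumes \<beta>: "\<And>v. Vector_Spaces.linear (*s) (*) (\<beta> v)" "\<And>w. Vector_Spaces.linear (*s) (*) (\<lambda>v. \<beta> v w)"
    and k: "k + 1 < length vs"
  shows "contract_factors \<beta> b b' k (pure_tensor vs) =
    tensor_scale (\<beta> (vs ! k) (vs ! (k + 1))) (\<Sum>j\<in>UNIV. pure_tensor (vs[k := b j, k + 1 := b' j]))"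
proof
  fix w :: "3 list"
  obtain us v v' ws where vs: "vs = us @ v # v' # ws" "length us = k" using split2[OF k] by auto
  have \<beta>vv': "\<beta> v v' = (\<Sum>a\<in>UNIV. \<Sum>c\<in>UNIV. \<beta> (axis a 1) (axis c 1) * (v $ a * v' $ c))"
    by (subst linear_expand[OF \<beta>(2)], subst linear_expand[OF \<beta>(1)])
      (simp add: sum_distrib_left mult_ac)
  show "contract_factors \<beta> b b' k (pure_tensor vs) w =
    tensor_scale (\<beta> (vs ! k) (vs ! (k + 1))) (\<Sum>j\<in>UNIV. pure_tensor (vs[k := b j, k + 1 := b' j])) w"
  proof (cases "length w = length vs")
    case True
    with k obtain u x y z where w: "w = u @ x # y # z" "length u = k" using split2[of k w] by auto
    have "(\<Sum>a\<in>UNIV. \<Sum>c\<in>UNIV. \<beta> (axis a 1) (axis c 1) * pure_tensor vs (u @ a # c # z)) =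
      \<beta> v v' * (pure_tensor us u * pure_tensor ws z)"
      by (simp add: w vs pure_tensor_append \<beta>vv' sum_distrib_left sum_distrib_right mult_ac)
    then have "contract_factors \<beta> b b' k (pure_tensor vs) w =
      \<beta> v v' * (pure_tensor us u * pure_tensor ws z) * (\<Sum>j\<in>UNIV. b j $ x * b' j $ y)"
      by (simp add: w contract_factors_at)
    also have "\<dots> = tensor_scale (\<beta> v v') (\<Sum>j\<in>UNIV. pure_tensor (vs[k := b j, k + 1 := b' j])) w"
      by (simp add: tensor_scale_def sum_apply w vs pure_tensor_append list_update_append sum_distrib_left mult_ac)
    finally show ?thesis by (simp add: vs nth_append)
  qed (simp add: pure_tensor_neq_length contract_factors_def tensor_scale_def sum_apply)
qed


section \<open>The Brauer relations hold on tensors\<close>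

lemma swap_factors_W: "t \<in> tensor_power r \<Longrightarrow> swap_factors k t \<in> tensor_power r"
  by (rule tensor_powerI) (simp add: swap_factors_def tensor_powerD)

lemma contract_factors_W: "t \<in> tensor_power r \<Longrightarrow> contract_factors \<beta> b b' k t \<in> tensor_power r"
  by (rule tensor_powerI) (simp add: contract_factors_def tensor_powerD)

lemma on_factor_W: "t \<in> tensor_power r \<Longrightarrow> on_factor k f t \<in> tensor_power r"
  by (rule tensor_powerI) (simp add: on_factor_def tensor_powerD)

lemma swap_factors_linear:
  "swap_factors k (s + t) = swap_factors k s + swap_factors k t"
  "swap_factors k (tensor_scale c t) = tensor_scale c (swap_factors k t)"
  by (auto simp: swap_factors_def tensor_scale_def fun_eq_iff)

lemma contract_factors_linear:
  "contract_factors \<beta> b b' k (s + t) = contract_factors \<beta> b b' k s + contract_factors \<beta> b b' k t"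
  "contract_factors \<beta> b b' k (tensor_scale c t) = tensor_scale c (contract_factors \<beta> b b' k t)"
  by (auto simp: contract_factors_def tensor_scale_def fun_eq_iff algebra_simps sum.distrib sum_distrib_left)

lemma on_factor_linear:
  "on_factor k f (s + t) = on_factor k f s + on_factor k f t"
  "on_factor k f (tensor_scale c t) = tensor_scale c (on_factor k f t)"
  by (auto simp: on_factor_def tensor_scale_def fun_eq_iff algebra_simps sum.distrib sum_distrib_left)

lemma on_factor_0: "on_factor k f 0 = 0"
  by (auto simp: on_factor_def fun_eq_iff)

lemma on_factor_sum: "on_factor k f (\<Sum>i\<in>I. F i) = (\<Sum>i\<in>I. on_factor k f (F i))"
  by (induction I rule: infinite_finite_induct)
    (simp_all only: sum.infinite sum.empty sum.insert on_factor_linear on_factor_0 not_False_eq_True)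

lemma tensor_power_eqI:
  assumes "s \<in> tensor_power r" "t \<in> tensor_power r" "\<And>w. length w = r \<Longrightarrow> s w = t w"
  shows "s = t"
  using assms by (metis tensor_powerD ext)

lemma tensor_power_eqI2:
  assumes "k + 1 < r" "s \<in> tensor_power r" "t \<in> tensor_power r"
    and "\<And>u x y v. length u = k \<Longrightarrow> s (u @ x # y # v) = t (u @ x # y # v)"
  shows "s = t"
  using assms(2,3)
proof (rule tensor_power_eqI)
  fix w :: "3 list" assume "length w = r"
  with assms(1) obtain u x y v where "w = u @ x # y # v" "length u = k"
    using split2[of k w] by auto
  then show "s w = t w" using assms(4) by blast
qed

lemma tensor_power_eqI3:
  assumes "k + 2 < r" "s \<in> tensor_power r" "t \<in> tensor_power r"
    and "\<And>u x y z v. length u = k \<Longrightarrow> s (u @ x # y # z # v) = t (u @ x # y # z # v)"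
  shows "s = t"
  using assms(2,3)
proof (rule tensor_power_eqI)
  fix w :: "3 list" assume "length w = r"
  with assms(1) obtain u x y z v where "w = u @ x # y # z # v" "length u = k"
    using split3[of k w] by auto
  then show "s w = t w" using assms(4) by blast
qed

lemma brauer_gen_mem [simp]:
  "i \<in> {1..<r} \<Longrightarrow> sg i \<in> carrier (free_algebra (brauer_gens r))"
  "i \<in> {1..<r} \<Longrightarrow> eg i \<in> carrier (free_algebra (brauer_gens r))"
  by (auto simp: brauer_gens_def)

lemma brauer_relators_carrier: "brauer_relators r \<delta> \<subseteq> carrier (free_algebra (brauer_gens r))"
proof
  fix p assume "p \<in> brauer_relators r \<delta>"
  then show "p \<in> carrier (free_algebra (brauer_gens r))"
    by cases (auto intro!: free_algebra_diff free_algebra_closed brauer_gen_mem)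
qed

lemma sum_swap3:
  "(\<Sum>x\<in>X. \<Sum>c\<in>C. \<Sum>d\<in>D. G x c d) = (\<Sum>c\<in>C. \<Sum>d\<in>D. \<Sum>x\<in>X. G x c d)"
  by (subst sum.swap, intro sum.cong refl, subst sum.swap, rule refl)

lemma sum_swap4:
  "(\<Sum>a\<in>A. \<Sum>b\<in>B. \<Sum>c\<in>C. \<Sum>d\<in>D. F a b c d) = (\<Sum>c\<in>C. \<Sum>d\<in>D. \<Sum>a\<in>A. \<Sum>b\<in>B. F a b c d)"
proof -
  have "(\<Sum>a\<in>A. \<Sum>b\<in>B. \<Sum>c\<in>C. \<Sum>d\<in>D. F a b c d) = (\<Sum>a\<in>A. \<Sum>c\<in>C. \<Sum>d\<in>D. \<Sum>b\<in>B. F a b c d)"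
    by (rule sum.cong[OF refl], rule sum_swap3)
  also have "\<dots> = (\<Sum>c\<in>C. \<Sum>d\<in>D. \<Sum>a\<in>A. \<Sum>b\<in>B. F a b c d)"
    by (rule sum_swap3)
  finally show ?thesis .
qed

locale form =
  fixes \<beta> :: "complex^3 \<Rightarrow> complex^3 \<Rightarrow> complex" and b b' :: "3 \<Rightarrow> complex^3"
  assumes lin: "\<And>v. Vector_Spaces.linear (*s) (*) (\<beta> v)" "\<And>w. Vector_Spaces.linear (*s) (*) (\<lambda>v. \<beta> v w)"
    and sym: "\<And>v w. \<beta> v w = \<beta> w v"
    and dual: "dual_bases \<beta> b b'"
begin

definition M where "M a c = \<beta> (axis a 1) (axis c 1)"
definition N where "N x y = (\<Sum>j\<in>UNIV. b j $ x * b' j $ y)"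

abbreviation ct where "ct \<equiv> contract_factors \<beta> b b'"

lemma form_expand: "\<beta> v w = (\<Sum>a\<in>UNIV. \<Sum>c\<in>UNIV. v $ a * M a c * w $ c)"
  by (subst linear_expand[OF lin(2)], subst linear_expand[OF lin(1)])
    (simp add: sum_distrib_left mult_ac M_def)

lemma M_sym: "M a c = M c a"
  unfolding M_def by (rule sym)

lemma MN_matrices:
  shows "(\<chi> x y. N y x) ** (\<chi> a c. M a c) = mat 1" "(\<chi> a c. M a c) ** (\<chi> x y. N y x) = mat 1"
proof -
  let ?B = "(\<chi> j a. b j $ a) :: complex^3^3" and ?B' = "(\<chi> a k. b' k $ a) :: complex^3^3"
  let ?M = "(\<chi> a c. M a c) :: complex^3^3"
  have "(?B ** ?M) ** ?B' = mat 1"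
  proof -
    have "((?B ** ?M) ** ?B') $ j $ k = \<beta> (b j) (b' k)" for j k
      by (simp add: matrix_matrix_mult_def form_expand sum_distrib_right) (rule sum.swap)
    then show ?thesis
      using dual by (simp add: vec_eq_iff mat_def dual_bases_def)
  qed
  then have "?B' ** (?B ** ?M) = mat 1"
    by (simp add: matrix_left_right_inverse)
  moreover have "?B' ** ?B = (\<chi> x y. N y x)"
    by (simp add: vec_eq_iff matrix_matrix_mult_def N_def mult.commute)
  ultimately show 1: "(\<chi> x y. N y x) ** ?M = mat 1"
    by (simp add: matrix_mul_assoc)
  then show "?M ** (\<chi> x y. N y x) = mat 1"
    by (simp add: matrix_left_right_inverse)
qed

lemma N_sym: "N x y = N y x"
proof -
  let ?Q = "(\<chi> x y. N y x) :: complex^3^3" and ?M = "(\<chi> a c. M a c) :: complex^3^3"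
  have M: "transpose ?M = ?M" using M_sym by (simp add: vec_eq_iff transpose_def)
  have "?M ** transpose ?Q = mat 1"
    using MN_matrices(1) by (metis M matrix_transpose_mul transpose_mat)
  then have "?Q = ?Q ** (?M ** transpose ?Q)" by simp
  also have "\<dots> = transpose ?Q"
    using MN_matrices(1) by (simp add: matrix_mul_assoc)
  finally show ?thesis by (simp add: vec_eq_iff transpose_def)
qed

lemma MN: "(\<Sum>c\<in>UNIV. M a c * N c z) = (if a = z then 1 else 0)"
proof -
  have "(\<Sum>c\<in>UNIV. M a c * N z c) = (if a = z then 1 else 0)"
    using MN_matrices(2) by (simp add: vec_eq_iff matrix_matrix_mult_def mat_def)
  then show ?thesis by (simp only: N_sym[of z])
qed

lemma NM: "(\<Sum>c\<in>UNIV. N a c * M c z) = (if a = z then 1 else 0)"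
proof -
  have "(\<Sum>c\<in>UNIV. N c a * M c z) = (if a = z then 1 else 0)"
    using MN_matrices(1) by (simp add: vec_eq_iff matrix_matrix_mult_def mat_def)
  then show ?thesis by (simp only: N_sym[of a])
qed

lemma MN_sum: "(\<Sum>a\<in>UNIV. \<Sum>c\<in>UNIV. M a c * (N c z * f a)) = f z"
proof -
  have "(\<Sum>a\<in>UNIV. \<Sum>c\<in>UNIV. M a c * (N c z * f a)) = (\<Sum>a\<in>UNIV. (\<Sum>c\<in>UNIV. M a c * N c z) * f a)"
    by (simp add: sum_distrib_left sum_distrib_right mult_ac)
  then show ?thesis by (simp add: MN if_distrib[where f = "\<lambda>x. x * _"] cong: if_cong)
qed

lemma NM_sum: "(\<Sum>a\<in>UNIV. \<Sum>c\<in>UNIV. M a c * (N x a * f c)) = f x"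
proof -
  have "(\<Sum>a\<in>UNIV. \<Sum>c\<in>UNIV. M a c * (N x a * f c)) = (\<Sum>c\<in>UNIV. (\<Sum>a\<in>UNIV. N x a * M a c) * f c)"
    by (subst sum.swap) (simp add: sum_distrib_left sum_distrib_right mult_ac)
  then show ?thesis by (simp add: NM if_distrib[where f = "\<lambda>x. x * _"] cong: if_cong)
qed

definition S where "S t u v = (\<Sum>a\<in>UNIV. \<Sum>c\<in>UNIV. M a c * t (u @ a # c # v))"

lemma ct_at: "length u = k \<Longrightarrow> ct k t (u @ x # y # v) = N x y * S t u v"
  by (simp add: contract_factors_at N_def S_def M_def)

lemma ct_at1: "length u = k \<Longrightarrow> ct (Suc k) t (u @ x # y # z # v) = N y z * S t (u @ [x]) v"
  using ct_at[of "u @ [x]" "Suc k" t y z v] by simp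

lemma sw_at1: "length u = k \<Longrightarrow> swap_factors (Suc k) t (u @ x # y # z # v) = t (u @ x # z # y # v)"
  using swap_factors_at[of "u @ [x]" "Suc k" t y z v] by simp

lemma two_factor_relations:
  assumes "k + 1 < r" "t \<in> tensor_power r"
  shows "swap_factors k (swap_factors k t) = t"
    and "ct k (ct k t) = tensor_scale 3 (ct k t)"
    and "swap_factors k (ct k t) = ct k t"
    and "ct k (swap_factors k t) = ct k t"
proof -
  note W = swap_factors_W contract_factors_W assms(2)
  have W3: "tensor_scale 3 (ct k t) \<in> tensor_power r"
    using contract_factors_W[OF assms(2)] by (auto simp: tensor_power_def tensor_scale_def)
  have 3: "(\<Sum>a\<in>UNIV. \<Sum>c\<in>UNIV. M a c * N a c) = 3"
  proof -
    have "(\<Sum>c\<in>UNIV. M a c * N a c) = 1" for a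
      using MN[of a a] by (simp only: N_sym[of a] simp_thms if_True)
    then show ?thesis by simp
  qed
  have S_ct: "S (ct k t) u v = 3 * S t u v" if "length u = k" for u v
    using that by (simp add: S_def[of "ct k t"] ct_at sum_distrib_right[symmetric] mult.assoc[symmetric] 3)
  have S_sw: "S (swap_factors k t) u v = S t u v" if "length u = k" for u v
    using that unfolding S_def
    by (subst sum.swap) (simp add: swap_factors_at M_sym)
  show "swap_factors k (swap_factors k t) = t"
    by (rule tensor_power_eqI2[OF assms(1)]) (use W in \<open>simp_all add: swap_factors_at\<close>)
  show "ct k (ct k t) = tensor_scale 3 (ct k t)"
    by (rule tensor_power_eqI2[OF assms(1)]) (use W W3 in \<open>simp_all add: ct_at S_ct tensor_scale_def\<close>)
  show "swap_factors k (ct k t) = ct k t"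
    by (rule tensor_power_eqI2[OF assms(1)]) (use W in \<open>simp_all add: ct_at swap_factors_at N_sym\<close>)
  show "ct k (swap_factors k t) = ct k t"
    by (rule tensor_power_eqI2[OF assms(1)]) (use W in \<open>simp_all add: ct_at S_sw\<close>)
qed

lemma far_relations:
  assumes "k + 2 \<le> l"
  shows "swap_factors k (swap_factors l t) = swap_factors l (swap_factors k t)"
    and "swap_factors k (ct l t) = ct l (swap_factors k t)"
    and "swap_factors l (ct k t) = ct k (swap_factors l t)"
    and "ct k (ct l t) = ct l (ct k t)"
proof -
  have ne: "k \<noteq> l" "Suc k \<noteq> l" "k \<noteq> Suc l" "l \<noteq> k" "l \<noteq> Suc k" "Suc l \<noteq> k" "Suc k \<noteq> Suc l"
    using assms by auto
  have upd: "w[l := p, Suc l := q, k := x, Suc k := y] = w[k := x, Suc k := y, l := p, Suc l := q]"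
    for w :: "3 list" and p q x y
    using ne by (metis list_update_swap)
  show "swap_factors k (swap_factors l t) = swap_factors l (swap_factors k t)"
    using ne by (auto simp: swap_factors_def fun_eq_iff upd)
  show "swap_factors k (ct l t) = ct l (swap_factors k t)"
    using ne by (auto simp: swap_factors_def contract_factors_def fun_eq_iff upd)
  show "swap_factors l (ct k t) = ct k (swap_factors l t)"
    using ne by (auto simp: swap_factors_def contract_factors_def fun_eq_iff upd)
  show "ct k (ct l t) = ct l (ct k t)"
  proof
    fix w
    define K where "K i f w = (\<Sum>a\<in>UNIV. \<Sum>c\<in>UNIV. M a c * f (w[i := a, Suc i := c]))"
      for i and f :: tensor and w :: "3 list"
    have ctK: "ct i f w = K i f w * N (w ! i) (w ! Suc i)" for i f w
      by (simp add: contract_factors_def K_def M_def N_def)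
    have 1: "K k (ct l t) w = K k (K l t) w * N (w ! l) (w ! Suc l)"
      using ne by (simp add: K_def[of k] ctK sum_distrib_left sum_distrib_right mult_ac)
    have 2: "K l (ct k t) w = K l (K k t) w * N (w ! k) (w ! Suc k)"
      using ne by (simp add: K_def[of l] ctK sum_distrib_left sum_distrib_right mult_ac)
    let ?s = "\<lambda>a c a' c'. M a c * (M a' c' * t (w[k := a, Suc k := c, l := a', Suc l := c']))"
    have "K k (K l t) w = (\<Sum>a\<in>UNIV. \<Sum>c\<in>UNIV. \<Sum>a'\<in>UNIV. \<Sum>c'\<in>UNIV. ?s a c a' c')"
      by (simp add: K_def sum_distrib_left)
    also have "\<dots> = (\<Sum>a'\<in>UNIV. \<Sum>c'\<in>UNIV. \<Sum>a\<in>UNIV. \<Sum>c\<in>UNIV. ?s a c a' c')"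
      by (rule sum_swap4)
    also have "\<dots> = K l (K k t) w"
      by (simp add: K_def sum_distrib_left upd mult_ac)
    finally show "ct k (ct l t) w = ct l (ct k t) w"
      by (simp add: ctK 1 2 mult_ac)
  qed
qed

lemma three_factor_relations:
  assumes "k + 2 < r" "t \<in> tensor_power r"
  shows "swap_factors k (swap_factors (Suc k) (swap_factors k t)) =
      swap_factors (Suc k) (swap_factors k (swap_factors (Suc k) t))"
    and "ct k (ct (Suc k) (ct k t)) = ct k t"
    and "ct (Suc k) (ct k (ct (Suc k) t)) = ct (Suc k) t"
    and "swap_factors k (ct (Suc k) (ct k t)) = swap_factors (Suc k) (ct k t)"
    and "ct (Suc k) (ct k (swap_factors (Suc k) t)) = ct (Suc k) (swap_factors k t)"
proof -
  note W = swap_factors_W contract_factors_W assms(2)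
  have 3: "S (ct k f) (u @ [y]) v = S f u (y # v)" if "length u = k" for f u y v
    using that by (simp add: S_def[of "ct k f"] ct_at NM_sum)
  have five: "S (ct (Suc k) f) u (y # v) = S f (u @ [y]) v" if "length u = k" for f u y v
    using that by (simp add: S_def[of "ct (Suc k) f"] ct_at1 MN_sum)
  have 1: "S (ct (Suc k) (ct k t)) u (z # v) = S t u (z # v)" if "length u = k" for u z v
    using that by (simp add: 3 five)
  have 2: "S (ct k (ct (Suc k) t)) (u @ [x]) v = S t (u @ [x]) v" if "length u = k" for u x v
    using that by (simp add: 3 five)
  have 4: "S (ct k (swap_factors (Suc k) t)) (u @ [x]) v = S (swap_factors k t) (u @ [x]) v"
    if "length u = k" for u x v
    using that by (simp add: 3) (simp add: S_def swap_factors_at sw_at1)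
  show "swap_factors k (swap_factors (Suc k) (swap_factors k t)) =
      swap_factors (Suc k) (swap_factors k (swap_factors (Suc k) t))"
    by (rule tensor_power_eqI3[OF assms(1)]) (use W in \<open>simp_all add: swap_factors_at sw_at1\<close>)
  show "ct k (ct (Suc k) (ct k t)) = ct k t"
    by (rule tensor_power_eqI3[OF assms(1)]) (use W in \<open>simp_all add: ct_at 1\<close>)
  show "ct (Suc k) (ct k (ct (Suc k) t)) = ct (Suc k) t"
    by (rule tensor_power_eqI3[OF assms(1)]) (use W in \<open>simp_all add: ct_at1 2\<close>)
  show "swap_factors k (ct (Suc k) (ct k t)) = swap_factors (Suc k) (ct k t)"
    by (rule tensor_power_eqI3[OF assms(1)])
      (use W in \<open>simp_all add: swap_factors_at sw_at1 ct_at ct_at1 3\<close>)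
  show "ct (Suc k) (ct k (swap_factors (Suc k) t)) = ct (Suc k) (swap_factors k t)"
    by (rule tensor_power_eqI3[OF assms(1)]) (use W in \<open>simp_all add: ct_at1 4\<close>)
qed

lemma free_rep_eta: "free_rep tensor_scale (tensor_power r) (brauer_gens r) (eta_gen \<beta> b b')"
  by (rule free_rep.intro[OF vector_space_tensor subspace_tensor_power])
    (auto simp: brauer_gens_def swap_factors_W contract_factors_W swap_factors_linear contract_factors_linear)

lemma eta_relations:
  assumes p: "p \<in> brauer_relators r 3" and t: "t \<in> tensor_power r"
  shows "free_eval tensor_scale (tensor_power r) (eta_gen \<beta> b b') p t = 0"
proof -
  interpret R: free_rep tensor_scale "tensor_power r" "brauer_gens r" "eta_gen \<beta> b b'"
    by (rule free_rep_eta)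
  note W = t swap_factors_W contract_factors_W R.ev_mult R.ev_W free_algebra_closed(3,7)
  have gW: "eta_gen \<beta> b b' g f \<in> tensor_power r" if "f \<in> tensor_power r" for f g
    using that by (cases g) (auto simp: swap_factors_W contract_factors_W)
  have far: "\<exists>k l. (i = Suc k \<and> j = Suc l) \<and> (k + 2 \<le> l \<or> l + 2 \<le> k)"
    if "i \<in> {1..<r}" "j \<in> {1..<r}" "i + 2 \<le> j \<or> j + 2 \<le> i" for i j
    using that by (intro exI[of _ "i - 1"] exI[of _ "j - 1"]) auto
  show ?thesis
    using p
  proof cases
    case (ss i)
    then show ?thesis using two_factor_relations[of "i - 1" r t] t by (simp add: gW swap_factors_W contract_factors_W)
  next
    case (ee i)
    then show ?thesis using two_factor_relations[of "i - 1" r t] t by (simp add: gW swap_factors_W contract_factors_W)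
  next
    case (se i)
    then show ?thesis using two_factor_relations[of "i - 1" r t] t by (simp add: gW swap_factors_W contract_factors_W)
  next
    case (es i)
    then show ?thesis using two_factor_relations[of "i - 1" r t] t by (simp add: gW swap_factors_W contract_factors_W)
  next
    case (ss_far i j)
    with far[of i j] far_relations[of "i - 1" "j - 1" t] far_relations[of "j - 1" "i - 1" t] t
    show ?thesis by (auto simp: gW swap_factors_W contract_factors_W)
  next
    case (se_far i j)
    with far[of i j] far_relations[of "i - 1" "j - 1" t] far_relations[of "j - 1" "i - 1" t] t
    show ?thesis by (auto simp: gW swap_factors_W contract_factors_W)
  next
    case (ee_far i j)
    with far[of i j] far_relations[of "i - 1" "j - 1" t] far_relations[of "j - 1" "i - 1" t] t
    show ?thesis by (auto simp: gW swap_factors_W contract_factors_W)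
  next
    case (sss i)
    then show ?thesis using three_factor_relations[of "i - 1" r t] t by (simp add: gW swap_factors_W contract_factors_W)
  next
    case (eee i j)
    then show ?thesis
      using three_factor_relations[of "i - 1" r t] three_factor_relations[of "j - 1" r t] t
      by (auto simp: gW swap_factors_W contract_factors_W)
  next
    case (see i)
    then show ?thesis using three_factor_relations[of "i - 1" r t] t
      by (simp add: gW swap_factors_W contract_factors_W)
  next
    case (ees i)
    then show ?thesis using three_factor_relations[of "i - 1" r t] t
      by (simp add: gW swap_factors_W contract_factors_W)
  qed
qed

lemma eta_lift:
  shows "p \<in> carrier (free_algebra (brauer_gens r)) \<Longrightarrow>
      eta \<beta> b b' r (brauer_class r 3 p) = free_eval tensor_scale (tensor_power r) (eta_gen \<beta> b b') p"
    and "eta \<beta> b b' r \<in> ring_hom (brauer_algebra r 3) (lin_End tensor_scale (tensor_power r))"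
  unfolding eta_def brauer_class_def brauer_algebra_def
  by (rule free_rep.presented_lift_hom[OF free_rep_eta brauer_relators_carrier eta_relations]; assumption)+

end

section \<open>The action of \<^const>\<open>Usl2\<close> on tensors, and \<open>\<eta>\<close> as a homomorphism into \<open>E(r)\<close>\<close>

lemma sl2_closed:
  "\<lbrakk>A \<in> sl2; B \<in> sl2\<rbrakk> \<Longrightarrow> A + B \<in> sl2"
  "A \<in> sl2 \<Longrightarrow> (\<chi> i j. c * A $ i $ j) \<in> sl2"
  "A ** B - B ** A \<in> sl2"
proof -
  show "\<lbrakk>A \<in> sl2; B \<in> sl2\<rbrakk> \<Longrightarrow> A + B \<in> sl2" by (simp add: sl2_def trace_add)
  show "A \<in> sl2 \<Longrightarrow> (\<chi> i j. c * A $ i $ j) \<in> sl2"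
    by (simp add: sl2_def trace_def sum_distrib_left[symmetric])
  show "A ** B - B ** A \<in> sl2"
    unfolding sl2_def mem_Collect_eq trace_sub trace_mul_sym[of A B] by (rule diff_self)
qed

lemma Usl2_relators_carrier: "Usl2_relators \<subseteq> carrier (free_algebra sl2)"
proof
  fix p assume "p \<in> Usl2_relators"
  then show "p \<in> carrier (free_algebra sl2)"
  proof cases
    case (add A B)
    show ?thesis unfolding add(1)
      by (intro free_algebra_diff free_algebra_closed sl2_closed add(2,3))
  next
    case (scale A c)
    show ?thesis unfolding scale(1)
      by (intro free_algebra_diff free_algebra_closed sl2_closed scale(2))
  next
    case (bracket A B)
    show ?thesis unfolding bracket(1)
      by (intro free_algebra_diff free_algebra_closed sl2_closed bracket(2,3))
  qed
qed

lemma Usl2_class_gen_mem: "A \<in> sl2 \<Longrightarrow> Usl2_class (gen A) \<in> carrier Usl2"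
  unfolding Usl2_class_def Usl2_def
  by (simp add: presented_class_hom(3)[OF Usl2_relators_carrier])

locale V1_module =
  fixes \<pi> :: "(complex^2^2) ncpoly set \<Rightarrow> complex^3 \<Rightarrow> complex^3"
  assumes mod: "Usl2_module (*s) UNIV \<pi>"
begin

abbreviation act where "act A \<equiv> \<pi> (Usl2_class (gen A))"

lemma \<pi>_hom: "\<pi> \<in> ring_hom Usl2 (lin_End (*s) UNIV)"
  and \<pi>_const: "\<pi> (Usl2_class (const c)) = (\<lambda>v. c *s v)"
  using mod by (auto simp: Usl2_module_def)

lemma \<pi>_class:
  assumes "p \<in> carrier (free_algebra sl2)" "q \<in> carrier (free_algebra sl2)"
  shows "\<pi> (Usl2_class (p + q)) v = \<pi> (Usl2_class p) v + \<pi> (Usl2_class q) v"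
    and "\<pi> (Usl2_class (p * q)) v = \<pi> (Usl2_class p) (\<pi> (Usl2_class q) v)"
proof -
  have c: "Usl2_class p \<in> carrier Usl2" "Usl2_class q \<in> carrier Usl2"
    using assms by (auto simp: Usl2_class_def Usl2_def presented_class_hom(3)[OF Usl2_relators_carrier])
  have "\<pi> (Usl2_class (p + q)) = \<pi> (Usl2_class p) \<oplus>\<^bsub>lin_End (*s) UNIV\<^esub> \<pi> (Usl2_class q)"
    "\<pi> (Usl2_class (p * q)) = \<pi> (Usl2_class p) \<otimes>\<^bsub>lin_End (*s) UNIV\<^esub> \<pi> (Usl2_class q)"
    using ring_hom_add[OF \<pi>_hom c] ring_hom_mult[OF \<pi>_hom c]
      presented_class_simps[OF Usl2_relators_carrier assms]
    by (simp_all add: Usl2_def Usl2_class_def)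
  then show "\<pi> (Usl2_class (p + q)) v = \<pi> (Usl2_class p) v + \<pi> (Usl2_class q) v"
    "\<pi> (Usl2_class (p * q)) v = \<pi> (Usl2_class p) (\<pi> (Usl2_class q) v)"
    by (simp_all add: lin_End_def compose_def)
qed

lemma \<pi>_diff:
  assumes "p \<in> carrier (free_algebra sl2)" "q \<in> carrier (free_algebra sl2)"
  shows "\<pi> (Usl2_class (p - q)) v = \<pi> (Usl2_class p) v - \<pi> (Usl2_class q) v"
  using \<pi>_class(1)[OF free_algebra_diff[OF assms] assms(2), of v] by simp

lemma \<pi>_eq: "p - q \<in> Usl2_relators \<Longrightarrow> p \<in> carrier (free_algebra sl2) \<Longrightarrow>
    q \<in> carrier (free_algebra sl2) \<Longrightarrow> Usl2_class p = Usl2_class q"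
  unfolding Usl2_class_def by (rule presented_class_eqI[OF Usl2_relators_carrier])

lemma act_linear: "A \<in> sl2 \<Longrightarrow> Vector_Spaces.linear (*s) (*s) (act A)"
proof -
  assume "A \<in> sl2"
  then have "act A \<in> carrier (lin_End (*s) UNIV)"
    using ring_hom_closed[OF \<pi>_hom] Usl2_class_gen_mem by blast
  then show ?thesis
    by (intro Vector_Spaces.linear.intro vec.vector_space_axioms)
      (auto simp: lin_End_def module_hom_axioms_def module_hom_def vec.module_axioms)
qed

lemma act_add: "\<lbrakk>A \<in> sl2; B \<in> sl2\<rbrakk> \<Longrightarrow> act (A + B) v = act A v + act B v"
proof -
  assume "A \<in> sl2" "B \<in> sl2"
  then have "Usl2_class (gen (A + B)) = Usl2_class (gen A + gen B)"
    by (intro \<pi>_eq Usl2_relators.add free_algebra_closed sl2_closed)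
  then show ?thesis
    using \<open>A \<in> sl2\<close> \<open>B \<in> sl2\<close> by (simp only: \<pi>_class(1) free_algebra_closed)
qed

lemma act_scale: "A \<in> sl2 \<Longrightarrow> act (\<chi> i j. c * A $ i $ j) v = c *s act A v"
proof -
  assume A: "A \<in> sl2"
  then have "Usl2_class (gen (\<chi> i j. c * A $ i $ j)) = Usl2_class (const c * gen A)"
    by (intro \<pi>_eq Usl2_relators.scale free_algebra_closed sl2_closed)
  then show ?thesis
    using A by (simp only: \<pi>_class(2) \<pi>_const free_algebra_closed)
qed

lemma act_bracket: "\<lbrakk>A \<in> sl2; B \<in> sl2\<rbrakk> \<Longrightarrow> act (A ** B - B ** A) v = act A (act B v) - act B (act A v)"
proof -
  assume A: "A \<in> sl2" "B \<in> sl2"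
  then have "Usl2_class (gen (A ** B - B ** A)) = Usl2_class (gen A * gen B - gen B * gen A)"
    by (intro \<pi>_eq Usl2_relators.bracket free_algebra_closed free_algebra_diff sl2_closed)
  then show ?thesis
    using A by (simp only: \<pi>_diff \<pi>_class(2) free_algebra_closed)
qed

definition L where "L r A t = (\<Sum>k<r. on_factor k (act A) t)"

lemma L_W: "t \<in> tensor_power r \<Longrightarrow> L r A t \<in> tensor_power r"
  by (rule tensor_powerI) (simp add: L_def sum_apply tensor_powerD[OF on_factor_W[of t r]])

lemma L_linear: "L r A (s + t) = L r A s + L r A t" "L r A (tensor_scale c t) = tensor_scale c (L r A t)"
proof -
  interpret vector_space tensor_scale by (rule vector_space_tensor)
  show "L r A (s + t) = L r A s + L r A t" "L r A (tensor_scale c t) = tensor_scale c (L r A t)"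
    by (simp_all only: L_def on_factor_linear sum.distrib scale_sum_right)
qed

lemma on_factor_compose:
  assumes f: "Vector_Spaces.linear (*s) (*s) f"
  shows "on_factor k f (on_factor k g t) = on_factor k (\<lambda>v. f (g v)) t"
proof
  fix w
  have "(\<Sum>a\<in>UNIV. f (axis a 1) $ x * (\<Sum>c\<in>UNIV. g (axis c 1) $ a * t (w[k := c]))) =
    (\<Sum>c\<in>UNIV. f (g (axis c 1)) $ x * t (w[k := c]))" for x
  proof -
    have "f (g (axis c 1)) $ x = (\<Sum>a\<in>UNIV. g (axis c 1) $ a * f (axis a 1) $ x)" for c
      by (subst linear_expand[OF f]) simp
    then show ?thesis
      by (simp add: sum_distrib_left sum_distrib_right mult_ac) (rule sum.swap)
  qed
  then show "on_factor k f (on_factor k g t) w = on_factor k (\<lambda>v. f (g v)) t w"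
    by (simp add: on_factor_def)
qed

lemma on_factor_commute:
  assumes "k \<noteq> l"
  shows "on_factor k f (on_factor l g t) = on_factor l g (on_factor k f t)"
proof
  fix w
  have "(\<Sum>a\<in>UNIV. f (axis a 1) $ x * (\<Sum>c\<in>UNIV. g (axis c 1) $ y * t (w[k := a, l := c]))) =
    (\<Sum>c\<in>UNIV. g (axis c 1) $ y * (\<Sum>a\<in>UNIV. f (axis a 1) $ x * t (w[l := c, k := a])))" for x y
    using assms by (simp add: sum_distrib_left mult_ac list_update_swap[of k l]) (rule sum.swap)
  then show "on_factor k f (on_factor l g t) w = on_factor l g (on_factor k f t) w"
    using assms by (simp add: on_factor_def)
qed

lemma L_relations:
  assumes "A \<in> sl2" "B \<in> sl2"
  shows "L r (A + B) t = L r A t + L r B t"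
    and "L r (\<chi> i j. c * A $ i $ j) t = tensor_scale c (L r A t)"
    and "L r (A ** B - B ** A) t = L r A (L r B t) - L r B (L r A t)"
proof -
  interpret vector_space tensor_scale by (rule vector_space_tensor)
  have "on_factor k (act (A + B)) t = on_factor k (act A) t + on_factor k (act B) t" for k
    by (simp add: on_factor_def act_add[OF assms] fun_eq_iff algebra_simps sum.distrib)
  then show "L r (A + B) t = L r A t + L r B t"
    by (simp only: L_def sum.distrib)
  have "on_factor k (act (\<chi> i j. c * A $ i $ j)) t = tensor_scale c (on_factor k (act A) t)" for k
    by (simp add: on_factor_def act_scale[OF assms(1)] fun_eq_iff tensor_scale_def sum_distrib_left mult_ac)
  then show "L r (\<chi> i j. c * A $ i $ j) t = tensor_scale c (L r A t)"
    by (simp only: L_def scale_sum_right)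
  have br: "on_factor k (act (A ** B - B ** A)) t =
      on_factor k (act A) (on_factor k (act B) t) - on_factor k (act B) (on_factor k (act A) t)" for k
    unfolding on_factor_compose[OF act_linear[OF assms(1)]] on_factor_compose[OF act_linear[OF assms(2)]]
    by (simp add: on_factor_def act_bracket[OF assms] fun_eq_iff algebra_simps sum_subtractf)
  have "L r A (L r B t) - L r B (L r A t) = (\<Sum>k<r. \<Sum>l<r.
      on_factor k (act A) (on_factor l (act B) t) - on_factor l (act B) (on_factor k (act A) t))"
    unfolding L_def on_factor_sum sum_subtractf by (subst (3) sum.swap) (rule refl)
  also have "\<dots> = (\<Sum>k<r. \<Sum>l<r. if l = k then on_factor k (act (A ** B - B ** A)) t else 0)"
    by (intro sum.cong refl) (simp add: br on_factor_commute)
  also have "\<dots> = L r (A ** B - B ** A) t"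
    unfolding L_def by (intro sum.cong refl) simp
  finally show "L r (A ** B - B ** A) t = L r A (L r B t) - L r B (L r A t)" by simp
qed

lemma free_rep_L: "free_rep tensor_scale (tensor_power r) sl2 (L r)"
  by (rule free_rep.intro[OF vector_space_tensor subspace_tensor_power]) (auto simp: L_W L_linear)

lemma tensor_action_lift:
  shows "p \<in> carrier (free_algebra sl2) \<Longrightarrow>
      tensor_action \<pi> r (Usl2_class p) = free_eval tensor_scale (tensor_power r) (L r) p"
    and "tensor_action \<pi> r \<in> ring_hom Usl2 (lin_End tensor_scale (tensor_power r))"
proof -
  interpret R: free_rep tensor_scale "tensor_power r" sl2 "L r" by (rule free_rep_L)
  have kill: "free_eval tensor_scale (tensor_power r) (L r) p t = 0"
    if "p \<in> Usl2_relators" "t \<in> tensor_power r" for p t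
    using that(1) by cases (use that(2) in \<open>simp_all add: L_relations L_W\<close>)
  have LL: "tensor_action \<pi> r = presented_lift tensor_scale (tensor_power r) (L r)"
    by (simp add: L_def[abs_def] tensor_action_def)
  show "p \<in> carrier (free_algebra sl2) \<Longrightarrow>
      tensor_action \<pi> r (Usl2_class p) = free_eval tensor_scale (tensor_power r) (L r) p"
    unfolding LL Usl2_class_def
    by (rule R.presented_lift_hom(1)[OF Usl2_relators_carrier kill])
  show "tensor_action \<pi> r \<in> ring_hom Usl2 (lin_End tensor_scale (tensor_power r))"
    unfolding LL Usl2_def
    by (rule R.presented_lift_hom(2)[OF Usl2_relators_carrier kill])
qed

lemma tensor_action_module: "Usl2_module tensor_scale (tensor_power r) (tensor_action \<pi> r)"
proof -
  interpret R: free_rep tensor_scale "tensor_power r" sl2 "L r" by (rule free_rep_L)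
  have "tensor_action \<pi> r (Usl2_class (const c)) = (\<lambda>x\<in>tensor_power r. tensor_scale c x)" for c
    by (rule ext) (simp add: tensor_action_lift(1), simp add: free_eval_def)
  then show ?thesis
    by (auto simp: Usl2_module_def tensor_action_lift(2) vector_space_tensor subspace_tensor_power)
qed

lemma commute_action:
  assumes T: "\<And>t. t \<in> tensor_power r \<Longrightarrow> T t \<in> tensor_power r"
    "\<And>s t. T (s + t) = T s + T t" "\<And>c t. T (tensor_scale c t) = tensor_scale c (T t)"
    and comm: "\<And>A t. \<lbrakk>A \<in> sl2; t \<in> tensor_power r\<rbrakk> \<Longrightarrow> T (L r A t) = L r A (T t)"
    and u: "u \<in> carrier Usl2" and t: "t \<in> tensor_power r"
  shows "T (tensor_action \<pi> r u t) = tensor_action \<pi> r u (T t)"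
proof -
  interpret R: free_rep tensor_scale "tensor_power r" sl2 "L r" by (rule free_rep_L)
  obtain p where p: "p \<in> carrier (free_algebra sl2)" "u = Usl2_class p"
    using u by (auto simp: Usl2_def Usl2_class_def presented_class_hom(3)[OF Usl2_relators_carrier])
  have T0: "T 0 = 0" using T(2)[of 0 0] by simp
  have Tsum: "T (\<Sum>i\<in>I. F i) = (\<Sum>i\<in>I. T (F i))" for I :: "(complex^2^2) fword set" and F
    by (induction I rule: infinite_finite_induct)
      (simp_all only: sum.infinite sum.empty sum.insert T0 T(2) not_False_eq_True)
  have word: "T (foldr (L r) gs t) = foldr (L r) gs (T t)" if "set gs \<subseteq> sl2" for gs
    using that by (induction gs) (auto simp: comm R.word(1) t)
  have "set (letters w) \<subseteq> sl2" if "w \<in> Poly_Mapping.keys p" for w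
    using p that by (simp add: free_algebra_def)
  then show ?thesis
    by (simp only: p(2) tensor_action_lift(1)[OF p(1)] free_eval_def restrict_apply t T(1) if_True Tsum T(3) word cong: sum.cong)
qed

end

lemma on_factor_far:
  assumes "k \<noteq> l" "k \<noteq> Suc l"
  shows "on_factor k f (swap_factors l t) = swap_factors l (on_factor k f t)"
    and "on_factor k f (contract_factors \<beta> b b' l t) = contract_factors \<beta> b b' l (on_factor k f t)"
proof -
  have upd: "w[l := p, Suc l := q, k := x] = w[k := x, l := p, Suc l := q]" for w :: "3 list" and p q x
    using assms by (metis list_update_swap)
  show "on_factor k f (swap_factors l t) = swap_factors l (on_factor k f t)"
    using assms by (auto simp: on_factor_def swap_factors_def fun_eq_iff upd)
  show "on_factor k f (contract_factors \<beta> b b' l t) = contract_factors \<beta> b b' l (on_factor k f t)"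
  proof
    fix w
    show "on_factor k f (contract_factors \<beta> b b' l t) w = contract_factors \<beta> b b' l (on_factor k f t) w"
    proof (cases "k < length w")
      case True
      let ?N = "\<Sum>j\<in>UNIV. b j $ (w ! l) * b' j $ (w ! Suc l)"
      let ?s = "\<lambda>x a c. f (axis x 1) $ (w ! k) * (\<beta> (axis a 1) (axis c 1) * t (w[k := x, l := a, Suc l := c]))"
      have 1: "on_factor k f (contract_factors \<beta> b b' l t) w = (\<Sum>x\<in>UNIV. f (axis x 1) $ (w ! k) *
          (\<Sum>a\<in>UNIV. \<Sum>c\<in>UNIV. \<beta> (axis a 1) (axis c 1) * t (w[k := x, l := a, Suc l := c]))) * ?N"
        using assms True by (simp add: on_factor_def contract_factors_def sum_distrib_right[of _ _ ?N] mult.assoc)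
      have 2: "contract_factors \<beta> b b' l (on_factor k f t) w = (\<Sum>a\<in>UNIV. \<Sum>c\<in>UNIV. \<beta> (axis a 1) (axis c 1) *
          (\<Sum>x\<in>UNIV. f (axis x 1) $ (w ! k) * t (w[k := x, l := a, Suc l := c]))) * ?N"
        using assms True by (simp add: on_factor_def contract_factors_def upd)
      have "(\<Sum>x\<in>UNIV. f (axis x 1) $ (w ! k) *
          (\<Sum>a\<in>UNIV. \<Sum>c\<in>UNIV. \<beta> (axis a 1) (axis c 1) * t (w[k := x, l := a, Suc l := c]))) =
          (\<Sum>x\<in>UNIV. \<Sum>a\<in>UNIV. \<Sum>c\<in>UNIV. ?s x a c)"
        by (simp add: sum_distrib_left)
      also have "\<dots> = (\<Sum>a\<in>UNIV. \<Sum>c\<in>UNIV. \<Sum>x\<in>UNIV. ?s x a c)"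
        by (rule sum_swap3)
      also have "\<dots> = (\<Sum>a\<in>UNIV. \<Sum>c\<in>UNIV. \<beta> (axis a 1) (axis c 1) *
          (\<Sum>x\<in>UNIV. f (axis x 1) $ (w ! k) * t (w[k := x, l := a, Suc l := c])))"
        by (simp add: sum_distrib_left mult_ac)
      finally have ?thesis by (simp only: 1 2)
      then show ?thesis .
    qed (simp add: on_factor_def contract_factors_def)
  qed
qed

locale V1_form = V1_module + form +
  assumes inv: "\<And>A v w. A \<in> sl2 \<Longrightarrow> \<beta> (act A v) w + \<beta> v (act A w) = 0"
begin

lemma L_split:
  assumes "l + 1 < r"
  shows "L r A t = on_factor l (act A) t + on_factor (Suc l) (act A) t + (\<Sum>k\<in>{..<r} - {l, Suc l}. on_factor k (act A) t)"
proof -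
  have "{..<r} = insert l (insert (Suc l) ({..<r} - {l, Suc l}))" using assms by auto
  then have "L r A t = (\<Sum>k\<in>insert l (insert (Suc l) ({..<r} - {l, Suc l})). on_factor k (act A) t)"
    unfolding L_def by (rule sum.cong) simp
  also have "\<dots> = on_factor l (act A) t + (on_factor (Suc l) (act A) t + (\<Sum>k\<in>{..<r} - {l, Suc l}. on_factor k (act A) t))"
    by (subst sum.insert, simp, simp, subst sum.insert) auto
  finally show ?thesis by (simp only: add.assoc)
qed

lemma on_factor_at1: "length u = k \<Longrightarrow> on_factor (Suc k) f t (u @ x # y # v) =
    (\<Sum>a\<in>UNIV. f (axis a 1) $ y * t (u @ x # a # v))"
  using on_factor_at[of "u @ [x]" "Suc k" f t y v] by simp

lemma on_factor_at0: "length u = k \<Longrightarrow> on_factor k f t (u @ x # y # v) =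
    (\<Sum>a\<in>UNIV. f (axis a 1) $ x * t (u @ a # y # v))"
  by (rule on_factor_at)

lemma swap_commute:
  assumes "l + 1 < r" "t \<in> tensor_power r"
  shows "swap_factors l (L r A t) = L r A (swap_factors l t)"
proof -
  have sum: "swap_factors l (\<Sum>i\<in>I. F i) = (\<Sum>i\<in>I. swap_factors l (F i))" for I :: "nat set" and F
    by (simp add: swap_factors_def fun_eq_iff sum_apply)
  have "swap_factors l (on_factor l (act A) t) = on_factor (Suc l) (act A) (swap_factors l t)"
    "swap_factors l (on_factor (Suc l) (act A) t) = on_factor l (act A) (swap_factors l t)"
    by (rule tensor_power_eqI2[OF assms(1)];
      simp add: assms swap_factors_W on_factor_W swap_factors_at on_factor_at0 on_factor_at1)+
  then show ?thesis
    by (simp add: L_split[OF assms(1)] swap_factors_linear sum on_factor_far(1) del: plus_fun_apply)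
qed

lemma M_inv:
  assumes "A \<in> sl2"
  shows "(\<Sum>d\<in>UNIV. act A (axis a 1) $ d * M d c) + (\<Sum>d\<in>UNIV. act A (axis c 1) $ d * M a d) = 0"
proof -
  have "\<beta> (act A (axis a 1)) (axis c 1) = (\<Sum>d\<in>UNIV. act A (axis a 1) $ d * M d c)"
    by (subst linear_expand[OF lin(2)]) (simp add: M_def)
  moreover have "\<beta> (axis a 1) (act A (axis c 1)) = (\<Sum>d\<in>UNIV. act A (axis c 1) $ d * M a d)"
    by (subst linear_expand[OF lin(1)]) (simp add: M_def)
  ultimately show ?thesis using inv[OF assms, of "axis a 1" "axis c 1"] by simp
qed

lemma N_inv:
  assumes "A \<in> sl2"
  shows "(\<Sum>a\<in>UNIV. act A (axis a 1) $ x * N a y) + (\<Sum>a\<in>UNIV. act A (axis a 1) $ y * N x a) = 0"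
proof -
  let ?P = "\<lambda>d a. act A (axis a 1) $ d"
  have "0 = (\<Sum>a\<in>UNIV. \<Sum>c\<in>UNIV. N x a * N c y *
      ((\<Sum>d\<in>UNIV. ?P d a * M d c) + (\<Sum>d\<in>UNIV. ?P d c * M a d)))"
    by (simp add: M_inv[OF assms])
  also have "\<dots> = (\<Sum>a\<in>UNIV. \<Sum>d\<in>UNIV. N x a * ?P d a * (\<Sum>c\<in>UNIV. M d c * N c y)) +
     (\<Sum>c\<in>UNIV. \<Sum>d\<in>UNIV. N c y * ?P d c * (\<Sum>a\<in>UNIV. N x a * M a d))"
  proof -
    have "(\<Sum>a\<in>UNIV. \<Sum>c\<in>UNIV. N x a * N c y * (\<Sum>d\<in>UNIV. ?P d a * M d c)) =
       (\<Sum>a\<in>UNIV. \<Sum>d\<in>UNIV. N x a * ?P d a * (\<Sum>c\<in>UNIV. M d c * N c y))"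
      by (simp add: sum_distrib_left mult_ac) (rule sum.cong[OF refl], rule sum.swap)
    moreover have "(\<Sum>a\<in>UNIV. \<Sum>c\<in>UNIV. N x a * N c y * (\<Sum>d\<in>UNIV. ?P d c * M a d)) =
       (\<Sum>c\<in>UNIV. \<Sum>d\<in>UNIV. N c y * ?P d c * (\<Sum>a\<in>UNIV. N x a * M a d))"
      by (simp add: sum_distrib_left mult_ac) (rule sum_swap3)
    ultimately show ?thesis by (simp add: distrib_left sum.distrib)
  qed
  also have "\<dots> = (\<Sum>a\<in>UNIV. N x a * ?P y a) + (\<Sum>c\<in>UNIV. N c y * ?P x c)"
    by (simp add: MN NM if_distrib[where f = "\<lambda>x. _ * x"] cong: if_cong)
  finally show ?thesis by (simp add: mult_ac add.commute)
qed

lemma ct_commute: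
  assumes l: "l + 1 < r" and t: "t \<in> tensor_power r" and A: "A \<in> sl2"
  shows "ct l (L r A t) = L r A (ct l t)"
proof -
  let ?P = "\<lambda>d a. act A (axis a 1) $ d"
  have 0: "(0 :: tensor) \<in> tensor_power r" by (simp add: tensor_power_def)
  have add: "f + g \<in> tensor_power r" if "f \<in> tensor_power r" "g \<in> tensor_power r" for f g
    using that by (intro tensor_powerI) (simp add: tensor_powerD)
  have ct0: "ct l 0 = 0"
    by (simp add: contract_factors_def fun_eq_iff)
  have sum: "ct l (\<Sum>i\<in>I. F i) = (\<Sum>i\<in>I. ct l (F i))" for I :: "nat set" and F
    by (induction I rule: infinite_finite_induct)
      (simp_all only: sum.infinite sum.empty sum.insert ct0 contract_factors_linear not_False_eq_True)
  have S0: "S (on_factor l (act A) t + on_factor (Suc l) (act A) t) u v = 0" if "length u = l" for u v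
  proof -
    have "S (on_factor l (act A) t + on_factor (Suc l) (act A) t) u v =
      (\<Sum>a\<in>UNIV. \<Sum>c\<in>UNIV. M a c * (\<Sum>d\<in>UNIV. ?P a d * t (u @ d # c # v))) +
      (\<Sum>a\<in>UNIV. \<Sum>c\<in>UNIV. M a c * (\<Sum>d\<in>UNIV. ?P c d * t (u @ a # d # v)))"
      using that by (simp add: S_def on_factor_at0 on_factor_at1 distrib_left sum.distrib)
    also have "(\<Sum>a\<in>UNIV. \<Sum>c\<in>UNIV. M a c * (\<Sum>d\<in>UNIV. ?P a d * t (u @ d # c # v))) =
      (\<Sum>d\<in>UNIV. \<Sum>c\<in>UNIV. (\<Sum>a\<in>UNIV. ?P a d * M a c) * t (u @ d # c # v))"
      by (simp add: sum_distrib_left sum_distrib_right mult_ac)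
        (subst sum_swap3, subst sum.swap, rule refl)
    also have "(\<Sum>a\<in>UNIV. \<Sum>c\<in>UNIV. M a c * (\<Sum>d\<in>UNIV. ?P c d * t (u @ a # d # v))) =
      (\<Sum>d\<in>UNIV. \<Sum>c\<in>UNIV. (\<Sum>a\<in>UNIV. ?P a c * M d a) * t (u @ d # c # v))"
      by (simp add: sum_distrib_left sum_distrib_right mult_ac) (rule sum.cong[OF refl], rule sum.swap)
    finally have "S (on_factor l (act A) t + on_factor (Suc l) (act A) t) u v =
      (\<Sum>d\<in>UNIV. \<Sum>c\<in>UNIV. ((\<Sum>a\<in>UNIV. ?P a d * M a c) + (\<Sum>a\<in>UNIV. ?P a c * M d a)) * t (u @ d # c # v))"
      by (simp only: distrib_right sum.distrib)
    then show ?thesis by (simp only: M_inv[OF A]) simp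
  qed
  have 1: "ct l (on_factor l (act A) t) + ct l (on_factor (Suc l) (act A) t) = 0"
    unfolding contract_factors_linear(1)[symmetric]
  proof (rule tensor_power_eqI2[OF l])
    show "ct l (on_factor l (act A) t + on_factor (Suc l) (act A) t) \<in> tensor_power r"
      by (intro contract_factors_W add on_factor_W t)
    show "ct l (on_factor l (act A) t + on_factor (Suc l) (act A) t) (u @ x # y # v) = 0 (u @ x # y # v)"
      if "length u = l" for u v x y
      by (simp only: ct_at[OF that] S0[OF that] mult_zero_right zero_fun_apply)
  qed (rule 0)
  have 2: "on_factor l (act A) (ct l t) + on_factor (Suc l) (act A) (ct l t) = 0"
  proof (rule tensor_power_eqI2[OF l])
    fix u v :: "3 list" and x y assume u: "length u = l"
    have "(on_factor l (act A) (ct l t) + on_factor (Suc l) (act A) (ct l t)) (u @ x # y # v) =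
      ((\<Sum>a\<in>UNIV. ?P x a * N a y) + (\<Sum>a\<in>UNIV. ?P y a * N x a)) * S t u v"
      using u by (simp add: on_factor_at0 on_factor_at1 ct_at distrib_left sum_distrib_left mult_ac)
    then show "(on_factor l (act A) (ct l t) + on_factor (Suc l) (act A) (ct l t)) (u @ x # y # v) = 0 (u @ x # y # v)"
      by (simp add: N_inv[OF A])
  qed (use t in \<open>simp_all add: 0 add contract_factors_W on_factor_W\<close>)
  show ?thesis
    by (simp add: L_split[OF l] contract_factors_linear sum 1 2 on_factor_far(2) del: plus_fun_apply)
qed

text \<open>\<open>\<eta>\<close> is a well-defined homomorphism of complex algebras into \<open>E(r)\<close> with the prescribed
  values on the generators.\<close>

theorem eta_hom: "eta \<beta> b b' r \<in> ring_hom (brauer_algebra r 3) (tensor_End \<pi> r)"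
proof (rule ring_hom_memI)
  interpret R: free_rep tensor_scale "tensor_power r" "brauer_gens r" "eta_gen \<beta> b b'"
    by (rule free_rep_eta)
  note h = eta_lift(2)[of r]
  have sel: "mult (tensor_End \<pi> r) = mult (lin_End tensor_scale (tensor_power r))"
    "add (tensor_End \<pi> r) = add (lin_End tensor_scale (tensor_power r))"
    "one (tensor_End \<pi> r) = one (lin_End tensor_scale (tensor_power r))"
    by (simp_all add: tensor_End_def Usl2_End_def)
  show "eta \<beta> b b' r (X \<otimes>\<^bsub>brauer_algebra r 3\<^esub> Y) = eta \<beta> b b' r X \<otimes>\<^bsub>tensor_End \<pi> r\<^esub> eta \<beta> b b' r Y"
    "eta \<beta> b b' r (X \<oplus>\<^bsub>brauer_algebra r 3\<^esub> Y) = eta \<beta> b b' r X \<oplus>\<^bsub>tensor_End \<pi> r\<^esub> eta \<beta> b b' r Y"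
    if "X \<in> carrier (brauer_algebra r 3)" "Y \<in> carrier (brauer_algebra r 3)" for X Y
    using ring_hom_mult[OF h that] ring_hom_add[OF h that] by (simp_all only: sel)
  show "eta \<beta> b b' r \<one>\<^bsub>brauer_algebra r 3\<^esub> = \<one>\<^bsub>tensor_End \<pi> r\<^esub>"
    using ring_hom_one[OF h] by (simp only: sel)
  fix X assume X: "X \<in> carrier (brauer_algebra r 3)"
  then obtain p where p: "p \<in> carrier (free_algebra (brauer_gens r))" "X = brauer_class r 3 p"
    by (auto simp: brauer_algebra_def brauer_class_def presented_class_hom(3)[OF brauer_relators_carrier])
  have gens: "eta_gen \<beta> b b' g (tensor_action \<pi> r u t) = tensor_action \<pi> r u (eta_gen \<beta> b b' g t)"
    if "g \<in> brauer_gens r" "u \<in> carrier Usl2" "t \<in> tensor_power r" for g u t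
    by (rule commute_action)
      (use that in \<open>auto simp: brauer_gens_def R.\<phi>_W swap_factors_W contract_factors_W swap_factors_linear
         contract_factors_linear swap_commute ct_commute simp del: plus_fun_apply\<close>)
  have actW: "tensor_action \<pi> r u t \<in> tensor_power r" if "u \<in> carrier Usl2" "t \<in> tensor_power r" for u t
    using ring_hom_closed[OF tensor_action_lift(2) that(1)] that(2) by (auto simp: lin_End_def)
  have lin_act: "tensor_action \<pi> r u \<in> carrier (lin_End tensor_scale (tensor_power r))" if "u \<in> carrier Usl2" for u
    using ring_hom_closed[OF tensor_action_lift(2) that] .
  have word: "foldr (eta_gen \<beta> b b') gs (tensor_action \<pi> r u t) = tensor_action \<pi> r u (foldr (eta_gen \<beta> b b') gs t)"
    if "set gs \<subseteq> brauer_gens r" "u \<in> carrier Usl2" "t \<in> tensor_power r" for gs u t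
    using that by (induction gs) (auto simp: gens R.word(1))
  have wd: "set (letters w) \<subseteq> brauer_gens r" if "w \<in> Poly_Mapping.keys p" for w
    using p that by (simp add: free_algebra_def)
  have "eta \<beta> b b' r X (tensor_action \<pi> r u t) = tensor_action \<pi> r u (eta \<beta> b b' r X t)"
    if u: "u \<in> carrier Usl2" and t: "t \<in> tensor_power r" for u t
  proof -
    obtain q where q: "q \<in> carrier (free_algebra sl2)" "u = Usl2_class q"
      using u by (auto simp: Usl2_def Usl2_class_def presented_class_hom(3)[OF Usl2_relators_carrier])
    interpret Q: free_rep tensor_scale "tensor_power r" sl2 "L r" by (rule free_rep_L)
    let ?a = "tensor_action \<pi> r u" and ?w = "\<lambda>w. foldr (eta_gen \<beta> b b') (letters w) t"
    let ?c = "Poly_Mapping.lookup p"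
    have "eta \<beta> b b' r X (?a t) = (\<Sum>w\<in>Poly_Mapping.keys p. tensor_scale (?c w) (?a (?w w)))"
      unfolding p(2) eta_lift(1)[OF p(1)] free_eval_def restrict_apply
      using u t by (simp add: actW word wd cong: sum.cong)
    also have "\<dots> = (\<Sum>w\<in>Poly_Mapping.keys p. ?a (tensor_scale (?c w) (?w w)))"
      using t by (intro sum.cong refl) (simp add: q tensor_action_lift(1) Q.ev_lin R.word(1) wd)
    also have "\<dots> = ?a (\<Sum>w\<in>Poly_Mapping.keys p. tensor_scale (?c w) (?w w))"
      unfolding q(2) tensor_action_lift(1)[OF q(1)]
      by (rule Q.ev_arg_sum[OF q(1), symmetric]) (use t wd in \<open>auto intro!: R.W_closed R.word(1)\<close>)
    also have "\<dots> = ?a (eta \<beta> b b' r X t)"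
      unfolding p(2) eta_lift(1)[OF p(1)] free_eval_def using t by simp
    finally show ?thesis .
  qed
  then show "eta \<beta> b b' r X \<in> carrier (tensor_End \<pi> r)"
    using ring_hom_closed[OF h X] by (simp add: tensor_End_def Usl2_End_def)
qed

theorem eta_generators:
  shows "i \<in> {1..<r} \<Longrightarrow> eta \<beta> b b' r (brauer_class r 3 (sg i)) =
      (\<lambda>t\<in>tensor_power r. swap_factors (i - 1) t)"
    and "i \<in> {1..<r} \<Longrightarrow> eta \<beta> b b' r (brauer_class r 3 (eg i)) =
      (\<lambda>t\<in>tensor_power r. contract_factors \<beta> b b' (i - 1) t)"
    and "eta \<beta> b b' r (brauer_class r 3 (const c)) = (\<lambda>t\<in>tensor_power r. tensor_scale c t)"
proof -
  interpret R: free_rep tensor_scale "tensor_power r" "brauer_gens r" "eta_gen \<beta> b b'"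
    by (rule free_rep_eta)
  have out: "R.ev p t = undefined" if "t \<notin> tensor_power r" for p t
    using that by (simp add: free_eval_def)
  show "i \<in> {1..<r} \<Longrightarrow> eta \<beta> b b' r (brauer_class r 3 (sg i)) =
      (\<lambda>t\<in>tensor_power r. swap_factors (i - 1) t)"
    "i \<in> {1..<r} \<Longrightarrow> eta \<beta> b b' r (brauer_class r 3 (eg i)) =
      (\<lambda>t\<in>tensor_power r. contract_factors \<beta> b b' (i - 1) t)"
    "eta \<beta> b b' r (brauer_class r 3 (const c)) = (\<lambda>t\<in>tensor_power r. tensor_scale c t)"
    by (auto simp: fun_eq_iff eta_lift(1) out)
qed

end

corollary eta_well_defined:
  assumes "irreducible_Usl2_module (*s) UNIV \<pi>" "invariant_form \<pi> \<beta>" "dual_bases \<beta> b b'"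
  shows "eta \<beta> b b' r \<in> ring_hom (brauer_algebra r 3) (tensor_End \<pi> r)"
    and "i \<in> {1..<r} \<Longrightarrow> eta \<beta> b b' r (brauer_class r 3 (sg i)) =
      (\<lambda>t\<in>tensor_power r. swap_factors (i - 1) t)"
    and "i \<in> {1..<r} \<Longrightarrow> eta \<beta> b b' r (brauer_class r 3 (eg i)) =
      (\<lambda>t\<in>tensor_power r. contract_factors \<beta> b b' (i - 1) t)"
    and "eta \<beta> b b' r (brauer_class r 3 (const c)) = (\<lambda>t\<in>tensor_power r. tensor_scale c t)"
proof -
  have "Usl2_module (*s) UNIV \<pi>"
    using assms(1) unfolding irreducible_Usl2_module_def by (elim conjE)
  then have "V1_module \<pi>"
    by (rule V1_module.intro)
  moreover have "form \<beta> b b'"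
    using assms(2) unfolding invariant_form_def
    by (intro form.intro assms(3)) blast+
  moreover have "V1_form_axioms \<pi> \<beta>"
    using assms(2) unfolding invariant_form_def
    by (intro V1_form_axioms.intro) blast
  ultimately interpret V1_form \<pi> \<beta> b b'
    by (rule V1_form.intro)
  show "eta \<beta> b b' r \<in> ring_hom (brauer_algebra r 3) (tensor_End \<pi> r)"
    by (rule eta_hom)
  show "i \<in> {1..<r} \<Longrightarrow> eta \<beta> b b' r (brauer_class r 3 (sg i)) =
      (\<lambda>t\<in>tensor_power r. swap_factors (i - 1) t)"
    "i \<in> {1..<r} \<Longrightarrow> eta \<beta> b b' r (brauer_class r 3 (eg i)) =
      (\<lambda>t\<in>tensor_power r. contract_factors \<beta> b b' (i - 1) t)"
    "eta \<beta> b b' r (brauer_class r 3 (const c)) = (\<lambda>t\<in>tensor_power r. tensor_scale c t)"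
    by (rule eta_generators; assumption)+
qed

end

theory Submission
  imports Defs
begin

text \<open>Only the symmetry and nondegeneracy of the form matter.  Let \<open>Q\<close> be the quotient of the
  Brauer algebra by \<open>\<Phi>\<close> and \<open>A n \<subseteq> Q\<close> the subalgebra generated by the \<open>s\<^sub>i, e\<^sub>i\<close> with \<open>i < n\<close>;
  one shows by induction on \<open>n\<close> that \<open>A n\<close> acts faithfully on tensors.  In the step from \<open>r\<close> to \<open>r + 1\<close>,
  \<open>J r = A r \<cdot> e\<^sub>r \<cdot> A r\<close> is the ideal of \<open>A (r + 1)\<close> generated by the \<open>e\<^sub>i\<close>.

  Faithfulness on \<open>J r\<close>: over an orthonormal basis the image of \<open>J r\<close> is closed under adjoints, so it has
  a left identity; by the induction hypothesis this lifts to a left identity \<open>P = \<Sum> u\<^sub>k e\<^sub>r v\<^sub>k\<close> of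
  \<open>J r\<close> itself.  If \<open>x \<in> J r\<close> acts by zero then so does \<open>e\<^sub>r v\<^sub>k x = e\<^sub>r y\<^sub>k\<close> with \<open>y\<^sub>k \<in> A r\<close>,
  hence \<open>y\<^sub>k = 0\<close> and \<open>x = P x = 0\<close>.

  Faithfulness modulo \<open>J r\<close>: with \<open>X\<^sub>i = 1 - s\<^sub>i\<close>, the relation \<open>\<Phi> = 0\<close> becomes \<open>X\<^sub>1X\<^sub>3 \<equiv> 0\<close>.  This
  leaves \<open>1\<close> and the \<open>r\<^sup>2\<close> monotone products \<open>X\<^sub>i \<dots> X\<^sub>j\<close>, which are linearly independent on the
  harmonic tensors \<open>v \<otimes> \<dots> \<otimes> w \<otimes> \<dots> \<otimes> v\<close>, with \<open>v\<close> isotropic and \<open>w\<close> orthogonal to \<open>v\<close>.  For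
  \<open>r = 2\<close>, where \<open>\<Phi>\<close> is not available, the antisymmetrizer on three strands is the only further element.\<close>

section \<open>The Brauer relations in an abstract algebra\<close>


locale brauer_rels =
  fixes sc :: "complex \<Rightarrow> 'a::ring_1" and s e :: "nat \<Rightarrow> 'a" and N :: nat
  assumes sc_add: "sc (a + b) = sc a + sc b" and sc_mult: "sc (a * b) = sc a * sc b"
    and sc_one: "sc 1 = 1" and sc_comm: "sc c * x = x * sc c"
    and ss: "\<lbrakk>1 \<le> i; i < N\<rbrakk> \<Longrightarrow> s i * s i = 1"
    and ee: "\<lbrakk>1 \<le> i; i < N\<rbrakk> \<Longrightarrow> e i * e i = sc 3 * e i"
    and se: "\<lbrakk>1 \<le> i; i < N\<rbrakk> \<Longrightarrow> s i * e i = e i"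
    and es: "\<lbrakk>1 \<le> i; i < N\<rbrakk> \<Longrightarrow> e i * s i = e i"
    and ss_far: "\<lbrakk>1 \<le> i; i + 2 \<le> j; j < N\<rbrakk> \<Longrightarrow> s i * s j = s j * s i"
    and se_far: "\<lbrakk>1 \<le> i; i + 2 \<le> j; j < N\<rbrakk> \<Longrightarrow> s i * e j = e j * s i"
    and es_far: "\<lbrakk>1 \<le> i; i + 2 \<le> j; j < N\<rbrakk> \<Longrightarrow> e i * s j = s j * e i"
    and ee_far: "\<lbrakk>1 \<le> i; i + 2 \<le> j; j < N\<rbrakk> \<Longrightarrow> e i * e j = e j * e i"
    and sss: "\<lbrakk>1 \<le> i; Suc i < N\<rbrakk> \<Longrightarrow> s i * s (Suc i) * s i = s (Suc i) * s i * s (Suc i)"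
    and eee: "\<lbrakk>1 \<le> i; Suc i < N\<rbrakk> \<Longrightarrow> e i * e (Suc i) * e i = e i"
      "\<lbrakk>1 \<le> i; Suc i < N\<rbrakk> \<Longrightarrow> e (Suc i) * e i * e (Suc i) = e (Suc i)"
    and see: "\<lbrakk>1 \<le> i; Suc i < N\<rbrakk> \<Longrightarrow> s i * e (Suc i) * e i = s (Suc i) * e i"
    and ees: "\<lbrakk>1 \<le> i; Suc i < N\<rbrakk> \<Longrightarrow> e (Suc i) * e i * s (Suc i) = e (Suc i) * s i"
begin

lemma sc_0 [simp]: "sc 0 = 0"
  using sc_add[of 0 0] by simp

lemma sc_minus: "sc (- a) = - sc a"
  using sc_add[of a "- a"] by (simp add: eq_neg_iff_add_eq_0 add.commute)

text \<open>The two mixed relations, multiplied by an involution, give \<open>s i * s (Suc i) * e i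
  = e (Suc i) * e i = e (Suc i) * s i * s (Suc i)\<close>. Cancelling the involutions shows that
  \<open>e (Suc i)\<close> is the conjugate of \<open>e i\<close> by \<open>s i * s (Suc i)\<close>.
  The other identities follow from these and \<open>eee\<close>.\<close>

lemma three_strands:
  assumes "1 \<le> i" "Suc i < N"
  shows "s i * s (Suc i) * e i = e (Suc i) * e i"
    and "e (Suc i) * s i * s (Suc i) = e (Suc i) * e i"
    and "e (Suc i) = s i * s (Suc i) * e i * s (Suc i) * s i"
    and "s (Suc i) * e i * s (Suc i) = s i * e (Suc i) * s i"
    and "s (Suc i) * s i * e (Suc i) = e i * e (Suc i)"
    and "s (Suc i) * e i * e (Suc i) = s i * e (Suc i)"
    and "e (Suc i) * s i * e (Suc i) = e (Suc i)"
proof -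
  define t u a b where "t = s i" "u = s (Suc i)" "a = e i" "b = e (Suc i)"
  note defs = this
  have tt: "t * t = 1" "u * u = 1" "t * (t * x) = x" "u * (u * x) = x" for x
    using ss[of i] ss[of "Suc i"] assms by (auto simp: defs mult.assoc[symmetric])
  have ta: "t * a = a" "a * t = a" "u * b = b" "b * u = b"
    using se[of i] se[of "Suc i"] es[of i] es[of "Suc i"] assms by (auto simp: defs)
  have see': "t * (b * a) = u * a" and ees': "b * (a * u) = b * t" and aba: "a * (b * a) = a" and bab: "b * (a * b) = b"
    using see[of i] ees[of i] eee[of i] assms by (auto simp: defs mult.assoc)
  have 1: "t * (u * a) = b * a" by (metis see' tt(3))
  have 2: "b * (t * u) = b * a" by (metis ees' tt(2) mult.assoc mult_1_right)
  have 3: "b = t * (u * (a * (u * t)))"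
  proof -
    have "b * (t * u) = t * (u * a)" by (simp add: 1 2)
    then have "b * (t * u) * (u * t) = t * (u * a) * (u * t)" by simp
    then show ?thesis by (simp add: mult.assoc tt)
  qed
  have 4: "u * (a * u) = t * (b * t)"
    by (subst 3) (simp add: mult.assoc tt)
  have aua: "a * (u * a) = a" by (metis aba 1 ta(2) mult.assoc)
  have 5: "a * b = a * (u * t)"
  proof -
    have "a * b = a * (t * (u * (a * (u * t))))" by (subst 3) simp
    also have "\<dots> = (a * t) * u * a * (u * t)" by (simp only: mult.assoc)
    also have "\<dots> = a * (u * t)" by (metis aua ta(2) mult.assoc)
    finally show ?thesis .
  qed
  have 6: "u * (t * b) = a * b"
    by (subst 5, subst 3) (simp add: mult.assoc tt)
  have 7: "u * (a * b) = t * b" by (metis 6 tt(4))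
  have 8: "b * (t * b) = b" by (metis bab 2 ta(3) mult.assoc)
  show "s i * s (Suc i) * e i = e (Suc i) * e i" using 1 by (simp only: defs mult.assoc)
  show "e (Suc i) * s i * s (Suc i) = e (Suc i) * e i" using 2 by (simp only: defs mult.assoc)
  show "e (Suc i) = s i * s (Suc i) * e i * s (Suc i) * s i" using 3 by (simp only: defs mult.assoc)
  show "s (Suc i) * e i * s (Suc i) = s i * e (Suc i) * s i" using 4 by (simp only: defs mult.assoc)
  show "s (Suc i) * s i * e (Suc i) = e i * e (Suc i)" using 6 by (simp only: defs mult.assoc)
  show "s (Suc i) * e i * e (Suc i) = s i * e (Suc i)" using 7 by (simp only: defs mult.assoc)
  show "e (Suc i) * s i * e (Suc i) = e (Suc i)" using 8 by (simp only: defs mult.assoc)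
qed

section \<open>Subalgebras generated by the strands up to \<open>n\<close>\<close>

inductive_set A :: "nat \<Rightarrow> 'a set" for n where
  A_sc: "sc c \<in> A n"
| A_add: "\<lbrakk>x \<in> A n; y \<in> A n\<rbrakk> \<Longrightarrow> x + y \<in> A n"
| A_s: "\<lbrakk>1 \<le> i; i < n; x \<in> A n\<rbrakk> \<Longrightarrow> s i * x \<in> A n"
| A_e: "\<lbrakk>1 \<le> i; i < n; x \<in> A n\<rbrakk> \<Longrightarrow> e i * x \<in> A n"

lemma A_0: "0 \<in> A n" and A_1: "1 \<in> A n"
  using A_sc[of 0 n] A_sc[of 1 n] by (simp_all add: sc_one)

lemma A_scale: "x \<in> A n \<Longrightarrow> sc c * x \<in> A n"
proof (induction rule: A.induct)
  case (A_sc d) show ?case using A.A_sc[of "c * d"] by (simp add: sc_mult)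
next
  case (A_add x y) then show ?case by (simp add: distrib_left A.A_add)
next
  case (A_s i x) then show ?case using A.A_s[of i n "sc c * x"] by (metis mult.assoc sc_comm)
next
  case (A_e i x) then show ?case using A.A_e[of i n "sc c * x"] by (metis mult.assoc sc_comm)
qed

lemma A_mult: "\<lbrakk>x \<in> A n; y \<in> A n\<rbrakk> \<Longrightarrow> x * y \<in> A n"
  by (induction rule: A.induct) (auto simp: A_scale distrib_right mult.assoc intro: A.intros)

lemma A_minus: "x \<in> A n \<Longrightarrow> - x \<in> A n"
  using A_scale[of x n "- 1"] by (simp add: sc_minus sc_one)

lemma A_diff: "\<lbrakk>x \<in> A n; y \<in> A n\<rbrakk> \<Longrightarrow> x - y \<in> A n"
  using A_add[of x n "- y"] A_minus by simp

lemma A_gens: "\<lbrakk>1 \<le> i; i < n\<rbrakk> \<Longrightarrow> s i \<in> A n" "\<lbrakk>1 \<le> i; i < n\<rbrakk> \<Longrightarrow> e i \<in> A n"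
  using A_s[of i n 1] A_e[of i n 1] A_1 by auto

lemma A_mono: "x \<in> A m \<Longrightarrow> m \<le> n \<Longrightarrow> x \<in> A n"
  by (induction rule: A.induct) (auto intro: A.intros)

lemma A_far:
  assumes "x \<in> A m" "m < j" "j < N"
  shows "s j * x = x * s j" "e j * x = x * e j"
proof -
  have "s j * x = x * s j \<and> e j * x = x * e j"
    using assms(1)
  proof (induction rule: A.induct)
    case (A_sc c) show ?case by (simp add: sc_comm)
  next
    case (A_add x y) then show ?case by (simp add: distrib_left distrib_right)
  next
    case (A_s i x)
    then have "s i * s j = s j * s i" "s i * e j = e j * s i"
      using assms by (auto intro: ss_far se_far)
    then show ?case using A_s by (metis mult.assoc)
  next
    case (A_e i x)
    then have "e i * s j = s j * e i" "e i * e j = e j * e i"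
      using assms by (auto intro: es_far ee_far)
    then show ?case using A_e by (metis mult.assoc)
  qed
  then show "s j * x = x * s j" "e j * x = x * e j" by auto
qed

lemma A_far':
  assumes "x \<in> A m" "m < j" "j < N"
  shows "s j * (x * y) = x * (s j * y)" "e j * (x * y) = x * (e j * y)"
  using A_far[OF assms] by (metis mult.assoc)+

text \<open>A spanning form for \<open>A (Suc r)\<close> in which a generator of index
  \<open>r\<close> occurs at most once per term; \<open>A_Suc_D\<close> shows that nothing is
  missing.\<close>

inductive_set D :: "nat \<Rightarrow> 'a set" for r where
  D_A: "x \<in> A r \<Longrightarrow> x \<in> D r"
| D_s: "\<lbrakk>x \<in> A r; y \<in> A r\<rbrakk> \<Longrightarrow> x * (s r * y) \<in> D r"
| D_e: "\<lbrakk>x \<in> A r; y \<in> A r\<rbrakk> \<Longrightarrow> x * (e r * y) \<in> D r"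
| D_add: "\<lbrakk>x \<in> D r; y \<in> D r\<rbrakk> \<Longrightarrow> x + y \<in> D r"

inductive_set J :: "nat \<Rightarrow> 'a set" for r where
  J_e: "\<lbrakk>x \<in> A r; y \<in> A r\<rbrakk> \<Longrightarrow> x * (e r * y) \<in> J r"
| J_add: "\<lbrakk>x \<in> J r; y \<in> J r\<rbrakk> \<Longrightarrow> x + y \<in> J r"

lemma J_D: "x \<in> J r \<Longrightarrow> x \<in> D r"
  by (induction rule: J.induct) (auto intro: D.intros)

lemma J_A: "\<lbrakk>x \<in> J r; 1 \<le> r\<rbrakk> \<Longrightarrow> x \<in> A (Suc r)"
proof (induction rule: J.induct)
  case (J_e x y)
  then show ?case using A_mono[of _ r "Suc r"] A_gens(2)[of r "Suc r"] by (intro A_mult) auto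
qed (rule A_add)

lemma J_left: "\<lbrakk>x \<in> J r; a \<in> A r\<rbrakk> \<Longrightarrow> a * x \<in> J r"
proof (induction rule: J.induct)
  case (J_e x y) then show ?case using J.J_e[of "a * x" r y] by (simp add: A_mult mult.assoc)
qed (auto simp: distrib_left intro: J.intros)

lemma J_right: "\<lbrakk>x \<in> J r; a \<in> A r\<rbrakk> \<Longrightarrow> x * a \<in> J r"
proof (induction rule: J.induct)
  case (J_e x y) then show ?case using J.J_e[of x r "y * a"] by (simp add: A_mult mult.assoc)
qed (auto simp: distrib_right intro: J.intros)

lemma D_left: "\<lbrakk>x \<in> D r; a \<in> A r\<rbrakk> \<Longrightarrow> a * x \<in> D r"
proof (induction rule: D.induct)
  case (D_s x y) then show ?case using D.D_s[of "a * x" r y] by (simp add: A_mult mult.assoc)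
next
  case (D_e x y) then show ?case using D.D_e[of "a * x" r y] by (simp add: A_mult mult.assoc)
qed (auto simp: distrib_left A_mult intro: D.intros)

lemma D_right: "\<lbrakk>x \<in> D r; a \<in> A r\<rbrakk> \<Longrightarrow> x * a \<in> D r"
proof (induction rule: D.induct)
  case (D_s x y) then show ?case using D.D_s[of x r "y * a"] by (simp add: A_mult mult.assoc)
next
  case (D_e x y) then show ?case using D.D_e[of x r "y * a"] by (simp add: A_mult mult.assoc)
qed (auto simp: distrib_right A_mult intro: D.intros)

lemma A_zero: "x \<in> A (Suc 0) \<Longrightarrow> x \<in> range sc"
  by (induction rule: A.induct) (auto simp: sc_add[symmetric])

text \<open>By the definition of \<open>D q\<close> only one of \<open>1, s\<^sub>q, e\<^sub>q\<close> stands between the outer letters: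
  everything else in \<open>a\<close> lies in \<open>A q\<close> and commutes with \<open>s\<^sub>r\<close> and \<open>e\<^sub>r\<close>.\<close>

lemma sandwich_step:
  assumes r: "1 \<le> q" "Suc q < N" "r = Suc q" and D: "a \<in> D q"
  shows "s r * (a * s r) \<in> D r" and "s r * (a * e r) \<in> J r" and "e r * (a * s r) \<in> J r"
    and "\<exists>a'\<in>A q. e r * (a * e r) = a' * e r"
proof -
  note rel = three_strands(1,2,4-7)[OF r(1,2), folded r(3)] sss[OF r(1,2), folded r(3), symmetric]
    eee(2)[OF r(1,2), folded r(3)] ees[OF r(1,2), folded r(3)]
  have rN: "1 \<le> r" "r < N" "q < r" "q \<le> r" using r by auto
  note far = A_far[OF _ rN(3,2)] A_far'[OF _ rN(3,2)]
  have gens: "s q \<in> A r" "e q \<in> A r" using r A_gens[of q r] by auto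
  note up = A_mono[OF _ rN(4)]
  have "s r * (a * s r) \<in> D r \<and> s r * (a * e r) \<in> J r \<and> e r * (a * s r) \<in> J r \<and>
     (\<exists>a'\<in>A q. e r * (a * e r) = a' * e r)"
    using D
  proof (induction rule: D.induct)
    case (D_A x)
    have "s r * (x * s r) = x" "s r * (x * e r) = x * e r" "e r * (x * s r) = x * e r"
      "e r * (x * e r) = (sc 3 * x) * e r"
      using ss[of r] se[of r] es[of r] ee[of r] rN far[OF D_A]
      by (simp_all add: sc_comm mult.assoc)
    then show ?case using D_A up[of x] J.J_e[of x r 1] A_1 A_scale[of x q 3] by (auto intro: D.D_A)
  next
    case (D_s x y)
    have y: "y * s r = s r * y" "y * e r = e r * y" using far[OF D_s(2)] by auto
    have p: "s r * (x * (s q * y) * h) = x * ((s r * s q * h) * y)"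
      "e r * (x * (s q * y) * h) = x * ((e r * s q * h) * y)" if "y * h = h * y" for h
      using that far[OF D_s(1)] by (simp_all add: mult.assoc)
    have xy: "x \<in> A r" "y \<in> A r" using D_s up by auto
    have 1: "s r * (x * (s q * y) * s r) = (x * s q) * (s r * (s q * y))"
      by (simp only: p[OF y(1)] rel) (simp add: mult.assoc)
    have 2: "s r * (x * (s q * y) * e r) = (x * e q) * (e r * y)"
      by (simp only: p[OF y(2)] rel) (simp add: mult.assoc)
    have 3: "e r * (x * (s q * y) * s r) = x * (e r * (e q * y))"
      by (simp only: p[OF y(1)] rel) (simp add: mult.assoc)
    have 4: "e r * (x * (s q * y) * e r) = (x * y) * e r"
      by (simp only: p[OF y(2)] rel) (simp add: mult.assoc y)
    show ?case
      unfolding 1 2 3 4 using xy gens D_s by (auto intro!: D.D_s J.J_e A_mult)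
  next
    case (D_e x y)
    have y: "y * s r = s r * y" "y * e r = e r * y" using far[OF D_e(2)] by auto
    have p: "s r * (x * (e q * y) * h) = x * ((s r * e q * h) * y)"
      "e r * (x * (e q * y) * h) = x * ((e r * e q * h) * y)" if "y * h = h * y" for h
      using that far[OF D_e(1)] by (simp_all add: mult.assoc)
    have xy: "x \<in> A r" "y \<in> A r" using D_e up by auto
    have 1: "s r * (x * (e q * y) * s r) = (x * s q) * (e r * (s q * y))"
      by (simp only: p[OF y(1)] rel) (simp add: mult.assoc)
    have 2: "s r * (x * (e q * y) * e r) = (x * s q) * (e r * y)"
      by (simp only: p[OF y(2)] rel) (simp add: mult.assoc)
    have 3: "e r * (x * (e q * y) * s r) = x * (e r * (s q * y))"
      by (simp only: p[OF y(1)] rel) (simp add: mult.assoc)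
    have 4: "e r * (x * (e q * y) * e r) = (x * y) * e r"
      by (simp only: p[OF y(2)] rel) (simp add: mult.assoc y)
    show ?case
      unfolding 1 2 3 4 using xy gens D_e by (auto intro!: D.D_e J.J_e A_mult)
  next
    case (D_add x y)
    then obtain x' y' where "x' \<in> A q" "y' \<in> A q" "e r * (x * e r) = x' * e r" "e r * (y * e r) = y' * e r"
      by blast
    then have "\<exists>a'\<in>A q. e r * ((x + y) * e r) = a' * e r"
      by (intro bexI[of _ "x' + y'"]) (auto simp: distrib_left distrib_right intro: A_add)
    then show ?case using D_add by (simp add: distrib_left distrib_right D.D_add J.J_add)
  qed
  then show "s r * (a * s r) \<in> D r" "s r * (a * e r) \<in> J r" "e r * (a * s r) \<in> J r"
    "\<exists>a'\<in>A q. e r * (a * e r) = a' * e r" by auto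
qed

text \<open>Membership in \<open>D (r - 1)\<close> is a hypothesis because \<open>A_Suc_D\<close>,
  which supplies it, is itself proved by induction through this lemma. The case \<open>r = 1\<close>
  is done directly, as \<open>A 1\<close> consists of scalars.\<close>

lemma sandwich_from_D:
  assumes r: "1 \<le> r" "r < N" and D: "a \<in> A r" "r \<noteq> 1 \<Longrightarrow> a \<in> D (r - 1)"
  shows "s r * (a * s r) \<in> D r" and "s r * (a * e r) \<in> J r" and "e r * (a * s r) \<in> J r"
    and "\<exists>a'\<in>A (r - 1). e r * (a * e r) = a' * e r"
proof -
  have "s r * (a * s r) \<in> D r \<and> s r * (a * e r) \<in> J r \<and> e r * (a * s r) \<in> J r \<and>
     (\<exists>a'\<in>A (r - 1). e r * (a * e r) = a' * e r)"
  proof (cases "r = 1")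
    case True
    then obtain c where c: "a = sc c" using A_zero D(1) by auto
    have "y * (sc c * z) = sc c * (y * z)" for y z by (metis mult.assoc sc_comm)
    then have "s r * (a * s r) = a" "s r * (a * e r) = a * e r" "e r * (a * s r) = a * e r"
      "e r * (a * e r) = sc (c * 3) * e r"
      using ss[of r] se[of r] es[of r] ee[of r] r
      by (simp_all add: c sc_mult mult.assoc)
    then show ?thesis using D(1) J.J_e[of a r 1] A_1 A_sc[of "c * 3" "r - 1"] by (auto intro: D.D_A)
  next
    case False
    then show ?thesis using sandwich_step[of "r - 1" r a] D r by auto
  qed
  then show "s r * (a * s r) \<in> D r" "s r * (a * e r) \<in> J r" "e r * (a * s r) \<in> J r"
    "\<exists>a'\<in>A (r - 1). e r * (a * e r) = a' * e r" by auto
qed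

text \<open>A generator of index \<open>r\<close> multiplied from the left meets the one already
  present across some \<open>a\<close> in \<open>A r\<close>. By induction \<open>a\<close> lies in
  \<open>D (r - 1)\<close>, so \<open>sandwich_from_D\<close> merges the two into at most
  one.\<close>

lemma A_Suc_D: "r < N \<Longrightarrow> x \<in> A (Suc r) \<Longrightarrow> 1 \<le> r \<Longrightarrow> x \<in> D r"
proof (induction r arbitrary: x)
  case (Suc r)
  let ?r = "Suc r"
  note sw = sandwich_from_D[of ?r]
  have aD: "a \<in> D (?r - 1)" if "a \<in> A ?r" "?r \<noteq> 1" for a using Suc.IH[of a] that Suc.prems by auto
  have s: "s ?r * x \<in> D ?r" and e: "e ?r * x \<in> D ?r" if "x \<in> D ?r" for x
  proof -
    have "s ?r * x \<in> D ?r \<and> e ?r * x \<in> D ?r"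
      using that
    proof (induction rule: D.induct)
      case (D_A x) then show ?case using D.D_s[of 1 ?r x] D.D_e[of 1 ?r x] A_1 by auto
    next
      case (D_s x y)
      then have "s ?r * (x * s ?r) \<in> D ?r" "e ?r * (x * s ?r) \<in> J ?r"
        using sw[of x] aD[of x] Suc.prems by auto
      then show ?case using D_right[of _ ?r y] J_D D_s by (metis mult.assoc)
    next
      case (D_e x y)
      then have "s ?r * (x * e ?r) \<in> J ?r" "\<exists>a\<in>A (?r - 1). e ?r * (x * e ?r) = a * e ?r"
        using sw[of x] aD[of x] Suc.prems by auto
      then obtain a where a: "a \<in> A (?r - 1)" "e ?r * (x * e ?r) = a * e ?r" by auto
      then have "a \<in> A ?r" using A_mono by auto
      then have "e ?r * (x * e ?r) \<in> J ?r" using J.J_e[of a ?r 1] a A_1 by auto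
      then show ?case using \<open>s ?r * (x * e ?r) \<in> J ?r\<close> D_right[of _ ?r y] J_D D_e by (metis mult.assoc)
    qed (auto simp: distrib_left intro: D.intros)
    then show "s ?r * x \<in> D ?r" "e ?r * x \<in> D ?r" by auto
  qed
  from Suc.prems(2) show ?case
  proof (induction rule: A.induct)
    case (A_s i x)
    then show ?case using s[of x] D_left[of x ?r "s i"] A_gens[of i ?r] by (cases "i = ?r") auto
  next
    case (A_e i x)
    then show ?case using e[of x] D_left[of x ?r "e i"] A_gens[of i ?r] by (cases "i = ?r") auto
  qed (auto intro: D.intros A.intros)
qed simp

lemma sandwich:
  assumes r: "1 \<le> r" "r < N" and a: "a \<in> A r"
  shows "s r * (a * e r) \<in> J r" and "e r * (a * s r) \<in> J r"
    and "\<exists>a'\<in>A (r - 1). e r * (a * e r) = a' * e r"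
proof -
  have "r \<noteq> 1 \<Longrightarrow> a \<in> D (r - 1)" using A_Suc_D[of "r - 1" a] a r by auto
  from sandwich_from_D[OF r a this]
  show "s r * (a * e r) \<in> J r" "e r * (a * s r) \<in> J r"
    "\<exists>a'\<in>A (r - 1). e r * (a * e r) = a' * e r" by auto
qed

text \<open>In diagrams this closes the last strand of \<open>a\<close>. The result lies in
  \<open>A (r - 1)\<close>, so it commutes with \<open>e r\<close> and can be written on either
  side.\<close>

lemma e_A_e:
  assumes r: "1 \<le> r" "r < N" and a: "a \<in> A r"
  shows "\<exists>a'\<in>A r. e r * (a * e r) = a' * e r \<and> e r * (a * e r) = e r * a'"
proof -
  obtain a' where a': "a' \<in> A (r - 1)" "e r * (a * e r) = a' * e r"
    using sandwich(3)[OF assms] by blast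
  moreover have "e r * a' = a' * e r" using A_far(2)[OF a'(1)] r by auto
  ultimately show ?thesis using A_mono[OF a'(1), of r] by auto
qed

text \<open>Stability under \<open>A r\<close> is built into \<open>J r\<close>, stability under
  \<open>s r\<close> and \<open>e r\<close> comes from \<open>sandwich\<close>, and
  \<open>A_Suc_D\<close> expresses every \<open>a\<close> through these.\<close>

lemma J_ideal:
  assumes r: "1 \<le> r" "r < N" and x: "x \<in> J r" and a: "a \<in> A (Suc r)"
  shows "a * x \<in> J r" "x * a \<in> J r"
proof -
  have eJ: "e r * (y * e r) \<in> J r" if "y \<in> A r" for y
    using e_A_e[OF r that] J.J_e[of _ r 1] A_1 by force
  have se: "s r * x \<in> J r" "x * s r \<in> J r" "e r * x \<in> J r" "x * e r \<in> J r" if "x \<in> J r" for x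
  proof -
    have "s r * x \<in> J r \<and> x * s r \<in> J r \<and> e r * x \<in> J r \<and> x * e r \<in> J r"
      using that
    proof (induction rule: J.induct)
      case (J_e x y)
      have "s r * (x * (e r * y)) = (s r * (x * e r)) * y" "e r * (x * (e r * y)) = (e r * (x * e r)) * y"
        "x * (e r * y) * s r = x * (e r * (y * s r))" "x * (e r * y) * e r = x * (e r * (y * e r))"
        by (simp_all add: mult.assoc)
      then show ?case using J_left J_right eJ sandwich[OF r] J_e by auto
    qed (auto simp: distrib_left distrib_right intro: J.intros)
    then show "s r * x \<in> J r" "x * s r \<in> J r" "e r * x \<in> J r" "x * e r \<in> J r" by auto
  qed
  have "a \<in> D r" using A_Suc_D r a by auto
  then have "\<forall>x\<in>J r. a * x \<in> J r \<and> x * a \<in> J r"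
  proof (induction rule: D.induct)
    case (D_s u v)
    then show ?case using se J_left J_right by (simp add: mult.assoc) (metis mult.assoc)
  next
    case (D_e u v)
    then show ?case using se J_left J_right by (simp add: mult.assoc) (metis mult.assoc)
  qed (auto simp: distrib_left distrib_right J_left J_right intro: J.intros)
  then show "a * x \<in> J r" "x * a \<in> J r" using x by auto
qed

text \<open>Descends from \<open>i = r\<close> by
  \<open>e i = e i * e (Suc i) * e i\<close>.\<close>

lemma J_contains_e:
  assumes r: "r < N" and i: "1 \<le> i" "i \<le> r"
  shows "e i \<in> J r"
  using i(2,1)
proof (induction rule: inc_induct)
  case base
  then show ?case using J.J_e[of 1 r 1] A_1 by auto
next
  case (step i)
  then have "e i * e (Suc i) * e i \<in> J r"
    using r A_gens[of i "Suc r"] by (intro J_ideal) auto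
  then show ?case using eee(1)[of i] step r by simp
qed

end

section \<open>Consequences of \<open>\<Phi> = 0\<close> modulo \<open>J\<close>\<close>

locale brauer_quot = brauer_rels +
  assumes N4: "4 \<le> N"
    and Phi: "(1 - s 1) * (1 - s 3) * e 2 * ((1 - s 1) * (1 - s 3)) - (1 - s 1) * (1 - s 3) -
      sc (1/4) * ((1 - s 1) * (1 - s 3)) * e 2 * (s 1 * s 3 * e 2 * s 3 * s 1) * ((1 - s 1) * (1 - s 3)) = 0"
begin

definition X where "X i = 1 - s i"

lemma X_A: "\<lbrakk>1 \<le> i; i < n\<rbrakk> \<Longrightarrow> X i \<in> A n"
  by (simp add: X_def A_diff A_1 A_gens)

lemma sc_two: "sc 2 * x = x + x"
  using sc_add[of 1 1] by (simp add: sc_one mult_2)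

lemma X_square: "\<lbrakk>1 \<le> i; i < N\<rbrakk> \<Longrightarrow> X i * X i = X i + X i"
  by (simp add: X_def algebra_simps ss)

lemma X_braid: "\<lbrakk>1 \<le> i; Suc i < N\<rbrakk> \<Longrightarrow> X i * X (Suc i) * X i - X i = X (Suc i) * X i * X (Suc i) - X (Suc i)"
  using ss[of i] ss[of "Suc i"] sss[of i] by (simp add: X_def algebra_simps)

lemma J_minus: "\<lbrakk>1 \<le> r; x \<in> J r\<rbrakk> \<Longrightarrow> - x \<in> J r"
  using J_left[of x r "- 1"] A_minus[OF A_1] by simp

lemma J_diff: "\<lbrakk>1 \<le> r; x \<in> J r; y \<in> J r\<rbrakk> \<Longrightarrow> x - y \<in> J r"
  using J_add[of x r "- y"] J_minus by simp

lemma J_0: "0 \<in> J r"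
  using J_e[of 0 r 0] A_0 by simp

lemma X_shift:
  assumes "1 \<le> i" "Suc i < N"
  shows "s i * s (Suc i) * X i * (s (Suc i) * s i) = X (Suc i)"
proof -
  have "s i * s (Suc i) * s i * (s (Suc i) * s i) = s (Suc i) * (s i * (s (Suc i) * s (Suc i)) * s i)"
    unfolding sss[OF assms] by (simp only: mult.assoc)
  also have "\<dots> = s (Suc i)" using ss[of i] ss[of "Suc i"] assms by simp
  finally have 1: "s i * s (Suc i) * s i * (s (Suc i) * s i) = s (Suc i)" .
  have "s i * s (Suc i) * (s (Suc i) * s i) = s i * (s (Suc i) * s (Suc i)) * s i"
    by (simp only: mult.assoc)
  also have "\<dots> = 1" using ss[of i] ss[of "Suc i"] assms by simp
  finally show ?thesis using 1 by (simp add: X_def right_diff_distrib left_diff_distrib)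
qed

lemma X_commute: "\<lbrakk>1 \<le> i; i + 2 \<le> j; j < N\<rbrakk> \<Longrightarrow> X i * X j = X j * X i"
  using ss_far[of i j] by (simp add: X_def algebra_simps)

text \<open>Modulo \<open>J\<close> the element \<open>\<Phi>\<close> becomes \<open>-X\<^sub>1X\<^sub>3\<close>; all other \<open>X\<^sub>iX\<^sub>j\<close> are conjugate to it.\<close>

lemma X_far_J:
  assumes r: "r < N" and ij: "1 \<le> i" "i + 2 \<le> j" "j \<le> r"
  shows "X i * X j \<in> J r"
proof -
  have r3: "3 \<le> r" using ij by simp
  define F where "F = X 1 * X 3"
  have AX: "X 1 \<in> A (Suc r)" "X 3 \<in> A (Suc r)" using r3 by (auto intro: X_A)
  have AF: "F \<in> A (Suc r)" unfolding F_def using AX by (rule A_mult)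
  have e2: "e 2 \<in> J r" using J_contains_e[of r 2] r r3 by simp
  have "F = F * e 2 * F - sc (1/4) * F * e 2 * (s 1 * s 3 * e 2 * s 3 * s 1) * F"
  proof -
    have "b = a - c" if "a - b - c = 0" for a b c :: 'a
      using that by (simp add: algebra_simps)
    from this[OF Phi] show ?thesis by (simp only: F_def X_def)
  qed
  moreover have "F * e 2 * F \<in> J r"
    using J_ideal[OF _ r] r3 AF e2 by simp
  moreover have "sc (1/4) * F * e 2 * (s 1 * s 3 * e 2 * s 3 * s 1) * F \<in> J r"
  proof -
    have "s 1 * s 3 * e 2 * s 3 * s 1 \<in> A (Suc r)"
      using r3 A_gens[of 1 "Suc r"] A_gens[of 2 "Suc r"] A_gens[of 3 "Suc r"] by (intro A_mult) auto
    moreover have "sc (1/4) * F \<in> A (Suc r)" using AF by (rule A_scale)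
    ultimately show ?thesis using J_ideal[OF _ r] r3 AF e2 by simp
  qed
  ultimately have "F \<in> J r" using J_diff[of r] r3 by (metis One_nat_def Suc_leD numeral_3_eq_3)
  \<comment> \<open>Conjugation by \<open>s k * s (Suc k)\<close> raises one index by one and leaves
    a distant index alone. Starting from the pair (1, 3), first \<open>j\<close> and then
    \<open>i\<close> is raised to its final value.\<close>
  have shift: "X i' * X j' \<in> J r"
    if "X i * X j \<in> J r" "s k * s (Suc k) * (X i * X j) * (s (Suc k) * s k) = X i' * X j'" "1 \<le> k" "Suc k \<le> r"
    for i j k i' j'
  proof -
    have "s k \<in> A (Suc r)" "s (Suc k) \<in> A (Suc r)" using that A_gens[of k "Suc r"] A_gens[of "Suc k" "Suc r"] by auto
    then show ?thesis using that(1) r3 J_ideal[OF _ r] A_mult unfolding that(2)[symmetric] by simp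
  qed
  have inv: "s (Suc k) * s k * (s k * s (Suc k)) = 1" if "1 \<le> k" "Suc k \<le> r" for k
  proof -
    have "s (Suc k) * s k * (s k * s (Suc k)) = s (Suc k) * (s k * s k) * s (Suc k)" by (simp only: mult.assoc)
    then show ?thesis using ss[of k] ss[of "Suc k"] that r by simp
  qed
  have sX: "s k * X l = X l * s k" if "1 \<le> k" "1 \<le> l" "k + 2 \<le> l \<or> l + 2 \<le> k" "k \<le> r" "l \<le> r" for k l
    using ss_far[of k l] ss_far[of l k] that r by (auto simp: X_def algebra_simps)
  have 1: "X 1 * X j \<in> J r" if "3 \<le> j" "j \<le> r" for j
    using that
  proof (induction j rule: dec_induct)
    case base show ?case using \<open>F \<in> J r\<close> by (simp add: F_def)
  next
    case (step j)
    have c: "s j * X 1 = X 1 * s j" "s (Suc j) * X 1 = X 1 * s (Suc j)" using sX[of j 1] sX[of "Suc j" 1] step by auto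
    have "s j * s (Suc j) * (X 1 * X j) * (s (Suc j) * s j) = s j * (s (Suc j) * X 1) * X j * (s (Suc j) * s j)"
      by (simp only: mult.assoc)
    also have "\<dots> = (s j * X 1) * (s (Suc j) * X j * (s (Suc j) * s j))"
      unfolding c(2) by (simp only: mult.assoc)
    also have "\<dots> = X 1 * (s j * s (Suc j) * X j * (s (Suc j) * s j))"
      unfolding c(1) by (simp only: mult.assoc)
    finally have "s j * s (Suc j) * (X 1 * X j) * (s (Suc j) * s j) = X 1 * (s j * s (Suc j) * X j * (s (Suc j) * s j))" .
    then show ?case using shift[of 1 j j 1 "Suc j"] step X_shift[of j] r by auto
  qed
  show ?thesis
    using ij(1,2)
  proof (induction i rule: dec_induct)
    case base show ?case using 1[of j] ij by simp
  next
    case (step i)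
    have c: "s i * X j = X j * s i" "s (Suc i) * X j = X j * s (Suc i)" using sX[of i j] sX[of "Suc i" j] step ij by auto
    have "s i * s (Suc i) * (X i * X j) * (s (Suc i) * s i) = s i * s (Suc i) * X i * ((X j * s (Suc i)) * s i)"
      by (simp only: mult.assoc)
    also have "\<dots> = s i * s (Suc i) * X i * (s (Suc i) * (X j * s i))"
      unfolding c(2)[symmetric] by (simp only: mult.assoc)
    also have "\<dots> = s i * s (Suc i) * X i * (s (Suc i) * s i) * X j"
      unfolding c(1)[symmetric] by (simp only: mult.assoc)
    finally show ?case using shift[of i j i "Suc i" j] step X_shift[of i] r ij by auto
  qed
qed

text \<open>The signed sum over the permutations of three consecutive strands, expressed in the
  \<open>X i\<close>. The braid relation makes it symmetric in the two generators.\<close>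

definition Z where "Z i = X i * X (Suc i) * X i - X i"

lemma Z_A: "\<lbrakk>1 \<le> i; Suc i < n\<rbrakk> \<Longrightarrow> Z i \<in> A n"
  by (simp add: Z_def A_diff A_mult X_A)

lemma Z_alt: "\<lbrakk>1 \<le> i; Suc i < N\<rbrakk> \<Longrightarrow> Z i = X (Suc i) * X i * X (Suc i) - X (Suc i)"
  unfolding Z_def by (rule X_braid)

text \<open>Let \<open>u\<close> and \<open>v\<close> antisymmetrize the first and the last three of
  four strands. Since \<open>x * z\<close> lies in \<open>J r\<close>, so do \<open>z * u\<close>,
  \<open>x * v\<close> and \<open>v * x\<close>. Expanding \<open>y * (z * u)\<close> and
  \<open>v * x * y\<close> gives \<open>v\<close> congruent to \<open>u\<close>, and then
  \<open>2 u = x * u\<close> is congruent to \<open>x * v\<close>, hence to 0.\<close>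

lemma Z_J:
  assumes r: "r < N" and i: "1 \<le> i" "Suc (Suc i) \<le> r"
  shows "Z i \<in> J r" "Z (Suc i) \<in> J r"
proof -
  let ?S = "A (Suc r)"
  define x y z where "x = X i" "y = X (Suc i)" "z = X (Suc (Suc i))"
  note defs = this
  have A: "x \<in> ?S" "y \<in> ?S" "z \<in> ?S" using i by (auto simp: defs intro: X_A)
  have f: "x * z \<in> J r" using X_far_J[OF r i(1), of "Suc (Suc i)"] i by (simp add: defs)
  have zx: "z * x = x * z" using X_commute[of i "Suc (Suc i)"] i r by (simp add: defs)
  define u v where "u = x * y * x - x" "v = y * z * y - y"
  have sq: "x * x = x + x" "z * z = z + z" using X_square i r by (auto simp: defs)
  have u: "u = y * x * y - y" using X_braid[of i] i r by (simp add: u_v_def defs)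
  have v: "v = z * y * z - z" using X_braid[of "Suc i"] i r by (simp add: u_v_def defs)
  note id = J_ideal[OF _ r]
  have r1: "1 \<le> r" using i by simp
  have zu: "z * u \<in> J r"
  proof -
    have "z * u = x * z * (y * x) - x * z" by (simp add: u_v_def right_diff_distrib mult.assoc[symmetric] zx)
    then show ?thesis using id[OF r1 f] A f by (auto intro!: J_diff[OF r1] A_mult)
  qed
  have xv: "x * v \<in> J r"
  proof -
    have "x * v = x * z * (y * z) - x * z" by (simp add: v right_diff_distrib mult.assoc[symmetric])
    then show ?thesis using id[OF r1 f] A f by (auto intro!: J_diff[OF r1] A_mult)
  qed
  have vx: "v * x \<in> J r"
  proof -
    have "v * x = (z * y) * (x * z) - x * z" using zx by (simp add: v left_diff_distrib mult.assoc)
    then show ?thesis using id[OF r1 f] A f by (auto intro!: J_diff[OF r1] A_mult)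
  qed
  have vu: "v - u \<in> J r"
  proof -
    have "y * (z * u) = y * z * (y * x * y) - y * z * y" by (simp add: u right_diff_distrib mult.assoc)
    moreover have "v * x * y = y * z * (y * x * y) - y * x * y" by (simp add: u_v_def left_diff_distrib mult.assoc)
    ultimately have "v - u = v * x * y - y * (z * u)" by (simp add: u) (simp add: u_v_def)
    then show ?thesis using id[OF r1 vx] id[OF r1 zu] A by (auto intro!: J_diff[OF r1])
  qed
  have "x * u = u + u" using sq by (simp add: u_v_def right_diff_distrib mult.assoc[symmetric] distrib_right)
  then have "sc 2 * u = x * v - x * (v - u)" by (simp add: sc_two right_diff_distrib)
  then have "sc 2 * u \<in> J r" using id[OF r1 vu] xv A by (auto intro!: J_diff[OF r1])
  then have "sc (1/2) * (sc 2 * u) \<in> J r" using A_sc by (rule J_left)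
  moreover have "sc (1/2) * (sc 2 * u) = u" by (simp add: mult.assoc[symmetric] sc_mult[symmetric] sc_one)
  ultimately have uJ: "u \<in> J r" by simp
  then show "Z i \<in> J r" by (simp add: Z_def u_v_def defs)
  have "v = (v - u) + u" by simp
  then have "v \<in> J r" using vu uJ J_add by metis
  then show "Z (Suc i) \<in> J r" by (simp add: Z_def u_v_def defs)
qed

section \<open>Monotone products and a spanning set modulo \<open>J\<close>\<close>

definition d where
  "d i j = prod_list (map X (if i \<le> j then [i..<Suc j] else rev [j..<Suc i]))"

lemma d_same: "d i i = X i"
  by (simp add: d_def)

lemma d_up: "i < j \<Longrightarrow> d i j = X i * d (Suc i) j"
  unfolding d_def by (subst upt_conv_Cons) auto

lemma d_down: "j \<le> i \<Longrightarrow> d (Suc i) j = X (Suc i) * d i j"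
  by (auto simp: d_def)

text \<open>The clause \<open>y = 1\<close> serves the case \<open>r = 2\<close>, where
  \<open>Z_K\<close> admits no further factor to the right of \<open>Z 1\<close>.\<close>

lemma d_rest:
  assumes "1 \<le> i" "i < n" "1 \<le> j" "j < n"
  shows "\<exists>y\<in>A n. d i j = X i * y \<and> (i = j \<longrightarrow> y = 1)"
proof -
  have P: "prod_list (map X xs) \<in> A n" if "set xs \<subseteq> {1..<n}" for xs
    using that by (induction xs) (auto simp: A_1 X_A A_mult)
  have dA: "d i j \<in> A n" if "1 \<le> i" "i < n" for i
    unfolding d_def using that assms by (intro P) auto
  consider "i = j" | "i < j" | k where "i = Suc k" "j \<le> k"
    by (metis less_eq_Suc_le linorder_cases Suc_le_D le_simps(2))
  then show ?thesis
  proof cases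
    case 1 then show ?thesis by (auto simp: d_same A_1)
  next
    case 2 then show ?thesis using d_up[of i j] dA[of "Suc i"] assms by auto
  next
    case 3 then show ?thesis using d_down[of j k] dA[of k] assms by auto
  qed
qed

text \<open>\<open>Z 1\<close> enters for \<open>r = 2\<close> alone: as soon as there is a fourth
  strand it lies in \<open>J r\<close> by \<open>Z_J\<close>.\<close>

inductive_set K :: "nat \<Rightarrow> 'a set" for r where
  K_sc: "sc c \<in> K r"
| K_d: "\<lbrakk>1 \<le> i; i \<le> r; 1 \<le> j; j \<le> r\<rbrakk> \<Longrightarrow> sc c * d i j \<in> K r"
| K_Z: "r = 2 \<Longrightarrow> sc c * Z 1 \<in> K r"
| K_J: "x \<in> J r \<Longrightarrow> x \<in> K r"
| K_add: "\<lbrakk>x \<in> K r; y \<in> K r\<rbrakk> \<Longrightarrow> x + y \<in> K r"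

lemma Z_K:
  assumes r: "r < N" and i: "1 \<le> i" "Suc i \<le> r" and y: "y \<in> A (Suc r)" "r = 2 \<longrightarrow> y = 1"
  shows "Z i * y \<in> K r"
proof (cases "r = 2")
  case True
  then have "i = 1" using i by simp
  then show ?thesis using K_Z[of r 1] True y by (simp add: sc_one)
next
  case False
  then have "Z i \<in> J r"
    using Z_J[OF r, of i] Z_J[OF r, of "i - 1"] i by (cases "Suc (Suc i) \<le> r") auto
  then show ?thesis using J_ideal[OF _ r _ y(1)] i by (intro K_J) auto
qed

text \<open>A new letter \<open>X k\<close> repeats the first letter, extends the path, turns it
  back, or is far from it. Repetition doubles the path. Turning back leaves an antisymmetrizer term
  and a shorter path, since \<open>X k * X i * X k\<close> is an antisymmetrizer plus
  \<open>X k\<close>. A far letter gives an element of \<open>J r\<close>.\<close>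

lemma X_d:
  assumes r: "r < N" and k: "1 \<le> k" "k \<le> r" and i: "1 \<le> i" "i \<le> r" and j: "1 \<le> j" "j \<le> r"
  shows "X k * d i j \<in> K r"
proof -
  have dK: "d i j \<in> K r" if "1 \<le> i" "i \<le> r" for i using K_d[of i r j 1] that j by (simp add: sc_one)
  obtain y where y: "y \<in> A (Suc r)" "d i j = X i * y" "i = j \<longrightarrow> y = 1" using d_rest[of i "Suc r" j] i j by auto
  obtain z where z: "z \<in> A (Suc r)" "d k j = X k * z" "k = j \<longrightarrow> z = 1" using d_rest[of k "Suc r" j] k j by auto
  consider "k = i" | "k = Suc i" "j \<le> i" | "i = Suc k" "i \<le> j" | "k = Suc i" "i < j" | "i = Suc k" "j \<le> k"
    | "k + 2 \<le> i" | "i + 2 \<le> k" by linarith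
  then show ?thesis
  proof cases
    case 1
    have "X k * d i j = sc 2 * d i j"
      using X_square[of i] i r 1 by (simp add: y sc_two mult.assoc[symmetric] distrib_right)
    then show ?thesis using K_d i j by simp
  next
    case 2 then show ?thesis using d_down[of j i] dK[of k] k by simp
  next
    case 3 then show ?thesis using d_up[of k j] dK[of k] k by simp
  next
    case 4
    have "X k * d i j = X k * X i * X k * z" using 4 d_up[of i j] z by (simp add: mult.assoc)
    also have "\<dots> = Z i * z + d k j" using Z_alt[of i] 4 k r i z(2) by (simp add: left_diff_distrib)
    finally show ?thesis using Z_K[OF r i(1) _ z(1)] z 4 k j i dK[of k] by (auto intro!: K_add)
  next
    case 5
    have "X k * d i j = X k * X i * X k * z" using 5 d_down[of j k] z by (simp add: mult.assoc)
    also have "\<dots> = Z k * z + d k j" using 5 by (simp add: Z_def z left_diff_distrib)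
    finally show ?thesis using Z_K[OF r k(1) _ z(1)] z 5 k j i dK[of k] by (auto intro!: K_add)
  next
    case 6
    then have "X k * X i \<in> J r" using X_far_J[OF r k(1)] i by simp
    then show ?thesis using J_ideal[OF _ r _ y(1)] i by (simp add: y mult.assoc[symmetric] K_J)
  next
    case 7
    then have "X k * X i \<in> J r" using X_far_J[OF r i(1), of k] X_commute[of i k] k r i by simp
    then show ?thesis using J_ideal[OF _ r _ y(1)] i by (simp add: y mult.assoc[symmetric] K_J)
  qed
qed

lemma K_scale: "\<lbrakk>x \<in> K r; 1 \<le> r\<rbrakk> \<Longrightarrow> sc c * x \<in> K r"
proof (induction rule: K.induct)
  case (K_sc b) then show ?case using K.K_sc[of "c * b"] by (simp add: sc_mult)
next
  case (K_d i j b) then show ?case using K.K_d[of i r j "c * b"] by (simp add: sc_mult mult.assoc)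
next
  case (K_Z b) then show ?case using K.K_Z[of r "c * b"] by (simp add: sc_mult mult.assoc)
next
  case (K_J x) then show ?case using J_left A_sc K.K_J by auto
next
  case (K_add x y) then show ?case by (simp add: distrib_left K.K_add)
qed

text \<open>Stability under \<open>X k\<close> yields stability under \<open>s k = 1 - X k\<close>,
  while \<open>e k * x\<close> falls into the ideal \<open>J r\<close>; the latter uses the
  inclusion of \<open>K r\<close> in \<open>A (Suc r)\<close>.\<close>

lemma A_K:
  assumes r: "r < N" "1 \<le> r"
  shows "x \<in> A (Suc r) \<Longrightarrow> x \<in> K r"
proof -
  note id = J_ideal[OF r(2,1)]
  have X: "X k * x \<in> K r" if "x \<in> K r" and k: "1 \<le> k" "k \<le> r" for x k
    using that(1)
  proof (induction rule: K.induct)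
    case (K_sc c)
    then show ?case using K.K_d[of k r k c] k by (simp add: d_same sc_comm)
  next
    case (K_d i j c)
    then show ?case using K_scale[OF X_d[OF r(1) k, of i j] r(2), of c]
      by (simp add: mult.assoc[symmetric] sc_comm[of c "X k"])
  next
    case (K_Z c)
    have "X k * Z 1 = sc 2 * Z 1"
    proof (cases "k = 1")
      case True
      then show ?thesis using X_square[of 1] r by (simp add: Z_def sc_two right_diff_distrib mult.assoc[symmetric] distrib_right)
    next
      case False
      then have "k = Suc 1" using K_Z k by simp
      then show ?thesis using X_square[of k] r k Z_alt[of 1] K_Z by (simp add: sc_two right_diff_distrib mult.assoc[symmetric] distrib_right)
    qed
    then have "X k * (sc c * Z 1) = sc (c * 2) * Z 1"       by (simp add: mult.assoc[symmetric] sc_comm[of c "X k", symmetric]) (simp add: mult.assoc sc_mult)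
    then show ?case using K.K_Z[OF K_Z] by simp
  next
    case (K_J x) then show ?case using id(1) X_A[of k "Suc r"] k K.K_J by auto
  next
    case (K_add x y) then show ?case by (simp add: distrib_left K.K_add)
  qed
  have s: "s k * x \<in> K r" if "x \<in> K r" "1 \<le> k" "k \<le> r" for x k
  proof -
    have "s k * x = x + sc (- 1) * (X k * x)" by (simp add: X_def sc_minus sc_one left_diff_distrib)
    then show ?thesis using that X[of x k] K_scale[OF _ r(2)] by (auto intro!: K_add)
  qed
  have KA: "x \<in> A (Suc r)" if "x \<in> K r" for x
    using that
  proof (induction rule: K.induct)
    case (K_d i j c)
    then obtain y where "y \<in> A (Suc r)" "d i j = X i * y" using d_rest[of i "Suc r" j] by auto
    then show ?case using K_d by (simp add: A_scale A_mult X_A)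
  next
    case (K_J x)
    then show ?case using J_A r by blast
  next
    case (K_Z c)
    then show ?case using Z_A[of 1 "Suc r"] by (intro A_scale) auto
  qed (auto intro: A_sc A_add)
  have e: "e k * x \<in> K r" if "x \<in> K r" "1 \<le> k" "k \<le> r" for x k
    using id(2)[OF J_contains_e KA[OF that(1)]] that r by (intro K_J) auto
  show "x \<in> A (Suc r) \<Longrightarrow> x \<in> K r"
    by (induction rule: A.induct) (auto intro: K_sc K_add s e)
qed

lemma K_expand:
  assumes "1 \<le> r" "x \<in> K r"
  shows "\<exists>c m z y. y \<in> J r \<and> (r \<noteq> 2 \<longrightarrow> z = 0) \<and>
    x = sc c + (\<Sum>i=1..r. \<Sum>j=1..r. sc (m i j) * d i j) + sc z * Z 1 + y"
  using assms(2)
proof (induction rule: K.induct)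
  case (K_sc c)
  then show ?case by (intro exI[of _ c] exI[of _ "\<lambda>_ _. 0"] exI[of _ 0]) (simp add: J_0)
next
  case (K_d i j c)
  have "(\<Sum>i'=1..r. \<Sum>j'=1..r. sc (if i' = i \<and> j' = j then c else 0) * d i' j') =
    (\<Sum>i'=1..r. if i' = i then \<Sum>j'=1..r. (if j' = j then sc c * d i j else 0) else 0)"
    by (intro sum.cong refl) (auto simp: if_distrib[of sc] if_distrib[of "\<lambda>x. x * _"] cong: if_cong)
  also have "\<dots> = sc c * d i j" using K_d by simp
  finally show ?case
    by (intro exI[of _ 0] exI[of _ "\<lambda>i' j'. if i' = i \<and> j' = j then c else 0"] exI[of _ 0]) (simp add: J_0)
next
  case (K_Z c)
  then show ?case by (intro exI[of _ 0] exI[of _ "\<lambda>_ _. 0"] exI[of _ c]) (auto simp: J_0)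
next
  case (K_J x)
  then show ?case by (intro exI[of _ 0] exI[of _ "\<lambda>_ _. 0"] exI[of _ x]) auto
next
  case (K_add x x')
  then obtain c m z y c' m' z' y' where
    *: "y \<in> J r" "r \<noteq> 2 \<longrightarrow> z = 0" "x = sc c + (\<Sum>i=1..r. \<Sum>j=1..r. sc (m i j) * d i j) + sc z * Z 1 + y"
    "y' \<in> J r" "r \<noteq> 2 \<longrightarrow> z' = 0" "x' = sc c' + (\<Sum>i=1..r. \<Sum>j=1..r. sc (m' i j) * d i j) + sc z' * Z 1 + y'"
    by blast
  show ?case
    by (intro exI[of _ "c + c'"] exI[of _ "\<lambda>i j. m i j + m' i j"] exI[of _ "z + z'"] exI[of _ "y + y'"])
      (use * in \<open>auto simp: sc_add distrib_right sum.distrib J_add\<close>)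
qed

end

section \<open>The standard form\<close>

definition dot :: "complex^3 \<Rightarrow> complex^3 \<Rightarrow> complex" where "dot v w = (\<Sum>i\<in>UNIV. v $ i * w $ i)"

abbreviation ax :: "3 \<Rightarrow> complex^3" where "ax j \<equiv> axis j 1"

lemma dot_linear: "Vector_Spaces.linear (*s) (*) (dot v)" "Vector_Spaces.linear (*s) (*) (\<lambda>v. dot v w)"
proof -
  have "module ((*) :: complex \<Rightarrow> complex \<Rightarrow> complex)" by standard (auto simp: algebra_simps)
  then have vs: "vector_space ((*) :: complex \<Rightarrow> complex \<Rightarrow> complex)"
    by (simp add: module_iff_vector_space)
  then show "Vector_Spaces.linear (*s) (*) (dot v)" "Vector_Spaces.linear (*s) (*) (\<lambda>v. dot v w)"
    by (auto intro!: Vector_Spaces.linear.intro vec.vector_space_axioms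
      simp: module_hom_axioms_def module_hom_def vec.module_axioms module_iff_vector_space
        dot_def algebra_simps sum.distrib sum_distrib_left)
qed

lemma dot_axis [simp]: "dot (axis j 1) (axis k 1) = (if j = k then 1 else 0)"
  by (simp add: dot_def axis_def if_distrib[where f = "\<lambda>x. _ * x"] cong: if_cong)

lemma dot_sym: "dot v w = dot w v"
  by (simp add: dot_def mult.commute)

lemma basis_family_axis: "basis_family ax"
proof -
  have r: "range ax = cart_basis" by (auto simp: cart_basis_def)
  have "inj ax" by (auto simp: inj_def axis_def vec_eq_iff split: if_splits)
  then show ?thesis by (simp add: basis_family_def r independent_cart_basis)
qed

interpretation std: form dot ax ax
  by (intro form.intro dot_linear) (auto simp: dot_sym dual_bases_def basis_family_axis)

lemma std_MN: "std.M a c = (if a = c then 1 else 0)" "std.N x y = (if x = y then 1 else 0)"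
proof -
  show "std.M a c = (if a = c then 1 else 0)" by (simp add: std.M_def)
  have "std.N x y = (\<Sum>j\<in>UNIV. if x = j then (if y = j then 1 else 0) else 0)"
    unfolding std.N_def by (intro sum.cong refl) (auto simp: axis_def)
  then show "std.N x y = (if x = y then 1 else 0)" by auto
qed

lemma std_S: "std.S t u v = (\<Sum>a\<in>UNIV. t (u @ a # a # v))"
  by (simp add: std.S_def std_MN if_distrib[where f = "\<lambda>x. x * _"] cong: if_cong)

lemma std_ct_at: "length u = k \<Longrightarrow> std.ct k t (u @ x # y # v) = (if x = y then \<Sum>a\<in>UNIV. t (u @ a # a # v) else 0)"
  by (simp add: std.ct_at std_MN std_S)

section \<open>Matrix units and coordinates of tensors\<close>

definition munit :: "3 \<Rightarrow> 3 \<Rightarrow> complex^3 \<Rightarrow> complex^3" where "munit i j v = v $ j *s axis i 1"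

lemma on_factor_munit:
  "length u = k \<Longrightarrow> on_factor k (munit i j) t (u @ x # v) = (if x = i then t (u @ j # v) else 0)"
proof -
  assume "length u = k"
  then have "on_factor k (munit i j) t (u @ x # v) = (\<Sum>a\<in>UNIV. if a = j then (if x = i then t (u @ j # v) else 0) else 0)"
    unfolding on_factor_at[OF \<open>length u = k\<close>] by (intro sum.cong refl) (auto simp: munit_def axis_def)
  then show ?thesis by simp
qed

lemma on_factor_munit':
  "length u = k \<Longrightarrow> on_factor (Suc k) (munit i j) t (u @ x # y # v) = (if y = i then t (u @ x # j # v) else 0)"
  using on_factor_munit[of "u @ [x]" "Suc k" i j t y v] by simp

text \<open>With matrix units E, the contraction is the sum of all E_ac tensor E_ac. Multiplying its
  second factor by E_ji from the left and E_ij from the right leaves E_ii tensor E_jj, and these sum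
  to the identity. This allows \<open>e r\<close> to be cancelled in
  \<open>null_cancel_e\<close>.\<close>

lemma id_from_contraction:
  assumes "Suc k < n" "t \<in> tensor_power n"
  shows "(\<Sum>i\<in>UNIV. \<Sum>j\<in>UNIV. on_factor (Suc k) (munit j i) (std.ct k (on_factor (Suc k) (munit i j) t))) = t"
    (is "?L = t")
proof (rule tensor_power_eqI2[of k n])
  have W: "(\<Sum>i\<in>I. f i) \<in> tensor_power n" if "\<And>i. f i \<in> tensor_power n" for I :: "3 set" and f
    using that by (intro tensor_powerI) (auto simp: sum_apply intro!: sum.neutral tensor_powerD)
  show "?L \<in> tensor_power n"
    by (intro W on_factor_W contract_factors_W assms(2))
  fix u :: "3 list" and x y v assume u: "length u = k"
  have "?L (u @ x # y # v) = (\<Sum>i\<in>UNIV. \<Sum>j\<in>UNIV. if j = y then (if i = x then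
      \<Sum>a\<in>UNIV. (if a = i then t (u @ a # y # v) else 0) else 0) else 0)"
    unfolding sum_apply using u
    by (intro sum.cong refl) (auto simp: on_factor_munit' std_ct_at)
  then show "?L (u @ x # y # v) = t (u @ x # y # v)" by simp
qed (use assms in auto)

definition unit_tensor :: "3 list \<Rightarrow> tensor" where "unit_tensor v = (\<lambda>w. if w = v then 1 else 0)"

lemma unit_tensor_W: "length v = n \<Longrightarrow> unit_tensor v \<in> tensor_power n"
  by (auto simp: unit_tensor_def tensor_power_def)

abbreviation words :: "nat \<Rightarrow> 3 list set" where "words n \<equiv> {w. length w = n}"

lemma finite_words: "finite (words n)"
  using finite_lists_length_eq[of "UNIV :: 3 set" n] by simp

lemma unit_tensor_expand:
  assumes "t \<in> tensor_power n"
  shows "t = (\<Sum>v\<in>words n. tensor_scale (t v) (unit_tensor v))"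
proof (rule tensor_power_eqI[OF assms])
  show "(\<Sum>v\<in>words n. tensor_scale (t v) (unit_tensor v)) \<in> tensor_power n"
    by (intro tensor_powerI) (auto simp: sum_apply tensor_scale_def unit_tensor_def intro!: sum.neutral)
  fix w :: "3 list" assume "length w = n"
  then show "t w = (\<Sum>v\<in>words n. tensor_scale (t v) (unit_tensor v)) w"
    by (simp add: sum_apply tensor_scale_def unit_tensor_def finite_words if_distrib[where f = "\<lambda>x. _ * x"] cong: if_cong)
qed

lemma swap_unit_sym:
  assumes "k + 1 < n" "length v = n" "length w = n"
  shows "swap_factors k (unit_tensor v) w = swap_factors k (unit_tensor w) v"
proof -
  obtain u x y z where v: "v = u @ x # y # z" "length u = k" using split2[of k v] assms by auto
  obtain u' x' y' z' where w: "w = u' @ x' # y' # z'" "length u' = k" using split2[of k w] assms by auto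
  show ?thesis using v w by (auto simp: swap_factors_at unit_tensor_def)
qed

lemma ct_unit_sym:
  assumes "k + 1 < n" "length v = n" "length w = n"
  shows "std.ct k (unit_tensor v) w = std.ct k (unit_tensor w) v"
proof -
  obtain u x y z where v: "v = u @ x # y # z" "length u = k" using split2[of k v] assms by auto
  obtain u' x' y' z' where w: "w = u' @ x' # y' # z'" "length u' = k" using split2[of k w] assms by auto
  have "(\<Sum>a\<in>UNIV. unit_tensor (p @ c # d # q) (p' @ a # a # q')) = (if p = p' \<and> c = d \<and> q = q' then 1 else 0)"
    if "length p' = length p" for p p' q q' c d
  proof -
    have "(\<Sum>a\<in>UNIV. unit_tensor (p @ c # d # q) (p' @ a # a # q')) =
      (\<Sum>a\<in>UNIV. if a = c then (if p = p' \<and> c = d \<and> q = q' then 1 else 0) else 0)"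
      using that by (intro sum.cong refl) (auto simp: unit_tensor_def)
    then show ?thesis by simp
  qed
  then show ?thesis using v w by (auto simp: std_ct_at)
qed

text \<open>Gram-Schmidt by induction on the coordinates: the functions of \<open>K\<close> that
  vanish at \<open>i\<close> form a subspace \<open>K0\<close>, and \<open>K\<close> is either
  \<open>K0\<close> or \<open>K0\<close> plus a line spanned by some \<open>k\<close> orthogonal to
  \<open>K0\<close>.\<close>

lemma orthogonal_projection_exists:
  fixes K :: "('x \<Rightarrow> complex) set"
  assumes "finite I"
    and add: "\<And>f g. \<lbrakk>f \<in> K; g \<in> K\<rbrakk> \<Longrightarrow> (\<lambda>x. f x + g x) \<in> K"
    and scale: "\<And>f c. f \<in> K \<Longrightarrow> (\<lambda>x. c * f x) \<in> K"
    and zero: "(\<lambda>x. 0) \<in> K"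
  shows "\<exists>g\<in>K. \<forall>h\<in>K. (\<Sum>x\<in>I. (f x - g x) * cnj (h x)) = 0"
  using assms
proof (induction I arbitrary: f K rule: finite_induct)
  case empty
  then show ?case by auto
next
  case (insert i I)
  note K = insert.prems
  define K0 where "K0 = {h \<in> K. h i = 0}"
  have K0: "(\<lambda>x. f x + g x) \<in> K0" "(\<lambda>x. c * f x) \<in> K0" "(\<lambda>x. 0) \<in> K0"
    if "f \<in> K0" "g \<in> K0" for f g c
    using that K by (auto simp: K0_def)
  have K00: "(\<lambda>x. 0) \<in> K0" using K by (simp add: K0_def)
  have proj: "\<exists>g\<in>K0. \<forall>h\<in>K0. (\<Sum>x\<in>insert i I. (f x - g x) * cnj (h x)) = 0" for f
  proof -
    obtain g where "g \<in> K0" "\<forall>h\<in>K0. (\<Sum>x\<in>I. (f x - g x) * cnj (h x)) = 0"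
      using insert.IH[of K0 f] K0 K00 by blast
    then show ?thesis using insert.hyps by (intro bexI[of _ g]) (auto simp: K0_def)
  qed
  show ?case
  proof (cases "K0 = K")
    case True
    then show ?thesis using proj[of f] by simp
  next
    case False
    then obtain k0 where k0: "k0 \<in> K" "k0 i \<noteq> 0" by (auto simp: K0_def)
    obtain g0 where g0: "g0 \<in> K0" "\<forall>h\<in>K0. (\<Sum>x\<in>insert i I. (k0 x - g0 x) * cnj (h x)) = 0"
      using proj[of k0] by blast
    define k where "k = (\<lambda>x. k0 x + (-1) * g0 x)"
    have k: "k \<in> K" "k i \<noteq> 0" using k0 g0(1) K(1)[OF k0(1) K(2)[of g0 "-1"]] by (auto simp: k_def K0_def)
    have korth: "(\<Sum>x\<in>insert i I. k x * cnj (h x)) = 0" if "h \<in> K0" for h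
      using g0(2) that by (simp add: k_def)
    have korth': "(\<Sum>x\<in>insert i I. h x * cnj (k x)) = 0" if "h \<in> K0" for h
    proof -
      have "(\<Sum>x\<in>insert i I. h x * cnj (k x)) = cnj (\<Sum>x\<in>insert i I. k x * cnj (h x))"
        by (simp add: mult.commute)
      then show ?thesis using korth[OF that] by simp
    qed
    define n where "n = (\<Sum>x\<in>insert i I. k x * cnj (k x))"
    have "n = of_real (\<Sum>x\<in>insert i I. (cmod (k x))\<^sup>2)"
      by (simp only: n_def complex_norm_square of_real_sum)
    moreover have "(\<Sum>x\<in>insert i I. (cmod (k x))\<^sup>2) > 0"
      using insert.hyps k by (intro sum_pos2[of _ i]) auto
    ultimately have n: "n \<noteq> 0" by (metis less_irrefl of_real_eq_0_iff)
    obtain g where g: "g \<in> K0" "\<forall>h\<in>K0. (\<Sum>x\<in>insert i I. (f x - g x) * cnj (h x)) = 0"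
      using proj[of f] by blast
    define c where "c = (\<Sum>x\<in>insert i I. f x * cnj (k x)) / n"
    define p where "p = (\<lambda>x. g x + c * k x)"
    have pK: "p \<in> K" unfolding p_def using g(1) k K by (auto simp: K0_def)
    have diff: "(\<Sum>x\<in>insert i I. (f x - p x) * cnj (h x)) =
      (\<Sum>x\<in>insert i I. (f x - g x) * cnj (h x)) - c * (\<Sum>x\<in>insert i I. k x * cnj (h x))" for h
      by (simp add: p_def algebra_simps sum_subtractf sum_distrib_left sum.distrib del: sum.insert)
    have 1: "(\<Sum>x\<in>insert i I. (f x - p x) * cnj (h x)) = 0" if "h \<in> K0" for h
      using diff[of h] g(2) korth that by simp
    have 2: "(\<Sum>x\<in>insert i I. (f x - p x) * cnj (k x)) = 0"
    proof -
      have "(\<Sum>x\<in>insert i I. (f x - g x) * cnj (k x)) = (\<Sum>x\<in>insert i I. f x * cnj (k x)) - (\<Sum>x\<in>insert i I. g x * cnj (k x))"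
        by (simp only: left_diff_distrib sum_subtractf)
      also have "\<dots> = c * n" using korth'[OF g(1)] n by (simp only: c_def) simp
      finally show ?thesis unfolding diff n_def[symmetric] by simp
    qed
    show ?thesis
    proof (intro bexI[OF _ pK] ballI)
      fix h assume h: "h \<in> K"
      \<comment> \<open>Subtracting this multiple of \<open>k\<close> makes \<open>h\<close> vanish
        at \<open>i\<close>, which puts \<open>h0\<close> into \<open>K0\<close>.\<close>
      define a where "a = h i / k i"
      define h0 where "h0 = (\<lambda>x. h x + (- a) * k x)"
      have "k i \<noteq> 0" by (rule k(2))
      then have h0: "h0 \<in> K0" using h k K(1)[OF h K(2)[OF k(1), of "- a"]] by (simp add: h0_def K0_def a_def)
      have "(\<Sum>x\<in>insert i I. (f x - p x) * cnj (h x)) =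
        (\<Sum>x\<in>insert i I. (f x - p x) * cnj (h0 x)) + cnj a * (\<Sum>x\<in>insert i I. (f x - p x) * cnj (k x))"
        by (simp add: h0_def algebra_simps sum_subtractf sum_distrib_left sum.distrib del: sum.insert)
      then show "(\<Sum>x\<in>insert i I. (f x - p x) * cnj (h x)) = 0" using 1[OF h0] 2 by simp
    qed
  qed
qed

section \<open>The action on tensors\<close>

locale std_rep = brauer_quot sc s e N
  for sc :: "complex \<Rightarrow> 'a::ring_1" and s e N +
  fixes \<rho> :: "'a \<Rightarrow> tensor \<Rightarrow> tensor"
  assumes \<rho>_W: "t \<in> tensor_power N \<Longrightarrow> \<rho> x t \<in> tensor_power N"
    and \<rho>_arg_add: "\<lbrakk>t \<in> tensor_power N; u \<in> tensor_power N\<rbrakk> \<Longrightarrow> \<rho> x (t + u) = \<rho> x t + \<rho> x u"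
    and \<rho>_arg_scale: "t \<in> tensor_power N \<Longrightarrow> \<rho> x (tensor_scale c t) = tensor_scale c (\<rho> x t)"
    and \<rho>_add: "t \<in> tensor_power N \<Longrightarrow> \<rho> (x + y) t = \<rho> x t + \<rho> y t"
    and \<rho>_mult: "t \<in> tensor_power N \<Longrightarrow> \<rho> (x * y) t = \<rho> x (\<rho> y t)"
    and \<rho>_sc: "t \<in> tensor_power N \<Longrightarrow> \<rho> (sc c) t = tensor_scale c t"
    and \<rho>_s: "\<lbrakk>1 \<le> i; i < N; t \<in> tensor_power N\<rbrakk> \<Longrightarrow> \<rho> (s i) t = swap_factors (i - 1) t"
    and \<rho>_e: "\<lbrakk>1 \<le> i; i < N; t \<in> tensor_power N\<rbrakk> \<Longrightarrow> \<rho> (e i) t = std.ct (i - 1) t"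
begin

abbreviation W where "W \<equiv> tensor_power N"

lemma W_add: "\<lbrakk>t \<in> W; u \<in> W\<rbrakk> \<Longrightarrow> t + u \<in> W"
  and W_scale: "t \<in> W \<Longrightarrow> tensor_scale c t \<in> W"
  and W_0: "0 \<in> W"
  by (auto intro!: tensor_powerI simp: tensor_powerD tensor_scale_def)

lemma W_sum: "(\<And>i. i \<in> I \<Longrightarrow> f i \<in> W) \<Longrightarrow> sum f I \<in> W"
  by (induction I rule: infinite_finite_induct) (auto simp: W_0 W_add)

lemma \<rho>_1: "t \<in> W \<Longrightarrow> \<rho> 1 t = t"
  using \<rho>_sc[of t 1] by (simp add: sc_one tensor_scale_def)

lemma \<rho>_0: "t \<in> W \<Longrightarrow> \<rho> 0 t = 0"
  using \<rho>_sc[of t 0] by (simp add: tensor_scale_def fun_eq_iff)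

lemma \<rho>_minus: "t \<in> W \<Longrightarrow> \<rho> (- x) t = - \<rho> x t"
  using \<rho>_add[of t x "- x"] \<rho>_0 by (simp add: eq_neg_iff_add_eq_0 add.commute)

lemma \<rho>_diff: "t \<in> W \<Longrightarrow> \<rho> (x - y) t = \<rho> x t - \<rho> y t"
  using \<rho>_add[of t x "- y"] \<rho>_minus by simp

lemma \<rho>_arg_0: "\<rho> x 0 = 0"
proof -
  have 0: "tensor_scale 0 t = 0" for t by (simp add: tensor_scale_def fun_eq_iff)
  show ?thesis using \<rho>_arg_scale[OF W_0, of x 0] by (simp only: 0)
qed

lemma \<rho>_sum: "t \<in> W \<Longrightarrow> \<rho> (\<Sum>i\<in>I. f i) t = (\<Sum>i\<in>I. \<rho> (f i) t)"
  by (induction I rule: infinite_finite_induct) (simp_all add: \<rho>_0 \<rho>_add del: plus_fun_apply)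

lemma \<rho>_arg_sum: "(\<And>i. i \<in> I \<Longrightarrow> f i \<in> W) \<Longrightarrow> \<rho> x (\<Sum>i\<in>I. f i) = (\<Sum>i\<in>I. \<rho> x (f i))"
  by (induction I rule: infinite_finite_induct) (simp_all add: \<rho>_arg_0 \<rho>_arg_add W_sum del: plus_fun_apply)

lemma tscale: "tensor_scale c t w = c * t w"
  by (simp add: tensor_scale_def)

subsection \<open>Faithfulness of multiplication by \<open>e\<^sub>r\<close>\<close>

definition null where "null x \<longleftrightarrow> (\<forall>t\<in>W. \<rho> x t = 0)"

lemma null_mult: "null x \<Longrightarrow> null (y * x)" "null x \<Longrightarrow> null (x * y)"
  by (simp_all add: null_def \<rho>_mult \<rho>_arg_0 \<rho>_W)

text \<open>Tensor factors are numbered from 0, so generators of index below \<open>r\<close> touch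
  only the factors up to \<open>r - 1\<close>; factor \<open>r\<close> is the one that
  \<open>e r\<close> adds.\<close>

lemma \<rho>_on_factor:
  assumes "r < N" "x \<in> A r" "t \<in> W"
  shows "\<rho> x (on_factor r f t) = on_factor r f (\<rho> x t)"
  using assms(2)
proof (induction rule: A.induct)
  case (A_sc c)
  then show ?case using assms by (simp add: \<rho>_sc on_factor_W on_factor_linear)
next
  case (A_add x y)
  then show ?case using assms by (simp add: \<rho>_add on_factor_W on_factor_linear del: plus_fun_apply)
next
  case (A_s i x)
  then show ?case using assms by (simp add: \<rho>_mult \<rho>_s on_factor_W \<rho>_W on_factor_far)
next
  case (A_e i x)
  then show ?case using assms by (simp add: \<rho>_mult \<rho>_e on_factor_W \<rho>_W on_factor_far)
qed

text \<open>\<open>id_from_contraction\<close> rewrites the argument or the value of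
  \<open>x\<close> as a sum of terms containing \<open>e r\<close>. As \<open>x\<close> commutes
  with the operators on factor \<open>r\<close>, it can be brought next to
  \<open>e r\<close>.\<close>

lemma null_cancel_e:
  assumes r: "1 \<le> r" "r < N" and x: "x \<in> A r" and null: "null (x * e r) \<or> null (e r * x)"
  shows "null x"
  unfolding null_def
proof
  fix t assume t: "t \<in> W"
  let ?f = "\<lambda>i j. on_factor r (munit i j)"
  have id: "(\<Sum>i\<in>UNIV. \<Sum>j\<in>UNIV. ?f j i (\<rho> (e r) (?f i j t))) = t" if "t \<in> W" for t
    using id_from_contraction[of "r - 1" N t] r that by (simp add: \<rho>_e on_factor_W)
  from null show "\<rho> x t = 0"
  proof
    assume n: "null (x * e r)"
    have "\<rho> x t = \<rho> x (\<Sum>i\<in>UNIV. \<Sum>j\<in>UNIV. ?f j i (\<rho> (e r) (?f i j t)))" by (simp only: id[OF t])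
    also have "\<dots> = (\<Sum>i\<in>UNIV. \<Sum>j\<in>UNIV. ?f j i (\<rho> (x * e r) (?f i j t)))"
      using t by (simp add: \<rho>_arg_sum W_sum on_factor_W \<rho>_W \<rho>_on_factor[OF r(2) x] \<rho>_mult)
    also have "\<dots> = 0"
      using n t by (simp add: null_def on_factor_W on_factor_0)
    finally show ?thesis .
  next
    assume n: "null (e r * x)"
    have "\<rho> x t = (\<Sum>i\<in>UNIV. \<Sum>j\<in>UNIV. ?f j i (\<rho> (e r) (?f i j (\<rho> x t))))" by (simp only: id[OF \<rho>_W[OF t]])
    also have "\<dots> = (\<Sum>i\<in>UNIV. \<Sum>j\<in>UNIV. ?f j i (\<rho> (e r * x) (?f i j t)))"
      using t by (simp add: on_factor_W \<rho>_W \<rho>_on_factor[OF r(2) x] \<rho>_mult)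
    also have "\<dots> = 0"
      using n t by (simp add: null_def on_factor_W on_factor_0)
    finally show ?thesis .
  qed
qed

subsection \<open>A left identity of \<open>J\<close> modulo the kernel\<close>

definition mat where "mat x w v = \<rho> x (unit_tensor v) w"

lemma \<rho>_mat:
  assumes "t \<in> W"
  shows "\<rho> x t w = (\<Sum>v\<in>words N. mat x w v * t v)"
proof -
  have "\<rho> x t = \<rho> x (\<Sum>v\<in>words N. tensor_scale (t v) (unit_tensor v))"
    using unit_tensor_expand[OF assms] by (rule arg_cong)
  also have "\<dots> = (\<Sum>v\<in>words N. \<rho> x (tensor_scale (t v) (unit_tensor v)))"
    by (rule \<rho>_arg_sum) (simp add: W_scale unit_tensor_W)
  also have "\<dots> = (\<Sum>v\<in>words N. tensor_scale (t v) (\<rho> x (unit_tensor v)))"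
    by (intro sum.cong refl \<rho>_arg_scale) (auto intro: unit_tensor_W)
  finally show ?thesis by (simp add: sum_apply mat_def tscale mult.commute)
qed

lemma null_mat: "null x \<longleftrightarrow> (\<forall>w\<in>words N. \<forall>v\<in>words N. mat x w v = 0)"
proof
  assume "null x"
  then show "\<forall>w\<in>words N. \<forall>v\<in>words N. mat x w v = 0"
    by (simp add: null_def mat_def unit_tensor_W)
next
  assume *: "\<forall>w\<in>words N. \<forall>v\<in>words N. mat x w v = 0"
  have "\<rho> x t w = 0" if "t \<in> W" for t w
  proof (cases "length w = N")
    case True
    then show ?thesis using * by (simp add: \<rho>_mat[OF that])
  qed (rule tensor_powerD[OF \<rho>_W[OF that]])
  then show "null x" by (auto simp: null_def)
qed

lemma mat_mult: "v \<in> words N \<Longrightarrow> mat (x * y) w v = (\<Sum>u\<in>words N. mat x w u * mat y u v)"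
  using \<rho>_mat[of "\<rho> y (unit_tensor v)" x w]
  by (simp add: mat_def[of "x * y"] mat_def[of y] \<rho>_mult \<rho>_W unit_tensor_W)

lemma mat_add: "v \<in> words N \<Longrightarrow> mat (x + y) w v = mat x w v + mat y w v"
  by (simp add: mat_def \<rho>_add unit_tensor_W)

lemma mat_diff: "v \<in> words N \<Longrightarrow> mat (x - y) w v = mat x w v - mat y w v"
  by (simp add: mat_def \<rho>_diff unit_tensor_W)

lemma mat_scale: "v \<in> words N \<Longrightarrow> mat (sc c * x) w v = c * mat x w v"
  by (simp add: mat_def \<rho>_mult \<rho>_sc \<rho>_W unit_tensor_W tscale)

text \<open>A relation on the abstract algebra, so that no anti-involution of it has to be
  constructed.\<close>

definition adj where "adj x y \<longleftrightarrow> (\<forall>w\<in>words N. \<forall>v\<in>words N. mat y w v = cnj (mat x v w))"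

lemma adj_mult: "\<lbrakk>adj x x'; adj y y'\<rbrakk> \<Longrightarrow> adj (x * y) (y' * x')"
  by (simp add: adj_def mat_mult mult.commute)

lemma adj_add: "\<lbrakk>adj x x'; adj y y'\<rbrakk> \<Longrightarrow> adj (x + y) (x' + y')"
  by (simp add: adj_def mat_add)

lemma adj_gens:
  assumes "1 \<le> i" "i < N"
  shows "adj (s i) (s i)" "adj (e i) (e i)"
proof -
  have r: "cnj (unit_tensor v w) = unit_tensor v w" for v w by (simp add: unit_tensor_def)
  have rs: "cnj (swap_factors k (unit_tensor v) w) = swap_factors k (unit_tensor v) w" for k v w
    by (simp add: swap_factors_def r)
  have re: "cnj (std.ct k (unit_tensor v) w) = std.ct k (unit_tensor v) w" if lw: "length w = N" "k + 1 < N" for k v w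
  proof -
    obtain u x y z where "w = u @ x # y # z" "length u = k" using split2[of k w] lw by auto
    then show ?thesis by (simp add: std_ct_at r)
  qed
  show "adj (s i) (s i)"
    using swap_unit_sym[of "i - 1" N] assms by (simp add: adj_def mat_def \<rho>_s unit_tensor_W rs)
  show "adj (e i) (e i)"
    using ct_unit_sym[of "i - 1" N] assms by (simp add: adj_def mat_def \<rho>_e unit_tensor_W re)
qed

lemma A_adj: "x \<in> A r \<Longrightarrow> r \<le> N \<Longrightarrow> \<exists>y\<in>A r. adj x y"
proof (induction rule: A.induct)
  case (A_sc c)
  have "adj (sc c) (sc (cnj c))"
    by (simp add: adj_def mat_def \<rho>_sc unit_tensor_W tscale) (simp add: unit_tensor_def)
  then show ?case using A.A_sc by blast
next
  case (A_add x y) then show ?case using adj_add A.A_add by (meson)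
next
  case (A_s i x)
  then obtain y where "y \<in> A r" "adj x y" by auto
  then show ?case using adj_mult[OF adj_gens(1)[of i]] A_s A_gens[of i r] A_mult by (intro bexI[of _ "y * s i"]) auto
next
  case (A_e i x)
  then obtain y where "y \<in> A r" "adj x y" by auto
  then show ?case using adj_mult[OF adj_gens(2)[of i]] A_e A_gens[of i r] A_mult by (intro bexI[of _ "y * e i"]) auto
qed

lemma J_adj: "x \<in> J r \<Longrightarrow> 1 \<le> r \<Longrightarrow> r < N \<Longrightarrow> \<exists>y\<in>J r. adj x y"
proof (induction rule: J.induct)
  case (J_e x y)
  then obtain x' y' where *: "x' \<in> A r" "adj x x'" "y' \<in> A r" "adj y y'" using A_adj[of x r] A_adj[of y r] by auto
  have "adj (x * (e r * y)) ((y' * e r) * x')"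
    using * J_e adj_gens(2)[of r] by (intro adj_mult) auto
  moreover have "(y' * e r) * x' \<in> J r" using J.J_e[of y' r x'] * by (simp add: mult.assoc)
  ultimately show ?case by blast
next
  case (J_add x y) then show ?case using adj_add J.J_add by meson
qed

text \<open>With \<open>P\<close> the projection of \<open>1\<close> to \<open>J\<close> in the Hilbert-Schmidt inner product and
  \<open>z = (1 - P) y\<close>, one has \<open>\<langle>z, z\<rangle> = \<langle>1 - P, z y\<^sup>*\<rangle> = 0\<close>, as \<open>z y\<^sup>* \<in> J\<close>.\<close>

lemma J_left_identity:
  assumes r: "1 \<le> r" "r < N"
  shows "\<exists>P\<in>J r. \<forall>y\<in>J r. null ((1 - P) * y)"
proof -
  define HS where "HS x y = (\<Sum>w\<in>words N. \<Sum>v\<in>words N. mat x w v * cnj (mat y w v))" for x y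
  let ?I = "words N \<times> words N"
  \<comment> \<open>The cutoff makes \<open>?m\<close> additive and homogeneous at every pair; for
    \<open>mat\<close> this is known only for columns in \<open>words N\<close>.\<close>
  let ?m = "\<lambda>x (w, v). if v \<in> words N then mat x w v else 0"
  let ?K = "?m ` J r"
  have "\<exists>g\<in>?K. \<forall>h\<in>?K. (\<Sum>p\<in>?I. (?m 1 p - g p) * cnj (h p)) = 0"
  proof (rule orthogonal_projection_exists)
    show "finite ?I" using finite_words by simp
    show "(\<lambda>p. f p + g p) \<in> ?K" if fg: "f \<in> ?K" "g \<in> ?K" for f g
    proof -
      obtain x y where xy: "x \<in> J r" "y \<in> J r" "f = ?m x" "g = ?m y" using fg by auto
      have "(\<lambda>p. f p + g p) = ?m (x + y)" by (auto simp: xy mat_add)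
      then show ?thesis using xy J_add by blast
    qed
    show "(\<lambda>p. c * f p) \<in> ?K" if f: "f \<in> ?K" for f c
    proof -
      obtain x where x: "x \<in> J r" "f = ?m x" using f by auto
      have "(\<lambda>p. c * f p) = ?m (sc c * x)" by (auto simp: x mat_scale)
      then show ?thesis using x J_left[OF x(1) A_sc] by blast
    qed
    have "(\<lambda>p. 0) = ?m 0" by (auto simp: mat_def \<rho>_0 unit_tensor_W)
    then show "(\<lambda>p. 0) \<in> ?K" using J_0 by blast
  qed
  then obtain P where P: "P \<in> J r" "\<And>h. h \<in> J r \<Longrightarrow> (\<Sum>p\<in>?I. (?m 1 p - ?m P p) * cnj (?m h p)) = 0"
    by auto
  have orth: "HS (1 - P) h = 0" if "h \<in> J r" for h
  proof -
    have "HS (1 - P) h = (\<Sum>p\<in>?I. (?m 1 p - ?m P p) * cnj (?m h p))"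
      unfolding HS_def sum.cartesian_product by (intro sum.cong refl) (auto simp: mat_diff)
    then show ?thesis using P(2)[OF that] by simp
  qed
  have HS_adj: "HS (x * y) z = HS x (z * y')" if "adj y y'" for x y z y'
  proof -
    have "HS (x * y) z = (\<Sum>w\<in>words N. \<Sum>v\<in>words N. \<Sum>u\<in>words N. mat x w u * mat y u v * cnj (mat z w v))"
      by (simp add: HS_def mat_mult sum_distrib_right)
    also have "\<dots> = (\<Sum>w\<in>words N. \<Sum>u\<in>words N. \<Sum>v\<in>words N. mat x w u * mat y u v * cnj (mat z w v))"
      by (intro sum.cong refl sum.swap)
    also have "\<dots> = HS x (z * y')"
      using that by (simp add: HS_def mat_mult sum_distrib_left adj_def mult_ac)
    finally show ?thesis .
  qed
  have HS_null: "null z" if "HS z z = 0" for z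
  proof -
    have "HS z z = of_real (\<Sum>w\<in>words N. \<Sum>v\<in>words N. (cmod (mat z w v))\<^sup>2)"
      by (simp only: HS_def complex_norm_square of_real_sum)
    then have "(\<Sum>w\<in>words N. \<Sum>v\<in>words N. (cmod (mat z w v))\<^sup>2) = 0"
      using that by (metis of_real_eq_0_iff)
    then show ?thesis
      by (simp add: null_mat sum_nonneg_eq_0_iff finite_words sum_nonneg)
  qed
  have "null ((1 - P) * y)" if y: "y \<in> J r" for y
  proof -
    let ?z = "(1 - P) * y"
    obtain y' where y': "y' \<in> J r" "adj y y'" using J_adj[OF y r] by blast
    have up: "a \<in> A (Suc r)" if "a \<in> J r" for a using J_A[OF that r(1)] .
    have "?z = y - P * y" by (simp add: left_diff_distrib)
    then have "?z \<in> J r" using J_ideal(1)[OF r y] up[OF P(1)] J_diff[OF r(1)] y by auto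
    then have "?z * y' \<in> J r" using J_ideal(1)[OF r y'(1)] up by auto
    then have "HS ?z ?z = 0" using HS_adj[OF y'(2)] orth by simp
    then show ?thesis by (rule HS_null)
  qed
  then show ?thesis using P(1) by blast
qed

lemma J_faithful:
  assumes r: "1 \<le> r" "r < N" and IH: "\<And>z. \<lbrakk>z \<in> A r; null z\<rbrakk> \<Longrightarrow> z = 0"
    and x: "x \<in> J r" "null x"
  shows "x = 0"
proof -
  obtain P where P: "P \<in> J r" "\<And>y. y \<in> J r \<Longrightarrow> null ((1 - P) * y)" using J_left_identity[OF r] by blast
  have Je: "\<exists>y\<in>A r. j * e r = y * e r" if "j \<in> J r" for j
    using that
  proof (induction rule: J.induct)
    case (J_e x y)
    obtain y' where "y' \<in> A r" "e r * (y * e r) = y' * e r" using e_A_e[OF r J_e(2)] by auto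
    then show ?case using J_e by (intro bexI[of _ "x * y'"]) (auto simp: mult.assoc A_mult)
  next
    case (J_add x y)
    then obtain x' y' where "x' \<in> A r" "x * e r = x' * e r" "y' \<in> A r" "y * e r = y' * e r" by auto
    then show ?case by (intro bexI[of _ "x' + y'"]) (auto simp: distrib_right A_add)
  qed
  have eJ: "\<exists>y\<in>A r. e r * j = e r * y" if "j \<in> J r" for j
    using that
  proof (induction rule: J.induct)
    case (J_e x y)
    obtain x' where "x' \<in> A r" "e r * (x * e r) = e r * x'" using e_A_e[OF r J_e(1)] by auto
    then have "e r * (x * (e r * y)) = e r * (x' * y)" by (metis mult.assoc)
    then show ?case using J_e \<open>x' \<in> A r\<close> by (intro bexI[of _ "x' * y"]) (auto simp: A_mult)
  next
    case (J_add x y)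
    then obtain x' y' where "x' \<in> A r" "e r * x = e r * x'" "y' \<in> A r" "e r * y = e r * y'" by auto
    then show ?case by (intro bexI[of _ "x' + y'"]) (auto simp: distrib_left A_add)
  qed
  \<comment> \<open>Here \<open>P\<close> becomes a left identity in the algebra itself and not only
    modulo the kernel. Since \<open>J r * e r\<close> lies in \<open>A r * e r\<close>, the defect
    is \<open>(a - y) * e r\<close> with \<open>a - y\<close> in \<open>A r\<close>, to which
    \<open>null_cancel_e\<close> and \<open>IH\<close> apply.\<close>
  have P1: "P * a * e r = a * e r" if a: "a \<in> A r" for a
  proof -
    obtain y where y: "y \<in> A r" "(P * a) * e r = y * e r" using Je[OF J_right[OF P(1) a]] by auto
    have "a * e r \<in> J r" using J_e[OF a A_1] by simp
    then have "null ((1 - P) * (a * e r))" by (rule P(2))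
    moreover have "(1 - P) * (a * e r) = (a - y) * e r"
      using y by (simp add: left_diff_distrib mult.assoc)
    ultimately have "null (a - y)" using null_cancel_e[OF r, of "a - y"] a y by (auto simp: A_diff)
    then show ?thesis using IH[of "a - y"] a y by (simp add: A_diff)
  qed
  have Px: "P * y = y" if "y \<in> J r" for y
    using that
  proof (induction rule: J.induct)
    case (J_e x y)
    then show ?case using P1[of x] by (metis mult.assoc)
  qed (simp add: distrib_left)
  have "e r * a * x = 0" if a: "a \<in> A r" for a
  proof -
    obtain y where y: "y \<in> A r" "e r * (a * x) = e r * y" using eJ[OF J_left[OF x(1) a]] by auto
    have "null (e r * y)" unfolding y(2)[symmetric] using x(2) null_mult(1) by blast
    then have "null y" using null_cancel_e[OF r y(1)] by blast
    then show ?thesis using IH[OF y(1)] y by (simp add: mult.assoc)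
  qed
  note * = this
  have "j * x = 0" if "j \<in> J r" for j
    using that by (induction rule: J.induct) (use * in \<open>simp_all add: mult.assoc distrib_right\<close>)
  then show ?thesis using Px[OF x(1)] P(1) by simp
qed

subsection \<open>Faithfulness modulo \<open>J\<close>\<close>

text \<open>The rightmost factor from \<open>A r\<close> in each term of \<open>x\<close> keeps
  \<open>t\<close> inside \<open>H\<close>, and the \<open>e r\<close> to its left then annihilates
  the result.\<close>

lemma J_kills:
  assumes r: "r < N" "1 \<le> r" and H: "H \<subseteq> W" "0 \<in> H"
    "\<And>t u. \<lbrakk>t \<in> H; u \<in> H\<rbrakk> \<Longrightarrow> t + u \<in> H" "\<And>t c. t \<in> H \<Longrightarrow> tensor_scale c t \<in> H"
    and Hs: "\<And>i t. \<lbrakk>1 \<le> i; i \<le> r; t \<in> H\<rbrakk> \<Longrightarrow> \<rho> (s i) t \<in> H"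
    and He: "\<And>i t. \<lbrakk>1 \<le> i; i \<le> r; t \<in> H\<rbrakk> \<Longrightarrow> \<rho> (e i) t = 0"
    and x: "x \<in> J r" and t: "t \<in> H"
  shows "\<rho> x t = 0"
proof -
  have A: "\<rho> y t \<in> H" if "y \<in> A r" for y
    using that
  proof (induction rule: A.induct)
    case (A_sc c) then show ?case using H t by (auto simp: \<rho>_sc subset_iff)
  next
    case (A_add x y) then show ?case using H(1,3) t \<rho>_add[of t x y] by (metis subsetD)
  next
    case (A_s i x)
    then show ?case using H(1) t Hs[of i "\<rho> x t"] \<rho>_mult[of t "s i" x] r by (auto simp: subset_iff)
  next
    case (A_e i x)
    then have "\<rho> (e i * x) t = 0" using H(1) t He[of i "\<rho> x t"] \<rho>_mult[of t "e i" x] r by (auto simp: subset_iff)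
    then show ?case using H(2) by (simp only:)
  qed
  have tW: "t \<in> W" using H t by auto
  from x show ?thesis
  proof (induction rule: J.induct)
    case (J_e x y)
    then show ?case using He[of r, OF r(2) order_refl A[OF J_e(2)]] tW by (simp add: \<rho>_mult \<rho>_W \<rho>_arg_0)
  qed (use tW in \<open>simp add: \<rho>_add\<close>)
qed

section \<open>Harmonic tensors with one factor orthogonal to the isotropic vector\<close>

definition iso_vec :: "complex^3" where "iso_vec = vector [1, \<i>, 0]"
definition perp_vec :: "complex^3" where "perp_vec = vector [0, 0, 1]"

lemma dot_iso: "dot iso_vec iso_vec = 0" "dot iso_vec perp_vec = 0" "dot perp_vec iso_vec = 0"
  by (simp_all add: dot_def iso_vec_def perp_vec_def sum_3)

definition vecs where "vecs b = map (\<lambda>k. if k = b then perp_vec else iso_vec) [0..<N]"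
definition T where "T b = pure_tensor (vecs b)"
text \<open>The coordinate at \<open>probe a\<close> reads off the coefficient of
  \<open>T a\<close>: the third entry is 1 for \<open>perp_vec\<close> and 0 for
  \<open>iso_vec\<close>, the first entry the reverse.\<close>

definition probe :: "nat \<Rightarrow> 3 list" where "probe a = map (\<lambda>k. if k = a then 3 else 1) [0..<N]"

lemma T_W: "T b \<in> W"
  by (simp add: T_def vecs_def pure_tensor_in)

lemma T_probe: "a < N \<Longrightarrow> b < N \<Longrightarrow> T b (probe a) = (if a = b then 1 else 0)"
proof -
  assume ab: "a < N" "b < N"
  have "T b (probe a) = (\<Prod>k<N. (if k = b then perp_vec else iso_vec) $ (if k = a then 3 else 1))"
    unfolding T_def pure_tensor_def by (simp add: vecs_def probe_def)
  also have "\<dots> = (if a = b then 1 else 0)"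
  proof (cases "a = b")
    case True
    then show ?thesis by (auto intro!: prod.neutral simp: perp_vec_def iso_vec_def)
  next
    case False
    then have "\<exists>k\<in>{..<N}. (if k = b then perp_vec else iso_vec) $ (if k = a then 3 else 1) = 0"
      using ab by (intro bexI[of _ b]) (auto simp: perp_vec_def)
    then show ?thesis using False by (subst prod_zero) auto
  qed
  finally show ?thesis .
qed

lemma \<rho>_s_T:
  assumes "1 \<le> i" "i < N"
  shows "\<rho> (s i) (T b) = T (Transposition.transpose (i - 1) i b)"
proof -
  have "(vecs b)[i - 1 := vecs b ! i, i := vecs b ! (i - 1)] = vecs (Transposition.transpose (i - 1) i b)"
    using assms by (intro nth_equalityI) (auto simp: vecs_def nth_list_update Transposition.transpose_def)
  then show ?thesis
    using swap_factors_pure[of "i - 1" "vecs b"] assms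
    by (simp add: \<rho>_s T_W) (simp add: T_def vecs_def)
qed

lemma \<rho>_e_T:
  assumes "1 \<le> i" "i < N"
  shows "\<rho> (e i) (T b) = 0"
proof -
  have "dot (vecs b ! (i - 1)) (vecs b ! i) = 0"
    using assms by (auto simp: vecs_def dot_iso)
  then have "std.ct (i - 1) (T b) = tensor_scale 0 (\<Sum>j\<in>UNIV. pure_tensor ((vecs b)[i - 1 := ax j, i := ax j]))"
    using contract_factors_pure[OF dot_linear, of "i - 1" "vecs b" ax ax] assms
    by (simp add: T_def) (simp add: vecs_def)
  also have "\<dots> = 0" by (simp add: fun_eq_iff tscale)
  finally show ?thesis using assms by (simp add: \<rho>_e T_W)
qed

lemma J_T:
  assumes r: "r < N" "1 \<le> r" and x: "x \<in> J r"
  shows "\<rho> x (T b) = 0"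
proof -
  \<comment> \<open>The bound \<open>max r b\<close> makes the index range contain \<open>b\<close>
    and be stable under the transpositions belonging to \<open>s 1\<close> up to
    \<open>s r\<close>.\<close>
  define H where "H = {t. \<exists>c. t = (\<Sum>b\<le>max r b. tensor_scale (c b) (T b))}"
  let ?m = "max r b"
  show ?thesis
  proof (rule J_kills[OF r _ _ _ _ _ _ x])
    show "H \<subseteq> W" by (auto simp: H_def intro!: W_sum W_scale T_W)
    show "0 \<in> H" unfolding H_def by (auto intro!: exI[of _ "\<lambda>_. 0"] simp: fun_eq_iff sum_apply tscale)
    show "t + u \<in> H" if tu: "t \<in> H" "u \<in> H" for t u
    proof -
      from tu obtain c c' where "t = (\<Sum>b\<le>?m. tensor_scale (c b) (T b))" "u = (\<Sum>b\<le>?m. tensor_scale (c' b) (T b))"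
        by (auto simp: H_def)
      then have "t + u = (\<Sum>b\<le>?m. tensor_scale (c b + c' b) (T b))"
        by (auto simp: fun_eq_iff sum_apply tscale sum.distrib distrib_right)
      then show ?thesis by (auto simp: H_def)
    qed
    show "tensor_scale c t \<in> H" if t: "t \<in> H" for t c
    proof -
      from t obtain c' where "t = (\<Sum>b\<le>?m. tensor_scale (c' b) (T b))" by (auto simp: H_def)
      then have "tensor_scale c t = (\<Sum>b\<le>?m. tensor_scale (c * c' b) (T b))"
        by (auto simp: fun_eq_iff sum_apply tscale sum_distrib_left mult.assoc)
      then show ?thesis by (auto simp: H_def)
    qed
    show "\<rho> (s i) t \<in> H" if i: "1 \<le> i" "i \<le> r" "t \<in> H" for i t
    proof -
      let ?\<tau> = "Transposition.transpose (i - 1) i"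
      from i obtain c where "t = (\<Sum>b\<le>?m. tensor_scale (c b) (T b))" by (auto simp: H_def)
      then have "\<rho> (s i) t = (\<Sum>b\<le>?m. tensor_scale (c b) (T (?\<tau> b)))"
        using i r by (simp add: \<rho>_arg_sum W_scale T_W \<rho>_arg_scale \<rho>_s_T)
      also have "\<dots> = (\<Sum>b\<le>?m. tensor_scale (c (?\<tau> b)) (T b))"
        by (rule sum.reindex_bij_witness[of _ ?\<tau> ?\<tau>])
          (use i in \<open>auto simp: Transposition.transpose_def\<close>)
      finally show ?thesis unfolding H_def by (intro CollectI exI[of _ "\<lambda>b. c (?\<tau> b)"])
    qed
    show "\<rho> (e i) t = 0" if i: "1 \<le> i" "i \<le> r" "t \<in> H" for i t
    proof -
      from i obtain c where "t = (\<Sum>b\<le>?m. tensor_scale (c b) (T b))" by (auto simp: H_def)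
      then have "\<rho> (e i) t = (\<Sum>b\<le>?m. tensor_scale (c b) 0)"
        using i r by (simp add: \<rho>_arg_sum W_scale T_W \<rho>_arg_scale \<rho>_e_T)
      then show ?thesis by (simp add: fun_eq_iff sum_apply tscale)
    qed
    have "T b = (\<Sum>b'\<le>?m. tensor_scale (if b' = b then 1 else 0) (T b'))"
      by (auto simp: fun_eq_iff sum_apply tscale if_distrib[where f = "\<lambda>x. x * _"] cong: if_cong)
    then show "T b \<in> H" unfolding H_def by (intro CollectI exI[of _ "\<lambda>b'. if b' = b then 1 else 0"])
  qed
qed

text \<open>The \<open>T b\<close> span a permutation module, on which \<open>d i j\<close> acts as the rank one operator
  \<open>path_sign i j \<cdot> R i \<otimes> \<alpha> j\<close>; the coordinates of \<open>R i = T (i - 1) - T i\<close> are again \<open>\<alpha> i\<close>.\<close>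

definition \<alpha> :: "nat \<Rightarrow> nat \<Rightarrow> complex" where "\<alpha> i b = (if Suc b = i then 1 else if b = i then - 1 else 0)"
definition path_sign :: "nat \<Rightarrow> nat \<Rightarrow> complex" where "path_sign i j = (- 1) ^ (if i \<le> j then j - i else i - j)"

definition R where "R i = T (i - 1) - T i"

lemma \<rho>_X_T:
  assumes "1 \<le> i" "i < N"
  shows "\<rho> (X i) (T b) = tensor_scale (\<alpha> i b) (R i)"
  using assms
  by (auto simp: X_def \<rho>_diff \<rho>_1 \<rho>_s_T T_W \<alpha>_def Transposition.transpose_def tensor_scale_def fun_eq_iff R_def)

lemma R_W: "R i \<in> W"
  by (rule tensor_powerI) (simp add: R_def tensor_powerD[OF T_W])

lemma \<rho>_arg_diff: "\<lbrakk>t \<in> W; u \<in> W\<rbrakk> \<Longrightarrow> \<rho> x (t - u) = \<rho> x t - \<rho> x u"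
proof -
  assume tu: "t \<in> W" "u \<in> W"
  then have "t - u \<in> W" by (auto intro!: tensor_powerI simp: tensor_powerD)
  then have "\<rho> x t = \<rho> x (t - u) + \<rho> x u" using \<rho>_arg_add[of "t - u" u x] tu by (simp del: plus_fun_apply)
  then show ?thesis by simp
qed

text \<open>Neighbouring vectors \<alpha> have inner product -1; this is the source of
  \<open>path_sign\<close>.\<close>

lemma \<rho>_X_\<alpha>:
  assumes "1 \<le> i" "i < N" "1 \<le> j" "i = Suc j \<or> j = Suc i"
  shows "\<rho> (X i) (tensor_scale c (R j)) = tensor_scale (- c) (R i)"
proof -
  have "\<rho> (X i) (R j) = tensor_scale (\<alpha> i (j - 1)) (R i) - tensor_scale (\<alpha> i j) (R i)"
    unfolding R_def[of j] using assms by (simp add: \<rho>_arg_diff T_W \<rho>_X_T)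
  moreover have "\<rho> (X i) (tensor_scale c (R j)) = tensor_scale c (\<rho> (X i) (R j))"
    by (simp add: \<rho>_arg_scale R_W)
  ultimately show ?thesis using assms by (auto simp: \<alpha>_def tensor_scale_def fun_eq_iff)
qed

lemma \<rho>_d_T:
  assumes "1 \<le> i" "i < N" "1 \<le> j" "j < N"
  shows "\<rho> (d i j) (T b) = tensor_scale (path_sign i j * \<alpha> j b) (R i)"
proof (cases "i \<le> j")
  case True
  then show ?thesis using assms(1)
  proof (induction i rule: inc_induct)
    case base
    then show ?case using assms by (simp add: d_same \<rho>_X_T path_sign_def)
  next
    case (step i)
    have "path_sign i j = - path_sign (Suc i) j"
      using step by (simp add: path_sign_def Suc_diff_Suc[symmetric, of i j])
    then show ?case
      using step assms \<rho>_X_\<alpha>[of i "Suc i"] by (simp add: d_up \<rho>_mult T_W)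
  qed
next
  case False
  then have "j \<le> i" by simp
  then show ?thesis using assms(2)
  proof (induction i rule: dec_induct)
    case base
    then show ?case using assms by (simp add: d_same \<rho>_X_T path_sign_def)
  next
    case (step i)
    have "path_sign (Suc i) j = - path_sign i j"
      using step by (auto simp: path_sign_def Suc_diff_le)
    then show ?case
      using step assms \<rho>_X_\<alpha>[of "Suc i" i] by (simp add: d_down \<rho>_mult T_W)
  qed
qed

lemma \<alpha>_sum: "\<lbrakk>1 \<le> j; j \<le> r\<rbrakk> \<Longrightarrow> (\<Sum>b\<le>r. \<alpha> j b) = 0"
proof -
  assume j: "1 \<le> j" "j \<le> r"
  then have "(\<Sum>b\<le>r. \<alpha> j b) = (\<Sum>b\<in>{j - 1, j}. \<alpha> j b)"
    by (intro sum.mono_neutral_right) (auto simp: \<alpha>_def)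
  then show ?thesis using j by (simp add: \<alpha>_def)
qed

text \<open>The system is triangular: at \<open>a = i - 1\<close> only the vectors with index
  \<open>i\<close> and \<open>i - 1\<close> can be nonzero, and the coefficient of the latter has
  already been shown to vanish.\<close>

lemma \<alpha>_independent:
  assumes h: "\<And>a. a \<le> r \<Longrightarrow> (\<Sum>i=1..r. h i * \<alpha> i a) = 0" and i: "1 \<le> i" "i \<le> r"
  shows "h i = 0"
proof -
  have "i \<le> r \<Longrightarrow> 1 \<le> i \<longrightarrow> h i = 0" for i
  proof (induction i)
    case (Suc a)
    have "(\<Sum>i=1..r. h i * \<alpha> i a) = (\<Sum>i\<in>{Suc a}. h i * \<alpha> i a)"
    proof (rule sum.mono_neutral_right)
      show "\<forall>i\<in>{1..r} - {Suc a}. h i * \<alpha> i a = 0"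
        using Suc by (auto simp: \<alpha>_def)
    qed (use Suc in auto)
    then show ?case using h[of a] Suc by (simp add: \<alpha>_def)
  qed simp
  then show ?thesis using i by blast
qed

text \<open>At least two of the first three factors of \<open>T b\<close> equal
  \<open>iso_vec\<close>, so antisymmetrizing them gives zero. Hence these tensors cannot detect
  \<open>Z 1\<close>, and \<open>r = 2\<close> gets a separate argument in
  \<open>A_null_J\<close>.\<close>

lemma Z_T:
  assumes "2 < N"
  shows "\<rho> (Z 1) (T b) = 0"
proof -
  have "\<rho> (X 1) (\<rho> (X 2) (\<rho> (X 1) (T b))) = \<rho> (X 1) (T b)"
    using \<rho>_X_T[of 1 b] \<rho>_X_\<alpha>[of 2 1] \<rho>_X_\<alpha>[of 1 2] assms by simp
  then show ?thesis by (simp add: Z_def \<rho>_diff T_W \<rho>_mult \<rho>_W numeral_2_eq_2)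
qed

lemma A_null_J:
  assumes r: "r < N" "1 \<le> r" and x: "x \<in> A (Suc r)" "null x"
  shows "x \<in> J r"
proof -
  obtain c m z y where y: "y \<in> J r" "r \<noteq> 2 \<longrightarrow> z = 0"
    and xe: "x = sc c + (\<Sum>i=1..r. \<Sum>j=1..r. sc (m i j) * d i j) + sc z * Z 1 + y"
    using K_expand[OF r(2) A_K[OF r x(1)]] by blast
  define \<mu> where "\<mu> i j = m i j * path_sign i j" for i j
  have eval: "c * (if a = b then 1 else 0) + (\<Sum>i=1..r. \<Sum>j=1..r. \<mu> i j * \<alpha> j b * \<alpha> i a) = 0"
    if ab: "a \<le> r" "b \<le> r" for a b
  proof -
    have zZ: "\<rho> (sc z * Z 1) (T b) = 0"
    proof (cases "r = 2")
      case True
      then show ?thesis using Z_T[of b] r by (simp add: \<rho>_mult T_W \<rho>_arg_0)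
    next
      case False
      then show ?thesis using y(2) by (simp add: \<rho>_0 T_W)
    qed
    have d: "\<rho> (sc (m i j) * d i j) (T b) (probe a) = \<mu> i j * \<alpha> j b * \<alpha> i a"
      if "i \<in> {1..r}" "j \<in> {1..r}" for i j
    proof -
      have "R i (probe a) = \<alpha> i a"
        using that ab r by (auto simp: R_def T_probe \<alpha>_def)
      then show ?thesis
        using that r \<rho>_d_T[of i j b] by (simp add: \<rho>_mult T_W \<rho>_sc W_scale R_W \<rho>_W tscale \<mu>_def)
    qed
    have "0 = \<rho> x (T b) (probe a)" using x(2) T_W by (simp add: null_def)
    also have "\<dots> = c * T b (probe a) + (\<Sum>i=1..r. \<Sum>j=1..r. \<rho> (sc (m i j) * d i j) (T b) (probe a))"
      using J_T[OF r y(1), of b] zZ unfolding xe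
      by (simp add: \<rho>_add \<rho>_sum T_W sum_apply \<rho>_sc tscale)
    also have "\<dots> = c * (if a = b then 1 else 0) + (\<Sum>i=1..r. \<Sum>j=1..r. \<mu> i j * \<alpha> j b * \<alpha> i a)"
      using ab r d by (simp add: T_probe)
    finally show ?thesis by simp
  qed
  \<comment> \<open>Summing the row \<open>a = 0\<close> over all \<open>b\<close> removes every
    rank one term, because the entries of each \<alpha> sum to zero; only the contribution
    \<open>c\<close> of the identity matrix remains.\<close>
  have c0: "c = 0"
  proof -
    have "0 = (\<Sum>b\<le>r. c * (if 0 = b then 1 else 0) + (\<Sum>i=1..r. \<Sum>j=1..r. \<mu> i j * \<alpha> j b * \<alpha> i 0))"
      by (rule sum.neutral[symmetric]) (use eval[of 0] in auto)
    also have "\<dots> = c + (\<Sum>b\<le>r. \<Sum>i=1..r. \<Sum>j=1..r. \<mu> i j * \<alpha> j b * \<alpha> i 0)"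
      by (simp add: sum.distrib sum_distrib_left[symmetric])
    also have "(\<Sum>b\<le>r. \<Sum>i=1..r. \<Sum>j=1..r. \<mu> i j * \<alpha> j b * \<alpha> i 0) =
      (\<Sum>i=1..r. \<Sum>j=1..r. \<Sum>b\<le>r. \<mu> i j * \<alpha> j b * \<alpha> i 0)"
      by (rule sum_swap3)
    also have "\<dots> = (\<Sum>i=1..r. \<Sum>j=1..r. \<mu> i j * \<alpha> i 0 * (\<Sum>b\<le>r. \<alpha> j b))"
      by (simp add: sum_distrib_left mult_ac)
    also have "\<dots> = 0" by (intro sum.neutral ballI) (simp add: \<alpha>_sum)
    finally show ?thesis by simp
  qed
  \<comment> \<open>Independence is used twice: here in the row index \<open>a\<close>, afterwards
    in the column index \<open>b\<close>.\<close>
  have row: "(\<Sum>j=1..r. \<mu> i j * \<alpha> j b) = 0" if "1 \<le> i" "i \<le> r" "b \<le> r" for i b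
    by (rule \<alpha>_independent[of r "\<lambda>i. \<Sum>j=1..r. \<mu> i j * \<alpha> j b", OF _ that(1,2)])
      (use eval[of _ b] that c0 in \<open>simp add: sum_distrib_right\<close>)
  have "m i j = 0" if "1 \<le> i" "i \<le> r" "1 \<le> j" "j \<le> r" for i j
    using \<alpha>_independent[of r "\<mu> i" j] row that by (simp add: \<mu>_def path_sign_def)
  then have x': "x = sc z * Z 1 + y" unfolding xe c0 by simp
  show ?thesis
  proof (cases "r = 2")
    case False
    then show ?thesis using x' y by simp
  next
    \<comment> \<open>Right multiplication by \<open>Z 1\<close> isolates \<open>z\<close>: the
      square of \<open>Z 1\<close> is 6 times \<open>Z 1\<close>, while \<open>J 2\<close>
      annihilates \<open>Z 1\<close>, because \<open>A 2\<close> acts on it by scalars and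
      \<open>e 2 * Z 1 = 0\<close>.\<close>
    case True
    have N: "2 < N" "Suc 1 < N" using r True by auto
    have X1Z: "X 1 * Z 1 = sc 2 * Z 1"
      using X_square[of 1] N by (simp add: Z_def sc_two right_diff_distrib mult.assoc[symmetric] distrib_right)
    have X2Z: "X 2 * Z 1 = sc 2 * Z 1"
      using X_square[of 2] Z_alt[of 1] N by (simp add: sc_two right_diff_distrib mult.assoc[symmetric] distrib_right numeral_2_eq_2)
    have lc: "x * (sc c * y) = sc c * (x * y)" for x y c by (metis mult.assoc sc_comm)
    have ZZ: "Z 1 * Z 1 = sc 6 * Z 1"
    proof -
      have "Z 1 * Z 1 = X 1 * (X 2 * (X 1 * Z 1)) - X 1 * Z 1"
        unfolding Z_def[of 1] by (simp add: left_diff_distrib mult.assoc numeral_2_eq_2)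
      also have "\<dots> = sc (2 * 2 * 2) * Z 1 - sc 2 * Z 1"
        by (simp only: X1Z X2Z lc[of "X 1"] lc[of "X 2"] sc_mult mult.assoc)
      also have "\<dots> = sc 6 * Z 1"
        using sc_add[of 6 2] by (simp add: algebra_simps)
      finally show ?thesis .
    qed
    have eX: "e i * X i = 0" if "1 \<le> i" "i < N" for i using es[OF that] by (simp add: X_def right_diff_distrib)
    have e1Z: "e 1 * Z 1 = 0"
      using eX[of 1] N by (simp add: Z_def right_diff_distrib mult.assoc[symmetric])
    have e2Z: "e 2 * Z 1 = 0"
      using eX[of 2] Z_alt[of 1] N by (simp add: right_diff_distrib mult.assoc[symmetric] numeral_2_eq_2)
    have s1Z: "s 1 * Z 1 = sc (- 1) * Z 1"
    proof -
      have "s 1 * Z 1 = Z 1 - X 1 * Z 1" by (simp add: X_def left_diff_distrib)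
      then show ?thesis unfolding X1Z by (simp add: sc_two sc_minus sc_one)
    qed
    have AZ: "\<exists>c. a * Z 1 = sc c * Z 1" if "a \<in> A 2" for a
      using that
    proof (induction rule: A.induct)
      case (A_add x y)
      then show ?case by (metis distrib_right sc_add)
    next
      case (A_s i x)
      then obtain c where c: "x * Z 1 = sc c * Z 1" by blast
      have "i = 1" using A_s by simp
      have "s 1 * x * Z 1 = s 1 * (sc c * Z 1)" by (simp only: mult.assoc c)
      also have "\<dots> = sc c * (s 1 * Z 1)" by (rule lc)
      also have "\<dots> = sc (c * (- 1)) * Z 1" by (simp only: s1Z sc_mult mult.assoc)
      finally show ?case using \<open>i = 1\<close> by blast
    next
      case (A_e i x)
      then obtain c where c: "x * Z 1 = sc c * Z 1" by blast
      have "i = 1" using A_e by simp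
      have "e 1 * x * Z 1 = e 1 * (sc c * Z 1)" by (simp only: mult.assoc c)
      also have "\<dots> = sc c * (e 1 * Z 1)" by (rule lc)
      also have "\<dots> = sc 0 * Z 1" by (simp only: e1Z) simp
      finally show ?case using \<open>i = 1\<close> by blast
    qed blast
    have "y * Z 1 = 0" if "y \<in> J 2" for y
      using that
    proof (induction rule: J.induct)
      case (J_e x y)
      obtain c where "y * Z 1 = sc c * Z 1" using AZ[OF J_e(2)] by blast
      moreover have "e 2 * (sc c * Z 1) = sc c * (e 2 * Z 1)" by (rule lc)
      ultimately show ?case by (simp only: mult.assoc e2Z mult_zero_right)
    qed (simp add: distrib_right)
    then have "x * Z 1 = sc (z * 6) * Z 1"
      using y(1) True by (simp add: x' distrib_right mult.assoc ZZ[unfolded One_nat_def] sc_mult)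
    then have nZ: "null (sc (z * 6) * Z 1)" using null_mult(2)[OF x(2), of "Z 1"] by simp
    define rest :: "3 list" where "rest = replicate (N - 3) 1"
    \<comment> \<open>With three distinct labels in front, the identity is the only permutation in
      \<open>Z 1\<close> that returns this word, so the coefficient computed below is 1.\<close>
    define t where "t = unit_tensor (1 # 2 # 3 # rest)"
    have t: "t \<in> W" unfolding t_def rest_def by (rule unit_tensor_W) (use N in simp)
    have Z_s: "Z 1 = 1 - s 1 - s 2 + s 1 * s 2 + s 2 * s 1 - s 1 * s 2 * s 1"
      using ss[of 1] N by (simp add: Z_def X_def algebra_simps numeral_2_eq_2)
    have sw: "swap_factors 0 f (x # y # w) = f (y # x # w)" "swap_factors (Suc 0) f (x # y # z # w) = f (x # z # y # w)"
      for f x y z w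
      using swap_factors_at[of "[]" 0 f x y w] swap_factors_at[of "[x]" 1 f y z w] by simp_all
    have "\<rho> (Z 1) t (1 # 2 # 3 # rest) = 1"
      unfolding Z_s using t N
      by (simp add: \<rho>_add \<rho>_diff \<rho>_1 \<rho>_mult \<rho>_W \<rho>_s swap_factors_W sw) (simp add: t_def unit_tensor_def)
    moreover have "\<rho> (sc (z * 6) * Z 1) t = tensor_scale (z * 6) (\<rho> (Z 1) t)"
      using t by (simp add: \<rho>_mult \<rho>_sc \<rho>_W)
    moreover have "\<rho> (sc (z * 6) * Z 1) t = 0" using nZ t by (simp add: null_def)
    ultimately have "z * 6 = 0" by (metis tscale mult_1_right zero_fun_apply)
    then show ?thesis using x' y by simp
  qed
qed

lemma null_sc:
  assumes "null (sc c)"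
  shows "c = 0"
proof -
  let ?w = "replicate N 1 :: 3 list"
  have "\<rho> (sc c) (unit_tensor ?w) ?w = c"
    by (simp add: \<rho>_sc unit_tensor_W tscale) (simp add: unit_tensor_def)
  moreover have "\<rho> (sc c) (unit_tensor ?w) = 0" using assms by (simp add: null_def unit_tensor_W)
  ultimately show ?thesis by simp
qed

theorem faithful: "\<lbrakk>n \<le> N; x \<in> A n; null x\<rbrakk> \<Longrightarrow> x = 0"
proof (induction n arbitrary: x)
  case (Suc r)
  show ?case
  proof (cases "r = 0")
    case True
    then obtain c where "x = sc c" using A_zero[of x] Suc.prems by auto
    then show ?thesis using null_sc[of c] Suc.prems by simp
  next
    case False
    then have r: "1 \<le> r" "r < N" using Suc.prems by auto
    have "x \<in> J r" using A_null_J[OF r(2,1)] Suc.prems by blast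
    then show ?thesis using J_faithful[OF r] Suc.IH Suc.prems r by auto
  qed
next
  case 0
  then obtain c where "x = sc c" using A_zero[of x] A_mono[of x 0 "Suc 0"] by auto
  then show ?case using null_sc[of c] 0 by simp
qed

end

section \<open>\<open>\<Phi>\<close> acts by zero\<close>

text \<open>An array antisymmetric in both pairs of indices is, in dimension three, determined by its
  contraction, as for the Riemann and Ricci tensors.\<close>

lemma antisym_decomposition:
  fixes g :: "3 \<Rightarrow> 3 \<Rightarrow> 3 \<Rightarrow> 3 \<Rightarrow> complex"
  assumes "\<And>a b c d. g b a c d = - g a b c d" "\<And>a b c d. g a b d c = - g a b c d"
  defines "h \<equiv> \<lambda>a d. \<Sum>p\<in>UNIV. g a p p d"
  defines "\<delta> \<equiv> \<lambda>a b :: 3. if a = b then 1 else 0"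
  shows "g a b c d = \<delta> b c * h a d - \<delta> a c * h b d - \<delta> b d * h a c + \<delta> a d * h b c -
    (\<Sum>q\<in>UNIV. h q q) / 2 * (\<delta> b c * \<delta> a d - \<delta> a c * \<delta> b d)"
proof -
  have z: "g a a c d = 0" "g a b c c = 0" for a b c d
    using assms(1)[of a a c d] assms(2)[of a b c c] by simp_all
  have r: "g 2 1 c d = - g 1 2 c d" "g 3 1 c d = - g 1 3 c d" "g 3 2 c d = - g 2 3 c d"
    "g a b 2 1 = - g a b 1 2" "g a b 3 1 = - g a b 1 3" "g a b 3 2 = - g a b 2 3" for a b c d
    using assms(1,2) by blast+
  show ?thesis
    using exhaust_3[of a] exhaust_3[of b] exhaust_3[of c] exhaust_3[of d]
    by (elim disjE; simp add: h_def \<delta>_def sum_3 z r field_simps)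
qed

definition F_op :: "tensor \<Rightarrow> tensor" where
  "F_op t = (t - swap_factors 2 t) - swap_factors 0 (t - swap_factors 2 t)"

definition e14_op :: "tensor \<Rightarrow> tensor" where
  "e14_op t = swap_factors 0 (swap_factors 2 (std.ct 1 (swap_factors 2 (swap_factors 0 t))))"

lemma at4:
  "swap_factors 0 t (a # b # c # d # v) = t (b # a # c # d # v)"
  "swap_factors 2 t (a # b # c # d # v) = t (a # b # d # c # v)"
  "std.ct (Suc 0) t (a # b # c # d # v) = (if b = c then \<Sum>p\<in>UNIV. t (a # p # p # d # v) else 0)"
  using swap_factors_at[of "[]" 0 t a b "c # d # v"] swap_factors_at[of "[a, b]" 2 t c d v]
    std_ct_at[of "[a]" 1 t b c "d # v"] by simp_all

text \<open>\<open>F_op t\<close> is antisymmetric in both pairs of indices. Contracting it gives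
  \<open>h\<close>, and contracting after \<open>e14_op\<close> gives the double trace \<kappa>. A
  second \<open>F_op\<close> turns these into the four terms in \<open>h\<close> and twice the term
  in \<kappa>, so the factor 1/4 produces the \<kappa>/2 of
  \<open>antisym_decomposition\<close>.\<close>

lemma Phi_op:
  assumes "4 \<le> n" "t \<in> tensor_power n"
  shows "F_op (std.ct 1 (F_op t)) - F_op t - tensor_scale (1/4) (F_op (std.ct 1 (e14_op (F_op t)))) = 0"
    (is "?L = 0")
proof -
  have F_W: "F_op f \<in> tensor_power n" if "f \<in> tensor_power n" for f
    using that swap_factors_W[OF that] by (auto intro!: tensor_powerI simp: F_op_def tensor_powerD swap_factors_def)
  define f where "f = F_op t"
  have fW: "f \<in> tensor_power n" unfolding f_def by (rule F_W[OF assms(2)])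
  have F_at: "F_op f (a # b # c # d # v) = f (a # b # c # d # v) - f (a # b # d # c # v)
      - f (b # a # c # d # v) + f (b # a # d # c # v)" for f a b c d v
    by (simp add: F_op_def at4)
  have "?L (a # b # c # d # v) = 0" for a b c d v
  proof -
    define g where "g a b c d = f (a # b # c # d # v)" for a b c d
    define h where "h a d = (\<Sum>p\<in>UNIV. g a p p d)" for a d
    define \<kappa> where "\<kappa> = (\<Sum>q\<in>UNIV. h q q)"
    have "g b a c d = - g a b c d" "g a b d c = - g a b c d" for a b c d
      by (simp_all add: g_def f_def F_at)
    note dec = antisym_decomposition[where g = g, OF this, folded h_def, folded \<kappa>_def]
    have ct: "std.ct 1 f (a # b # c # d # v) = (if b = c then h a d else 0)" for a b c d
      by (simp add: at4 h_def g_def)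
    have cte: "std.ct 1 (e14_op f) (a # b # c # d # v) = (if b = c \<and> a = d then \<kappa> else 0)" for a b c d
      by (auto simp: e14_op_def at4 \<kappa>_def h_def g_def intro: sum.swap)
    have "?L (a # b # c # d # v) = F_op (std.ct 1 f) (a # b # c # d # v) - g a b c d -
        1 / 4 * F_op (std.ct 1 (e14_op f)) (a # b # c # d # v)"
      by (simp add: f_def[symmetric] tensor_scale_def g_def)
    also have "\<dots> = 0"
      unfolding F_at ct cte dec[of a b c d]
      by (cases "a = c"; cases "a = d"; cases "b = c"; cases "b = d"; simp)
    finally show ?thesis .
  qed
  moreover have "\<exists>a b c d v. w = a # b # c # d # v" if "4 \<le> length w" for w :: "3 list"
    using that by (auto simp: Suc_le_length_iff numeral_eq_Suc)
  ultimately have L0: "?L w = 0" if "4 \<le> length w" for w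
    using that by blast
  have LW: "?L w = 0" if "length w \<noteq> n" for w
    using that tensor_powerD[OF F_W] fW contract_factors_W swap_factors_W assms
    by (simp add: F_op_def e14_op_def tensor_scale_def swap_factors_def contract_factors_def tensor_powerD)
  show ?thesis
  proof
    fix w show "?L w = 0 w" using L0[of w] LW[of w] assms by (cases "length w = n") auto
  qed
qed

section \<open>Reduction to the standard form\<close>

primrec on_all :: "(complex^3 \<Rightarrow> complex^3) \<Rightarrow> nat \<Rightarrow> tensor \<Rightarrow> tensor" where
  "on_all g 0 t = t"
| "on_all g (Suc n) t = on_factor n g (on_all g n t)"

lemma on_all_W: "t \<in> tensor_power r \<Longrightarrow> on_all g n t \<in> tensor_power r"
  by (induction n) (auto intro: on_factor_W)

lemma on_all_linear:
  "on_all g n (t + u) = on_all g n t + on_all g n u"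
  "on_all g n (tensor_scale c t) = tensor_scale c (on_all g n t)"
  by (induction n) (simp_all add: on_factor_linear del: plus_fun_apply)

text \<open>For operators concerning only the factors \<open>k\<close> and \<open>k + 1\<close>: the
  lower factors commute with \<open>op\<close>, the two factors together convert \<open>op\<close>
  into \<open>op'\<close>, and the higher factors commute with \<open>op'\<close>.\<close>

lemma on_all_intertwine:
  assumes far: "\<And>m f. m \<noteq> k \<Longrightarrow> m \<noteq> Suc k \<Longrightarrow> on_factor m g (op f) = op (on_factor m g f)"
    "\<And>m f. m \<noteq> k \<Longrightarrow> m \<noteq> Suc k \<Longrightarrow> on_factor m g (op' f) = op' (on_factor m g f)"
    and near: "\<And>f. f \<in> tensor_power r \<Longrightarrow>
      on_factor (Suc k) g (on_factor k g (op f)) = op' (on_factor (Suc k) g (on_factor k g f))"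
    and t: "t \<in> tensor_power r" and n: "k + 2 \<le> n"
  shows "on_all g n (op t) = op' (on_all g n t)"
proof -
  have low: "on_all g n (op t) = op (on_all g n t)" if "n \<le> k" for n
    using that by (induction n) (auto simp: far)
  show ?thesis
    using n
  proof (induction n rule: dec_induct)
    case base
    show ?case using near[OF on_all_W[OF t]] by (simp add: low)
  next
    case (step n)
    then show ?case by (simp add: far)
  qed
qed

lemma on_factor_Suc_at: "length u = k \<Longrightarrow> on_factor (Suc k) f t (u @ x # y # v) =
    (\<Sum>a\<in>UNIV. f (axis a 1) $ y * t (u @ x # a # v))"
  using on_factor_at[of "u @ [x]" "Suc k" f t y v] by simp

lemma on_all_swap:
  assumes "k + 1 < r" "t \<in> tensor_power r"
  shows "on_all g r (swap_factors k t) = swap_factors k (on_all g r t)"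
proof (rule on_all_intertwine[OF _ _ _ assms(2)])
  fix f :: tensor assume f: "f \<in> tensor_power r"
  show "on_factor (Suc k) g (on_factor k g (swap_factors k f)) = swap_factors k (on_factor (Suc k) g (on_factor k g f))"
  proof (rule tensor_power_eqI2[OF assms(1)])
    fix u :: "3 list" and x y v assume u: "length u = k"
    have "(\<Sum>a\<in>UNIV. g (axis a 1) $ y * (\<Sum>b\<in>UNIV. g (axis b 1) $ x * f (u @ a # b # v))) =
      (\<Sum>b\<in>UNIV. g (axis b 1) $ x * (\<Sum>a\<in>UNIV. g (axis a 1) $ y * f (u @ a # b # v)))"
      unfolding sum_distrib_left by (subst sum.swap) (simp add: mult_ac)
    then show "on_factor (Suc k) g (on_factor k g (swap_factors k f)) (u @ x # y # v) =
        swap_factors k (on_factor (Suc k) g (on_factor k g f)) (u @ x # y # v)"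
      using u by (simp add: on_factor_Suc_at on_factor_at swap_factors_at)
  qed (use f in \<open>auto intro!: on_factor_W swap_factors_W\<close>)
qed (use assms in \<open>auto simp: on_factor_far\<close>)

section \<open>Orthonormal bases and isometries\<close>

context form
begin

text \<open>The locale has dual bases instead of this property; it follows because \<open>N\<close>
  inverts the Gram matrix \<open>M\<close>.\<close>

lemma nondegenerate: "(\<And>w. \<beta> v w = 0) \<Longrightarrow> v = 0"
proof -
  assume *: "\<And>w. \<beta> v w = 0"
  have "v $ z = (\<Sum>c\<in>UNIV. \<beta> v (axis c 1) * N c z)" for z
  proof -
    have "(\<Sum>c\<in>UNIV. \<beta> v (axis c 1) * N c z) = (\<Sum>c\<in>UNIV. (\<Sum>a\<in>UNIV. v $ a * M a c) * N c z)"
      by (subst linear_expand[OF lin(2)]) (simp add: M_def)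
    also have "\<dots> = (\<Sum>a\<in>UNIV. \<Sum>c\<in>UNIV. M a c * (N c z * v $ a))"
      unfolding sum_distrib_right by (subst sum.swap) (simp add: mult_ac)
    also have "\<dots> = v $ z" by (rule MN_sum)
    finally show ?thesis by simp
  qed
  then show "v = 0" using * by (simp add: vec_eq_iff)
qed

lemma \<beta>_linear:
  "\<beta> v (w + w') = \<beta> v w + \<beta> v w'" "\<beta> (w + w') v = \<beta> w v + \<beta> w' v"
  "\<beta> v (c *s w) = c * \<beta> v w" "\<beta> (c *s w) v = c * \<beta> w v"
  "\<beta> v (\<Sum>i\<in>I. f i) = (\<Sum>i\<in>I. \<beta> v (f i))" "\<beta> v (w - w') = \<beta> v w - \<beta> v w'" "\<beta> (w - w') v = \<beta> w v - \<beta> w' v"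
proof -
  interpret l: Vector_Spaces.linear "(*s)" "(*)" "\<beta> v" by (rule lin)
  interpret r: Vector_Spaces.linear "(*s)" "(*)" "\<lambda>w. \<beta> w v" by (rule lin)
  show "\<beta> v (w + w') = \<beta> v w + \<beta> v w'" "\<beta> (w + w') v = \<beta> w v + \<beta> w' v"
    "\<beta> v (c *s w) = c * \<beta> v w" "\<beta> (c *s w) v = c * \<beta> w v"
    "\<beta> v (\<Sum>i\<in>I. f i) = (\<Sum>i\<in>I. \<beta> v (f i))" "\<beta> v (w - w') = \<beta> v w - \<beta> v w'" "\<beta> (w - w') v = \<beta> w v - \<beta> w' v"
    by (simp_all add: l.add r.add l.scale r.scale l.sum l.diff r.diff)
qed

text \<open>Gram-Schmidt for a complex bilinear form, where the residue \<open>P v\<close> could be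
  isotropic. If it were so for all \<open>v\<close>, polarization would make the form vanish on the
  image of \<open>P\<close>, nondegeneracy would give \<open>P = 0\<close>, and fewer than three
  vectors would span. A complex square root normalizes the residue.\<close>

lemma orthonormal_system:
  "k \<le> 3 \<Longrightarrow> \<exists>f :: nat \<Rightarrow> complex^3. \<forall>i<k. \<forall>j<k. \<beta> (f i) (f j) = (if i = j then 1 else 0)"
proof (induction k)
  case (Suc k)
  then obtain f :: "nat \<Rightarrow> complex^3" where f: "\<And>i j. i < k \<Longrightarrow> j < k \<Longrightarrow> \<beta> (f i) (f j) = (if i = j then 1 else 0)"
    by auto
  define P where "P v = v - (\<Sum>i<k. \<beta> v (f i) *s f i)" for v
  have Pf: "\<beta> (f j) (P v) = 0" if "j < k" for j v
    using f[OF that] that by (simp add: P_def \<beta>_linear sym[of v] if_distrib[where f = "\<lambda>x. _ * x"] cong: if_cong)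
  have PP: "\<beta> (P v) w = \<beta> (P v) (P w)" for v w
    using Pf by (simp add: P_def[of w] \<beta>_linear sym[of "P v"])
  have "\<exists>v. \<beta> (P v) (P v) \<noteq> 0"
  proof (rule ccontr)
    assume "\<nexists>v. \<beta> (P v) (P v) \<noteq> 0"
    then have 0: "\<beta> (P v) (P v) = 0" for v by auto
    have Padd: "P (v + w) = P v + P w" for v w
      by (simp add: P_def \<beta>_linear vec.scale_left_distrib sum.distrib)
    have "\<beta> (P v) (P w) = 0" for v w
      using 0[of "v + w"] 0[of v] 0[of w] sym[of "P v" "P w"] by (simp add: Padd \<beta>_linear)
    then have "P v = 0" for v using nondegenerate[of "P v"] PP by simp
    then have "v = (\<Sum>i<k. \<beta> v (f i) *s f i)" for v by (simp add: P_def)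
    then have "v \<in> vec.span (f ` {..<k})" for v
      by (metis (no_types, lifting) vec.span_sum vec.span_scale vec.span_base imageI)
    then have "vec.dim (UNIV :: (complex^3) set) \<le> card (f ` {..<k})"
      by (intro vec.dim_le_card) auto
    also have "\<dots> \<le> k" using card_image_le[of "{..<k}" f] by simp
    finally show False using Suc.prems by (simp add: vec.dim_UNIV card_cart_basis)
  qed
  then obtain v where v: "\<beta> (P v) (P v) \<noteq> 0" by blast
  define w where "w = (1 / csqrt (\<beta> (P v) (P v))) *s P v"
  have "\<beta> w w = 1"
  proof -
    have "csqrt (\<beta> (P v) (P v)) * csqrt (\<beta> (P v) (P v)) = \<beta> (P v) (P v)"
      using power2_csqrt[of "\<beta> (P v) (P v)"] by (simp add: power2_eq_square)
    then show ?thesis using v by (simp add: w_def \<beta>_linear)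
  qed
  moreover have "\<beta> (f j) w = 0" "\<beta> w (f j) = 0" if "j < k" for j
    using Pf[OF that] sym by (simp_all add: w_def \<beta>_linear)
  ultimately show ?case using f
    by (intro exI[of _ "f(k := w)"]) (auto simp: less_Suc_eq)
qed simp

lemma orthonormal_basis: "\<exists>G :: 3 \<Rightarrow> complex^3. \<forall>i j. \<beta> (G i) (G j) = (if i = j then 1 else 0)"
proof -
  obtain f :: "nat \<Rightarrow> complex^3" where f: "\<And>i j. i < 3 \<Longrightarrow> j < 3 \<Longrightarrow> \<beta> (f i) (f j) = (if i = j then 1 else 0)"
    using orthonormal_system[of 3] by auto
  define n :: "3 \<Rightarrow> nat" where "n i = (if i = 1 then 0 else if i = 2 then 1 else 2)" for i
  have "n i < 3" "n i = n j \<longleftrightarrow> i = j" for i j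
    using exhaust_3[of i] exhaust_3[of j] by (auto simp: n_def)
  then show ?thesis using f by (intro exI[of _ "\<lambda>i. f (n i)"]) auto
qed

text \<open>With the basis vectors as rows of \<open>G\<close>, orthonormality says that
  \<open>G\<close> times \<open>M\<close> times the transpose of \<open>G\<close> is 1. Hence the
  transpose of \<open>G\<close> times \<open>G\<close> inverts \<open>M\<close>, as \<open>N\<close>
  does.\<close>

lemma orthonormal_N:
  fixes G :: "3 \<Rightarrow> complex^3"
  assumes G: "\<And>i j. \<beta> (G i) (G j) = (if i = j then 1 else 0)"
  shows "(\<Sum>c\<in>UNIV. G c $ x * G c $ y) = N x y"
proof -
  let ?G = "(\<chi> i a. G i $ a) :: complex^3^3" and ?M = "(\<chi> a c. M a c) :: complex^3^3" and ?N = "(\<chi> x y. N y x) :: complex^3^3"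
  have "((?G ** ?M) ** transpose ?G) $ j $ k = \<beta> (G j) (G k)" for j k
    by (simp add: matrix_matrix_mult_def form_expand sum_distrib_right transpose_def) (rule sum.swap)
  then have "(?G ** ?M) ** transpose ?G = mat 1" using G by (simp add: vec_eq_iff mat_def)
  then have "transpose ?G ** (?G ** ?M) = mat 1" by (simp add: matrix_left_right_inverse)
  then have "transpose ?G ** ?G ** (?M ** ?N) = ?N" by (simp add: matrix_mul_assoc)
  then have "transpose ?G ** ?G = ?N" by (simp add: MN_matrices)
  then have "(transpose ?G ** ?G) $ x $ y = N y x" by simp
  then show ?thesis using N_sym[of x y] by (simp add: matrix_matrix_mult_def transpose_def)
qed

text \<open>On the standard basis \<open>g\<close> is an isometry from \<open>dot\<close> to
  \<beta>. The evaluation half of the contraction is matched through \<open>S\<close>, the inserted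
  tensor through \<open>orthonormal_N\<close>.\<close>

lemma on_all_ct:
  assumes G: "\<And>i j. \<beta> (G i) (G j) = (if i = j then 1 else 0)" and g: "\<And>i. g (axis i 1) = G i"
    and k: "k + 1 < r" "t \<in> tensor_power r"
  shows "on_all g r (std.ct k t) = ct k (on_all g r t)"
proof (rule on_all_intertwine[OF _ _ _ k(2)])
  fix f :: tensor assume f: "f \<in> tensor_power r"
  show "on_factor (Suc k) g (on_factor k g (std.ct k f)) = ct k (on_factor (Suc k) g (on_factor k g f))"
  proof (rule tensor_power_eqI2[OF k(1)])
    fix u :: "3 list" and x y v assume u: "length u = k"
    have "S (on_factor (Suc k) g (on_factor k g f)) u v =
      (\<Sum>a\<in>UNIV. \<Sum>c\<in>UNIV. M a c * (\<Sum>q\<in>UNIV. G q $ c * (\<Sum>p\<in>UNIV. G p $ a * f (u @ p # q # v))))"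
      using u by (simp add: S_def on_factor_Suc_at on_factor_at g)
    also have "\<dots> = (\<Sum>a\<in>UNIV. \<Sum>c\<in>UNIV. \<Sum>q\<in>UNIV. \<Sum>p\<in>UNIV. (G p $ a * M a c * G q $ c) * f (u @ p # q # v))"
      by (simp add: sum_distrib_left mult_ac)
    also have "\<dots> = (\<Sum>q\<in>UNIV. \<Sum>p\<in>UNIV. \<Sum>a\<in>UNIV. \<Sum>c\<in>UNIV. (G p $ a * M a c * G q $ c) * f (u @ p # q # v))"
      by (rule sum_swap4)
    also have "\<dots> = (\<Sum>q\<in>UNIV. \<Sum>p\<in>UNIV. \<beta> (G p) (G q) * f (u @ p # q # v))"
      by (simp add: form_expand sum_distrib_right)
    also have "\<dots> = (\<Sum>q\<in>UNIV. f (u @ q # q # v))"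
      by (simp add: G if_distrib[where f = "\<lambda>x. x * _"] cong: if_cong)
    finally have S: "S (on_factor (Suc k) g (on_factor k g f)) u v = (\<Sum>q\<in>UNIV. f (u @ q # q # v))" .
    have "on_factor (Suc k) g (on_factor k g (std.ct k f)) (u @ x # y # v) =
      (\<Sum>q\<in>UNIV. G q $ y * (\<Sum>p\<in>UNIV. G p $ x * (if p = q then \<Sum>a\<in>UNIV. f (u @ a # a # v) else 0)))"
      using u by (simp add: on_factor_Suc_at on_factor_at g std_ct_at)
    also have "\<dots> = (\<Sum>q\<in>UNIV. G q $ x * G q $ y) * (\<Sum>a\<in>UNIV. f (u @ a # a # v))"
    proof -
      have "(\<Sum>q\<in>UNIV. G q $ y * (\<Sum>p\<in>UNIV. G p $ x * (if p = q then c else 0))) = (\<Sum>q\<in>UNIV. G q $ x * G q $ y) * c" for c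
        by (simp add: sum_distrib_right sum_distrib_left mult_ac if_distrib[where f = "\<lambda>x. _ * x"] cong: if_cong)
      then show ?thesis .
    qed
    finally show "on_factor (Suc k) g (on_factor k g (std.ct k f)) (u @ x # y # v) =
      ct k (on_factor (Suc k) g (on_factor k g f)) (u @ x # y # v)"
      using u by (simp add: ct_at S orthonormal_N[OF G])
  qed (use f in \<open>auto intro!: on_factor_W contract_factors_W\<close>)
qed (use k in \<open>auto simp: on_factor_far\<close>)

end

text \<open>The order is opposite to that of \<open>on_all\<close>, so that inverse operators cancel
  from the inside out and no factors have to be commuted.\<close>

primrec on_all_rev :: "(complex^3 \<Rightarrow> complex^3) \<Rightarrow> nat \<Rightarrow> tensor \<Rightarrow> tensor" where
  "on_all_rev g 0 t = t"
| "on_all_rev g (Suc n) t = on_all_rev g n (on_factor n g t)"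

lemma on_all_rev_W: "t \<in> tensor_power r \<Longrightarrow> on_all_rev g n t \<in> tensor_power r"
  by (induction n arbitrary: t) (auto intro: on_factor_W)

lemma on_factor_inverse:
  assumes inv: "\<And>x y. (\<Sum>c\<in>UNIV. g' (axis c 1) $ x * g (axis y 1) $ c) = (if x = y then 1 else 0)"
    and t: "t \<in> tensor_power r" "n < r"
  shows "on_factor n g' (on_factor n g t) = t"
proof (rule tensor_power_eqI[of _ r])
  fix w :: "3 list" assume "length w = r"
  then obtain u x v where w: "w = u @ x # v" "length u = n" using split1[of n w] t by auto
  have "on_factor n g' (on_factor n g t) w =
    (\<Sum>c\<in>UNIV. \<Sum>y\<in>UNIV. (g' (axis c 1) $ x * g (axis y 1) $ c) * t (u @ y # v))"
    using w by (simp add: on_factor_at sum_distrib_left mult.assoc)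
  also have "\<dots> = (\<Sum>y\<in>UNIV. (\<Sum>c\<in>UNIV. g' (axis c 1) $ x * g (axis y 1) $ c) * t (u @ y # v))"
    unfolding sum_distrib_right by (rule sum.swap)
  also have "\<dots> = t w" by (simp add: inv w if_distrib[where f = "\<lambda>x. x * _"] cong: if_cong)
  finally show "on_factor n g' (on_factor n g t) w = t w" .
qed (use t in \<open>auto intro!: on_factor_W\<close>)

lemma on_all_inverse:
  assumes inv: "\<And>x y. (\<Sum>c\<in>UNIV. g' (axis c 1) $ x * g (axis y 1) $ c) = (if x = y then 1 else 0)"
    and t: "t \<in> tensor_power r" "n \<le> r"
  shows "on_all_rev g' n (on_all g n t) = t" "on_all g' n (on_all_rev g n t) = t"
proof -
  show "on_all_rev g' n (on_all g n t) = t"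
    using t(2) by (induction n) (simp_all add: on_factor_inverse[OF inv on_all_W[OF t(1)]])
  show "on_all g' n (on_all_rev g n t) = t"
    using t by (induction n arbitrary: t) (simp_all add: on_factor_W on_factor_inverse[OF inv])
qed

context form
begin

text \<open>The tensor power of an isometry from \<open>dot\<close> to \<beta> is invertible and
  intertwines the two representations, so the same polynomials act by zero.\<close>

lemma kernel_standard:
  assumes p: "p \<in> carrier (free_algebra (brauer_gens r))"
  shows "(\<forall>t\<in>tensor_power r. free_eval tensor_scale (tensor_power r) (eta_gen \<beta> b b') p t = 0) \<longleftrightarrow>
    (\<forall>t\<in>tensor_power r. free_eval tensor_scale (tensor_power r) (eta_gen dot ax ax) p t = 0)"
proof -
  interpret R: free_rep tensor_scale "tensor_power r" "brauer_gens r" "eta_gen \<beta> b b'"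
    by (rule free_rep_eta)
  interpret R0: free_rep tensor_scale "tensor_power r" "brauer_gens r" "eta_gen dot ax ax"
    by (rule std.free_rep_eta)
  obtain G :: "3 \<Rightarrow> complex^3" where G: "\<And>i j. \<beta> (G i) (G j) = (if i = j then 1 else 0)"
    using orthonormal_basis by blast
  define g where "g v = (\<Sum>i\<in>UNIV. v $ i *s G i)" for v :: "complex^3"
  have g: "g (axis i 1) = G i" for i
    by (simp add: g_def vec_eq_iff axis_def if_distrib[where f = "\<lambda>x. x * _"] cong: if_cong)
  \<comment> \<open>The coordinates with respect to the orthonormal basis \<open>G\<close>, hence
    the inverse of \<open>g\<close>.\<close>
  define g' where "g' v = (\<chi> x. \<beta> (G x) v)" for v
  have inv1: "(\<Sum>c\<in>UNIV. g' (axis c 1) $ x * g (axis y 1) $ c) = (if x = y then 1 else 0)" for x y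
    using linear_expand[OF lin(1), of "G x" "G y"] by (simp add: g g'_def G mult.commute)
  have inv2: "(\<Sum>c\<in>UNIV. g (axis c 1) $ x * g' (axis y 1) $ c) = (if x = y then 1 else 0)" for x y
  proof -
    have "(\<Sum>c\<in>UNIV. g (axis c 1) $ x * g' (axis y 1) $ c) = (\<Sum>c\<in>UNIV. \<Sum>a\<in>UNIV. (G c $ x * G c $ a) * M a y)"
    proof -
      have "\<beta> (G c) (axis y 1) = (\<Sum>a\<in>UNIV. G c $ a * M a y)" for c
        by (subst linear_expand[OF lin(2)]) (simp add: M_def)
      then show ?thesis by (simp add: g g'_def sum_distrib_left mult.assoc)
    qed
    also have "\<dots> = (\<Sum>a\<in>UNIV. (\<Sum>c\<in>UNIV. G c $ x * G c $ a) * M a y)"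
      unfolding sum_distrib_right by (rule sum.swap)
    finally show ?thesis by (simp add: orthonormal_N[OF G] NM)
  qed
  let ?T = "on_all g r" and ?I = "on_all_rev g' r"
  have gen: "?T (eta_gen dot ax ax c t) = eta_gen \<beta> b b' c (?T t)"
    if "c \<in> brauer_gens r" "t \<in> tensor_power r" for c t
    using that on_all_swap[of _ r t g] on_all_ct[OF G g, of _ r t] by (auto simp: brauer_gens_def)
  have word: "?T (foldr (eta_gen dot ax ax) gs t) = foldr (eta_gen \<beta> b b') gs (?T t)"
    if "set gs \<subseteq> brauer_gens r" "t \<in> tensor_power r" for gs t
    using that by (induction gs) (auto simp: gen R0.word(1))
  have T0: "?T 0 = 0"
    using on_all_linear(1)[of g r 0 0] by (simp del: plus_fun_apply)
  have Tsum: "?T (\<Sum>i\<in>I. f i) = (\<Sum>i\<in>I. ?T (f i))" for I :: "brauer_gen fword set" and f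
    by (induction I rule: infinite_finite_induct) (simp_all only: sum.infinite sum.empty sum.insert T0 on_all_linear not_False_eq_True)
  have ev: "R.ev p (?T t) = ?T (R0.ev p t)" if t: "t \<in> tensor_power r" for t
  proof -
    have "set (letters w) \<subseteq> brauer_gens r" if "w \<in> Poly_Mapping.keys p" for w
      using p that by (simp add: free_algebra_def)
    then show ?thesis
      using t by (simp add: free_eval_def on_all_W Tsum on_all_linear word cong: sum.cong)
  qed
  show ?thesis
  proof (intro iffI ballI)
    fix t assume *: "\<forall>t\<in>tensor_power r. R.ev p t = 0" and t: "t \<in> tensor_power r"
    have "?T (R0.ev p t) = 0" using * ev[OF t] on_all_W[OF t] by auto
    then have "?I (?T (R0.ev p t)) = ?I (?T 0)" by (simp only: T0)
    then show "R0.ev p t = 0"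
      using on_all_inverse(1)[OF inv1, of _ r r] R0.ev_W[OF p t] R0.W_closed(1) by simp
  next
    fix t assume *: "\<forall>t\<in>tensor_power r. R0.ev p t = 0" and t: "t \<in> tensor_power r"
    have "t = ?T (?I t)" using on_all_inverse(2)[OF inv2 t order_refl] by simp
    then have "R.ev p t = ?T (R0.ev p (?I t))" using ev[OF on_all_rev_W[OF t]] by metis
    then show "R.ev p t = 0" using * on_all_rev_W[OF t] T0 by simp
  qed
qed

end

section \<open>The quotient as a type\<close>

definition FA :: "nat \<Rightarrow> brauer_gen ncpoly set" where "FA N = carrier (free_algebra (brauer_gens N))"

text \<open>Bracketed exactly like the assumption \<open>Phi\<close> of \<open>brauer_quot\<close>,
  which it has to match after transfer.\<close>

definition Phi_poly :: "brauer_gen ncpoly" where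
  "Phi_poly = (1 - sg 1) * (1 - sg 3) * eg 2 * ((1 - sg 1) * (1 - sg 3)) - (1 - sg 1) * (1 - sg 3) -
      const (1/4) * ((1 - sg 1) * (1 - sg 3)) * eg 2 * (sg 1 * sg 3 * eg 2 * sg 3 * sg 1) * ((1 - sg 1) * (1 - sg 3))"

definition quot_ideal :: "nat \<Rightarrow> brauer_gen ncpoly set" where
  "quot_ideal N = {p \<in> FA N. brauer_class N 3 p \<in> genideal (brauer_algebra N 3) {brauer_Phi N}}"

abbreviation std_eval :: "nat \<Rightarrow> brauer_gen ncpoly \<Rightarrow> tensor \<Rightarrow> tensor" where
  "std_eval N \<equiv> free_eval tensor_scale (tensor_power N) (eta_gen dot ax ax)"

lemma FA_closed [simp]:
  "1 \<in> FA N" "0 \<in> FA N" "const c \<in> FA N"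
  "\<lbrakk>1 \<le> i; i < N\<rbrakk> \<Longrightarrow> sg i \<in> FA N" "\<lbrakk>1 \<le> i; i < N\<rbrakk> \<Longrightarrow> eg i \<in> FA N"
  "p \<in> FA N \<Longrightarrow> - p \<in> FA N" "\<lbrakk>p \<in> FA N; q \<in> FA N\<rbrakk> \<Longrightarrow> p + q \<in> FA N"
  "\<lbrakk>p \<in> FA N; q \<in> FA N\<rbrakk> \<Longrightarrow> p * q \<in> FA N" "\<lbrakk>p \<in> FA N; q \<in> FA N\<rbrakk> \<Longrightarrow> p - q \<in> FA N"
  by (simp_all add: FA_def del: One_nat_def)

lemma FA_closed' [simp]: "Suc 0 < N \<Longrightarrow> sg (Suc 0) \<in> FA N" "Suc 0 < N \<Longrightarrow> eg (Suc 0) \<in> FA N"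
  by (simp_all add: FA_def del: One_nat_def)

lemma Phi_poly_FA: "4 \<le> N \<Longrightarrow> Phi_poly \<in> FA N"
  by (simp add: Phi_poly_def)

lemma brauer_Phi_class: "brauer_Phi N = brauer_class N 3 Phi_poly"
  by (simp add: brauer_Phi_def Phi_poly_def Let_def)

lemma brauer_class_hom: "ring_hom_ring (free_algebra (brauer_gens N)) (brauer_algebra N 3) (brauer_class N 3)"
  unfolding brauer_algebra_def brauer_class_def
  by (intro ring_hom_ringI2 ring_free_algebra presented_class_hom brauer_relators_carrier)

lemma brauer_carrier: "carrier (brauer_algebra N 3) = brauer_class N 3 ` FA N"
  by (simp add: FA_def brauer_algebra_def brauer_class_def presented_class_hom(3)[OF brauer_relators_carrier])

lemma brauer_Phi_carrier: "4 \<le> N \<Longrightarrow> brauer_Phi N \<in> carrier (brauer_algebra N 3)"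
  using Phi_poly_FA by (simp add: brauer_Phi_class brauer_carrier)

lemma Phi_ideal: "4 \<le> N \<Longrightarrow> ideal (genideal (brauer_algebra N 3) {brauer_Phi N}) (brauer_algebra N 3)"
proof -
  assume N: "4 \<le> N"
  interpret h: ring_hom_ring "free_algebra (brauer_gens N)" "brauer_algebra N 3" "brauer_class N 3"
    by (rule brauer_class_hom)
  show ?thesis using brauer_Phi_carrier[OF N] by (intro h.S.genideal_ideal) auto
qed

lemma quot_ideal_closed:
  assumes N: "4 \<le> N"
  shows "0 \<in> quot_ideal N"
    and "\<lbrakk>p \<in> quot_ideal N; q \<in> quot_ideal N\<rbrakk> \<Longrightarrow> p + q \<in> quot_ideal N"
    and "\<lbrakk>p \<in> quot_ideal N; q \<in> FA N\<rbrakk> \<Longrightarrow> q * p \<in> quot_ideal N"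
    and "\<lbrakk>p \<in> quot_ideal N; q \<in> FA N\<rbrakk> \<Longrightarrow> p * q \<in> quot_ideal N"
    and "p \<in> brauer_relators N 3 \<Longrightarrow> p \<in> quot_ideal N"
    and "Phi_poly \<in> quot_ideal N"
proof -
  interpret h: ring_hom_ring "free_algebra (brauer_gens N)" "brauer_algebra N 3" "brauer_class N 3"
    by (rule brauer_class_hom)
  interpret I: ideal "genideal (brauer_algebra N 3) {brauer_Phi N}" "brauer_algebra N 3"
    by (rule Phi_ideal[OF N])
  have z: "brauer_class N 3 0 \<in> genideal (brauer_algebra N 3) {brauer_Phi N}"
    using h.hom_zero I.zero_closed by (simp only: free_algebra_simps)
  show "0 \<in> quot_ideal N" using z by (simp add: quot_ideal_def)
  show "\<lbrakk>p \<in> quot_ideal N; q \<in> quot_ideal N\<rbrakk> \<Longrightarrow> p + q \<in> quot_ideal N"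
    using h.hom_add[of p q] I.a_closed by (auto simp: quot_ideal_def FA_def)
  have car: "brauer_class N 3 q \<in> carrier (brauer_algebra N 3)" if "q \<in> FA N" for q
    using that by (simp add: brauer_carrier)
  show "\<lbrakk>p \<in> quot_ideal N; q \<in> FA N\<rbrakk> \<Longrightarrow> q * p \<in> quot_ideal N"
    using h.hom_mult[of q p] I.I_l_closed[OF _ car] by (auto simp: quot_ideal_def FA_def)
  show "\<lbrakk>p \<in> quot_ideal N; q \<in> FA N\<rbrakk> \<Longrightarrow> p * q \<in> quot_ideal N"
    using h.hom_mult[of p q] I.I_r_closed[OF _ car] by (auto simp: quot_ideal_def FA_def)
  show "p \<in> quot_ideal N" if p: "p \<in> brauer_relators N 3"
  proof -
    have "p \<in> FA N" using p brauer_relators_carrier by (auto simp: FA_def)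
    moreover have "brauer_class N 3 p = \<zero>\<^bsub>brauer_algebra N 3\<^esub>"
      unfolding brauer_class_def brauer_algebra_def by (rule presented_class_hom(4)[OF brauer_relators_carrier p])
    ultimately show ?thesis using I.zero_closed by (simp add: quot_ideal_def)
  qed
  show "Phi_poly \<in> quot_ideal N"
    using Phi_poly_FA[OF N] h.S.genideal_self[of "{brauer_Phi N}"] brauer_Phi_carrier[OF N]
    by (auto simp: quot_ideal_def brauer_Phi_class)
qed

lemma quot_ideal_minus:
  assumes "4 \<le> N"
  shows "p \<in> quot_ideal N \<Longrightarrow> - p \<in> quot_ideal N"
    and "\<lbrakk>p \<in> quot_ideal N; q \<in> quot_ideal N\<rbrakk> \<Longrightarrow> p - q \<in> quot_ideal N"
proof -
  show 1: "p \<in> quot_ideal N \<Longrightarrow> - p \<in> quot_ideal N" for p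
    using quot_ideal_closed(3)[OF assms, of p "- 1"] by simp
  show "\<lbrakk>p \<in> quot_ideal N; q \<in> quot_ideal N\<rbrakk> \<Longrightarrow> p - q \<in> quot_ideal N"
    using quot_ideal_closed(2)[OF assms, of p "- q"] 1 by simp
qed

lemma std_eval_zero_iff:
  "std_eval N p = \<zero>\<^bsub>lin_End tensor_scale (tensor_power N)\<^esub> \<longleftrightarrow> (\<forall>t\<in>tensor_power N. std_eval N p t = 0)"
proof -
  have "\<zero>\<^bsub>lin_End tensor_scale (tensor_power N)\<^esub> = (\<lambda>t\<in>tensor_power N. 0)"
    by (simp only: lin_End_def ring_record_simps)
  then show ?thesis by (auto simp: fun_eq_iff free_eval_def)
qed

lemma std_eval_Phi:
  assumes N: "4 \<le> N" and t: "t \<in> tensor_power N"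
  shows "std_eval N Phi_poly t = 0"
proof -
  interpret R: free_rep tensor_scale "tensor_power N" "brauer_gens N" "eta_gen dot ax ax"
    by (rule std.free_rep_eta)
  let ?F = "(1 - sg 1) * (1 - sg 3)"
  have mem: "1 - sg 1 \<in> FA N" "1 - sg 3 \<in> FA N" "sg 1 \<in> FA N" "sg 3 \<in> FA N" "eg 2 \<in> FA N" "?F \<in> FA N"
    using N by simp_all
  have mult: "R.ev (p * q) t = R.ev p (R.ev q t)" "R.ev p t \<in> tensor_power N"
    if "p \<in> FA N" "q \<in> FA N" "t \<in> tensor_power N" for p q t
    using that by (auto simp: FA_def)
  have diff_W: "t - swap_factors 2 t \<in> tensor_power N" if "t \<in> tensor_power N" for t
    using that by (auto intro!: tensor_powerI simp: tensor_powerD swap_factors_def)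
  have F: "R.ev ?F t = F_op t" if "t \<in> tensor_power N" for t
  proof -
    have "R.ev ?F t = R.ev (1 - sg 1) (R.ev (1 - sg 3) t)" by (rule mult(1)[OF mem(1,2) that])
    then show ?thesis using that diff_W[OF that] by (simp add: F_op_def)
  qed
  have F_W: "F_op t \<in> tensor_power N" if "t \<in> tensor_power N" for t
    using mult(2)[OF mem(6,6) that] F[OF that] by simp
  have s_W: "swap_factors k t \<in> tensor_power N" "std.ct k t \<in> tensor_power N" if "t \<in> tensor_power N" for k t
    using that by (auto intro: swap_factors_W contract_factors_W)
  have gens: "R.ev (sg 1) t = swap_factors 0 t" "R.ev (sg 3) t = swap_factors 2 t" "R.ev (eg 2) t = std.ct 1 t"
    if "t \<in> tensor_power N" for t
    using that by simp_all
  define G where "G = ?F"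
  have G: "R.ev G t = F_op t" "G \<in> FA N" if "t \<in> tensor_power N" for t
    using F mem that by (simp_all add: G_def)
  have "R.ev Phi_poly t = F_op (std.ct 1 (F_op t)) - F_op t - tensor_scale (1/4) (F_op (std.ct 1 (e14_op (F_op t))))"
    using t mem(3-5) G(2)[OF t] unfolding Phi_poly_def G_def[symmetric]
    by (simp only: R.ev_diff mult(1) FA_closed G(1) F_W s_W gens R.ev_const e14_op_def)
  then show ?thesis using Phi_op[OF N t] by simp
qed

text \<open>The kernel of the induced map on the Brauer algebra is an ideal and contains
  \<open>brauer_Phi N\<close>, so it contains the ideal generated by it.\<close>

lemma quot_ideal_kernel:
  assumes N: "4 \<le> N" and p: "p \<in> quot_ideal N" and t: "t \<in> tensor_power N"
  shows "std_eval N p t = 0"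
proof -
  interpret R: free_rep tensor_scale "tensor_power N" "brauer_gens N" "eta_gen dot ax ax"
    by (rule std.free_rep_eta)
  let ?B = "brauer_algebra N 3" and ?E = "lin_End tensor_scale (tensor_power N)" and ?e = "eta dot ax ax N"
  interpret c: ring_hom_ring "free_algebra (brauer_gens N)" ?B "brauer_class N 3"
    by (rule brauer_class_hom)
  interpret h: ring_hom_ring ?B ?E ?e
    by (intro ring_hom_ringI2 c.S.ring_axioms R.ring_lin_End std.eta_lift(2))
  have lift: "?e (brauer_class N 3 p) = std_eval N p" if "p \<in> FA N" for p
    using that std.eta_lift(1) by (simp add: FA_def)
  have "std_eval N Phi_poly = \<zero>\<^bsub>?E\<^esub>"
    using std_eval_Phi[OF N] by (intro iffD2[OF std_eval_zero_iff] ballI)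
  then have "?e (brauer_Phi N) = \<zero>\<^bsub>?E\<^esub>"
    by (simp only: brauer_Phi_class lift[OF Phi_poly_FA[OF N]])
  then have "{brauer_Phi N} \<subseteq> a_kernel ?B ?E ?e"
    using brauer_Phi_carrier[OF N] unfolding a_kernel_def' by blast
  then have "genideal ?B {brauer_Phi N} \<subseteq> a_kernel ?B ?E ?e"
    by (rule c.S.genideal_minimal[OF h.kernel_is_ideal])
  then have "?e (brauer_class N 3 p) = \<zero>\<^bsub>?E\<^esub>"
    using p unfolding quot_ideal_def a_kernel_def' by blast
  moreover have "p \<in> FA N" using p by (simp add: quot_ideal_def)
  ultimately have "std_eval N p = \<zero>\<^bsub>?E\<^esub>" by (simp only: lift)
  then show ?thesis using t by (simp only: std_eval_zero_iff)
qed

section \<open>The product of the quotient algebras as a ring\<close>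

definition tower_rel :: "(nat \<Rightarrow> brauer_gen ncpoly) \<Rightarrow> (nat \<Rightarrow> brauer_gen ncpoly) \<Rightarrow> bool" where
  "tower_rel f g \<longleftrightarrow> (\<forall>N\<ge>4. f N \<in> FA N \<and> g N \<in> FA N \<and> f N - g N \<in> quot_ideal N)"

lemma tower_rel_refl: "(\<And>N. 4 \<le> N \<Longrightarrow> f N \<in> FA N) \<Longrightarrow> tower_rel f f"
  by (simp add: tower_rel_def quot_ideal_closed)

text \<open>The product of the algebras \<open>B\<^sub>N(3) / \<langle>\<Phi>\<rangle>\<close> over all \<open>N \<ge> 4\<close>: a type cannot depend on
  the single \<open>N\<close> of interest.\<close>

quotient_type tower = "nat \<Rightarrow> brauer_gen ncpoly" / partial: tower_rel
proof (rule part_equivpI)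
  show "\<exists>f. tower_rel f f" by (rule exI[of _ "\<lambda>_. 0"]) (simp add: tower_rel_refl)
  show "symp tower_rel"
    using quot_ideal_minus(1) by (intro sympI) (force simp: tower_rel_def)
  show "transp tower_rel"
  proof (rule transpI)
    fix f g h assume fg: "tower_rel f g" and gh: "tower_rel g h"
    have "f N - h N \<in> quot_ideal N" if "4 \<le> N" for N
      using quot_ideal_closed(2)[OF that, of "f N - g N" "g N - h N"] fg gh that by (simp add: tower_rel_def)
    then show "tower_rel f h" using fg gh by (simp add: tower_rel_def)
  qed
qed

instantiation tower :: ring_1
begin

lift_definition zero_tower :: tower is "\<lambda>_. 0" by (simp add: tower_rel_refl)
lift_definition one_tower :: tower is "\<lambda>_. 1" by (simp add: tower_rel_refl)

lift_definition plus_tower :: "tower \<Rightarrow> tower \<Rightarrow> tower" is "\<lambda>f g N. f N + g N"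
proof -
  fix f f' g g' assume a: "tower_rel f f'" "tower_rel g g'"
  have "f N + g N - (f' N + g' N) \<in> quot_ideal N" if "4 \<le> N" for N
    using quot_ideal_closed(2)[OF that, of "f N - f' N" "g N - g' N"] a that by (simp add: tower_rel_def algebra_simps)
  then show "tower_rel (\<lambda>N. f N + g N) (\<lambda>N. f' N + g' N)" using a by (simp add: tower_rel_def)
qed

lift_definition uminus_tower :: "tower \<Rightarrow> tower" is "\<lambda>f N. - f N"
proof -
  fix f f' assume a: "tower_rel f f'"
  have "- f N - (- f' N) \<in> quot_ideal N" if "4 \<le> N" for N
    using quot_ideal_minus(1)[OF that, of "f N - f' N"] a that by (simp add: tower_rel_def algebra_simps)
  then show "tower_rel (\<lambda>N. - f N) (\<lambda>N. - f' N)" using a by (simp add: tower_rel_def)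
qed

lift_definition minus_tower :: "tower \<Rightarrow> tower \<Rightarrow> tower" is "\<lambda>f g N. f N - g N"
proof -
  fix f f' g g' assume a: "tower_rel f f'" "tower_rel g g'"
  have "f N - g N - (f' N - g' N) \<in> quot_ideal N" if "4 \<le> N" for N
    using quot_ideal_minus(2)[OF that, of "f N - f' N" "g N - g' N"] a that by (simp add: tower_rel_def algebra_simps)
  then show "tower_rel (\<lambda>N. f N - g N) (\<lambda>N. f' N - g' N)" using a by (simp add: tower_rel_def)
qed

lift_definition times_tower :: "tower \<Rightarrow> tower \<Rightarrow> tower" is "\<lambda>f g N. f N * g N"
proof -
  fix f f' g g' assume a: "tower_rel f f'" "tower_rel g g'"
  have "f N * g N - f' N * g' N \<in> quot_ideal N" if N: "4 \<le> N" for N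
  proof -
    have "f N * g N - f' N * g' N = (f N - f' N) * g N + f' N * (g N - g' N)" by (simp add: algebra_simps)
    then show ?thesis
      using a N quot_ideal_closed(3)[OF N, of "g N - g' N" "f' N"] quot_ideal_closed(4)[OF N, of "f N - f' N" "g N"]
      by (simp add: tower_rel_def quot_ideal_closed(2)[OF N])
  qed
  then show "tower_rel (\<lambda>N. f N * g N) (\<lambda>N. f' N * g' N)" using a by (simp add: tower_rel_def)
qed

instance
proof
  show "(0 :: tower) \<noteq> 1"
  proof transfer
    interpret R: free_rep tensor_scale "tensor_power 4" "brauer_gens 4" "eta_gen dot ax ax"
      by (rule std.free_rep_eta)
    \<comment> \<open>Nontriviality is tested in the component 4: the elements of
      \<open>quot_ideal 4\<close> act by zero, and -1 does not.\<close>
    let ?w = "replicate 4 1 :: 3 list"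
    have "std_eval 4 (0 - 1) (unit_tensor ?w) ?w = - 1"
      by (simp add: unit_tensor_W) (simp add: unit_tensor_def)
    then have "(0 - 1) \<notin> quot_ideal 4"
      using quot_ideal_kernel[of 4 "0 - 1" "unit_tensor ?w"] by (auto simp: unit_tensor_W)
    then show "\<not> tower_rel (\<lambda>_. 0) (\<lambda>_. 1)"
      unfolding tower_rel_def by auto
  qed
qed (transfer; simp add: tower_rel_def quot_ideal_closed algebra_simps)+

end

lift_definition tower_sc :: "complex \<Rightarrow> tower" is "\<lambda>c _. const c"
  by (simp add: tower_rel_refl)

text \<open>Outside the component \<open>N\<close> the generators act as in the trivial representation
  \<open>s\<^sub>i \<mapsto> 1\<close>, \<open>e\<^sub>i \<mapsto> 0\<close>, which satisfies all relations.\<close>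

lift_definition tower_s :: "nat \<Rightarrow> nat \<Rightarrow> tower" is "\<lambda>N i M. if M = N \<and> 1 \<le> i \<and> i < N then sg i else 1"
  by (rule tower_rel_refl) auto

lift_definition tower_e :: "nat \<Rightarrow> nat \<Rightarrow> tower" is "\<lambda>N i M. if M = N \<and> 1 \<le> i \<and> i < N then eg i else 0"
  by (rule tower_rel_refl) auto

text \<open>For \<open>N < 4\<close> nothing is required of the component \<open>f N\<close>, so the
  default must not depend on \<open>f\<close>.\<close>

lift_definition tower_rep :: "nat \<Rightarrow> tower \<Rightarrow> tensor \<Rightarrow> tensor" is
  "\<lambda>N f t. if 4 \<le> N then std_eval N (f N) t else t"
proof (rule ext)
  fix N f g t assume fg: "tower_rel f g"
  show "(if 4 \<le> N then std_eval N (f N) t else t) = (if 4 \<le> N then std_eval N (g N) t else t)"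
  proof (cases "4 \<le> N \<and> t \<in> tensor_power N")
    case True
    interpret R: free_rep tensor_scale "tensor_power N" "brauer_gens N" "eta_gen dot ax ax"
      by (rule std.free_rep_eta)
    show ?thesis
      using quot_ideal_kernel[of N "f N - g N" t] fg True by (simp add: tower_rel_def)
  qed (auto simp: free_eval_def)
qed

text \<open>Expresses that \<open>p\<close> represents the component \<open>N\<close>; a relation,
  since representatives are determined only up to \<open>quot_ideal N\<close>.\<close>

lift_definition tower_comp :: "nat \<Rightarrow> tower \<Rightarrow> brauer_gen ncpoly \<Rightarrow> bool" is
  "\<lambda>N f p. 4 \<le> N \<and> p \<in> FA N \<and> f N - p \<in> quot_ideal N"
proof (rule ext)
  fix N f g p assume fg: "tower_rel f g"
  have "f N - p \<in> quot_ideal N \<longleftrightarrow> g N - p \<in> quot_ideal N" if N: "4 \<le> N"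
  proof -
    have "f N - g N \<in> quot_ideal N" using fg N by (simp add: tower_rel_def)
    then show ?thesis
      using quot_ideal_closed(2)[OF N, of "f N - g N" "g N - p"] quot_ideal_minus(2)[OF N, of "f N - p" "f N - g N"]
      by auto
  qed
  then show "(4 \<le> N \<and> p \<in> FA N \<and> f N - p \<in> quot_ideal N) = (4 \<le> N \<and> p \<in> FA N \<and> g N - p \<in> quot_ideal N)"
    by blast
qed

lemma const_add: "const (a + b) = const a + const b" and const_mult: "const (a * b) = const a * const b"
  and const_one: "const 1 = 1"
  by (simp_all add: const_def single_add mult_single)

lemma const_comm:
  fixes p :: "'g ncpoly"
  shows "const c * p = p * const c"
proof -
  have "const c * Poly_Mapping.single w a = Poly_Mapping.single w a * const c" for w :: "'g fword" and a
    by (simp add: const_def mult_single mult.commute)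
  then have "const c * (\<Sum>w\<in>Poly_Mapping.keys p. Poly_Mapping.single w (Poly_Mapping.lookup p w)) =
    (\<Sum>w\<in>Poly_Mapping.keys p. Poly_Mapping.single w (Poly_Mapping.lookup p w)) * const c"
    by (simp add: sum_distrib_left sum_distrib_right)
  moreover have "p = (\<Sum>w\<in>Poly_Mapping.keys p. Poly_Mapping.single w (Poly_Mapping.lookup p w))"
    by (rule poly_mapping_eqI) (simp add: lookup_sum lookup_single when_def in_keys_iff)
  ultimately show ?thesis by simp
qed

text \<open>Relations between the generators hold literally in the components other than
  \<open>N\<close>, so the ideal enters only at \<open>N\<close>.\<close>

lemma tower_relI:
  assumes "\<And>M. f M \<in> FA M" "\<And>M. g M \<in> FA M" "\<And>M. M \<noteq> N \<Longrightarrow> f M = g M" "4 \<le> N \<Longrightarrow> f N - g N \<in> quot_ideal N"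
  shows "tower_rel f g"
  unfolding tower_rel_def
proof (intro allI impI conjI assms)
  fix M :: nat assume "4 \<le> M"
  then show "f M - g M \<in> quot_ideal M" using assms(3,4) quot_ideal_closed(1) by (cases "M = N") auto
qed

lemma std_rep_tower:
  assumes N: "4 \<le> N"
  shows "std_rep tower_sc (tower_s N) (tower_e N) N (tower_rep N)"
proof -
  note rel = quot_ideal_closed(5)[OF N]
  interpret R: free_rep tensor_scale "tensor_power N" "brauer_gens N" "eta_gen dot ax ax"
    by (rule std.free_rep_eta)
  have 1: "brauer_rels tower_sc (tower_s N) (tower_e N) N"
  proof
    fix a b c x
    show "tower_sc (a + b) = tower_sc a + tower_sc b" by transfer (simp add: const_add tower_rel_refl)
    show "tower_sc (a * b) = tower_sc a * tower_sc b" by transfer (simp add: const_mult tower_rel_refl)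
    show "tower_sc 1 = 1" by transfer (simp add: const_one tower_rel_refl)
    show "tower_sc c * x = x * tower_sc c"
      by transfer (simp add: const_comm tower_rel_def quot_ideal_closed)
  next
    fix i assume i: "1 \<le> i" "i < N"
    then have i': "i \<in> {1..<N}" by simp
    show "tower_s N i * tower_s N i = 1"
      by (transfer fixing: N i, rule tower_relI[where N = N]) (use i rel[OF ss[OF i']] in auto)
    show "tower_e N i * tower_e N i = tower_sc 3 * tower_e N i"
      by (transfer fixing: N i, rule tower_relI[where N = N]) (use i rel[OF ee[OF i']] in auto)
    show "tower_s N i * tower_e N i = tower_e N i"
      by (transfer fixing: N i, rule tower_relI[where N = N]) (use i rel[OF se[OF i']] in auto)
    show "tower_e N i * tower_s N i = tower_e N i"
      by (transfer fixing: N i, rule tower_relI[where N = N]) (use i rel[OF es[OF i']] in auto)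
  next
    fix i j assume ij: "1 \<le> i" "i + 2 \<le> j" "j < N"
    then have i': "i \<in> {1..<N}" "j \<in> {1..<N}" "i + 2 \<le> j \<or> j + 2 \<le> i" "j + 2 \<le> i \<or> i + 2 \<le> j" by auto
    show "tower_s N i * tower_s N j = tower_s N j * tower_s N i"
      by (transfer fixing: N i j, rule tower_relI[where N = N]) (use ij rel[OF ss_far[OF i'(1-3)]] in auto)
    show "tower_s N i * tower_e N j = tower_e N j * tower_s N i"
      by (transfer fixing: N i j, rule tower_relI[where N = N]) (use ij rel[OF se_far[OF i'(1-3)]] in auto)
    \<comment> \<open>This is the relator \<open>se_far\<close> with the indices exchanged and the
      opposite sign.\<close>
    show "tower_e N i * tower_s N j = tower_s N j * tower_e N i"
      by (transfer fixing: N i j, rule tower_relI[where N = N])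
        (use ij quot_ideal_minus(1)[OF N rel[OF se_far[OF i'(2,1,4)]]] in auto)
    show "tower_e N i * tower_e N j = tower_e N j * tower_e N i"
      by (transfer fixing: N i j, rule tower_relI[where N = N]) (use ij rel[OF ee_far[OF i'(1-3)]] in auto)
  next
    fix i assume i: "1 \<le> i" "Suc i < N"
    then have i': "i \<in> {1..<N}" "i + 1 \<in> {1..<N}" "Suc i \<in> {1..<N}" by auto
    show "tower_s N i * tower_s N (Suc i) * tower_s N i = tower_s N (Suc i) * tower_s N i * tower_s N (Suc i)"
      by (transfer fixing: N i, rule tower_relI[where N = N]) (use i rel[OF sss[OF i'(1,2)]] in auto)
    show "tower_e N i * tower_e N (Suc i) * tower_e N i = tower_e N i"
      by (transfer fixing: N i, rule tower_relI[where N = N]) (use i rel[OF eee[OF i'(1,3)]] in auto)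
    show "tower_e N (Suc i) * tower_e N i * tower_e N (Suc i) = tower_e N (Suc i)"
      by (transfer fixing: N i, rule tower_relI[where N = N]) (use i rel[OF eee[OF i'(3,1)]] in auto)
    show "tower_s N i * tower_e N (Suc i) * tower_e N i = tower_s N (Suc i) * tower_e N i"
      by (transfer fixing: N i, rule tower_relI[where N = N]) (use i rel[OF see[OF i'(1,2)]] in auto)
    show "tower_e N (Suc i) * tower_e N i * tower_s N (Suc i) = tower_e N (Suc i) * tower_s N i"
      by (transfer fixing: N i, rule tower_relI[where N = N]) (use i rel[OF ees[OF i'(1,2)]] in auto)
  qed
  have 2: "brauer_quot_axioms tower_sc (tower_s N) (tower_e N) N"
  proof
    show "4 \<le> N" by (rule N)
    show "(1 - tower_s N 1) * (1 - tower_s N 3) * tower_e N 2 * ((1 - tower_s N 1) * (1 - tower_s N 3)) -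
      (1 - tower_s N 1) * (1 - tower_s N 3) - tower_sc (1/4) * ((1 - tower_s N 1) * (1 - tower_s N 3)) * tower_e N 2 *
      (tower_s N 1 * tower_s N 3 * tower_e N 2 * tower_s N 3 * tower_s N 1) * ((1 - tower_s N 1) * (1 - tower_s N 3)) = 0"
      by (transfer fixing: N, rule tower_relI[where N = N])
        (use N quot_ideal_closed(6)[OF N] in \<open>auto simp: Phi_poly_def\<close>)
  qed
  have 3: "std_rep_axioms tower_sc (tower_s N) (tower_e N) N (tower_rep N)"
  proof
    fix t u x y c assume t: "t \<in> tensor_power N"
    show "tower_rep N x t \<in> tensor_power N"
      using N t by (transfer fixing: N t) (auto simp: tower_rel_def FA_def)
    show "tower_rep N x (tensor_scale c t) = tensor_scale c (tower_rep N x t)"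
      using N t by (transfer fixing: N t c) (simp add: tower_rel_def FA_def R.ev_lin)
    show "tower_rep N (x + y) t = tower_rep N x t + tower_rep N y t"
      using N t by (transfer fixing: N t) simp
    show "tower_rep N (x * y) t = tower_rep N x (tower_rep N y t)"
      using N t by (transfer fixing: N t) (simp add: tower_rel_def FA_def)
    show "tower_rep N (tower_sc c) t = tensor_scale c t"
      using N t by (transfer fixing: N t c) simp
    assume u: "u \<in> tensor_power N"
    show "tower_rep N x (t + u) = tower_rep N x t + tower_rep N x u"
      using N t u by (transfer fixing: N t u) (simp add: tower_rel_def FA_def R.ev_lin)
  next
    fix i t assume i: "1 \<le> i" "i < N" and t: "t \<in> tensor_power N"
    show "tower_rep N (tower_s N i) t = swap_factors (i - 1) t"
      using N t i by (transfer fixing: N i t) simp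
    show "tower_rep N (tower_e N i) t = std.ct (i - 1) t"
      using N t i by (transfer fixing: N i t) simp
  qed
  show ?thesis
    by (intro std_rep.intro brauer_quot.intro 1 2 3)
qed

text \<open>Faithfulness speaks only about \<open>A N\<close>, so \<open>p\<close> is first lifted,
  word by word, to some \<open>x\<close> in \<open>A N\<close> whose component \<open>N\<close> is
  represented by \<open>p\<close>. Then \<open>x\<close> acts as \<open>p\<close> does, so
  \<open>x = 0\<close>, and reading off its component puts \<open>p\<close> into the ideal.\<close>

theorem std_kernel_quot_ideal:
  assumes N: "4 \<le> N" and p: "p \<in> FA N" and 0: "\<forall>t\<in>tensor_power N. std_eval N p t = 0"
  shows "p \<in> quot_ideal N"
proof -
  interpret std_rep tower_sc "tower_s N" "tower_e N" N "tower_rep N" by (rule std_rep_tower[OF N])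
  have word: "\<exists>x\<in>A N. tower_comp N x (Poly_Mapping.single (FWord gs) c)" if "set gs \<subseteq> brauer_gens N" for gs c
    using that
  proof (induction gs)
    case Nil
    have "tower_comp N (tower_sc c) (const c)"
      using N by (transfer fixing: N c) (simp add: quot_ideal_closed)
    then show ?case using A_sc by (auto simp: const_def zero_fword_def)
  next
    case (Cons g gs)
    then obtain x where x: "x \<in> A N" "tower_comp N x (Poly_Mapping.single (FWord gs) c)" by auto
    have w: "Poly_Mapping.single (FWord (g # gs)) c = gen g * Poly_Mapping.single (FWord gs) c"
      by (simp add: gen_def mult_single plus_fword_def)
    have mul: "tower_comp N (y * x) (q * p)" if "tower_comp N y q" "tower_comp N x p" for x y p q
      using that
    proof (transfer fixing: N p q)
      fix x y assume a: "tower_rel y y" "tower_rel x x" "4 \<le> N \<and> q \<in> FA N \<and> y N - q \<in> quot_ideal N"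
        "4 \<le> N \<and> p \<in> FA N \<and> x N - p \<in> quot_ideal N"
      have "y N * x N - q * p = (y N - q) * x N + q * (x N - p)" by (simp add: algebra_simps)
      then show "4 \<le> N \<and> q * p \<in> FA N \<and> y N * x N - q * p \<in> quot_ideal N"
        using a quot_ideal_closed(2)[OF N] quot_ideal_closed(3)[OF N, of "x N - p" q]
          quot_ideal_closed(4)[OF N, of "y N - q" "x N"] by (simp add: tower_rel_def)
    qed
    consider i where "g = GenS i" "1 \<le> i" "i < N" | i where "g = GenE i" "1 \<le> i" "i < N"
      using Cons.prems by (auto simp: brauer_gens_def)
    then show ?case
    proof cases
      case (1 i)
      have "tower_comp N (tower_s N i) (sg i)"
        using N 1 by (transfer fixing: N i) (simp add: quot_ideal_closed)
      from mul[OF this x(2)] show ?thesis unfolding w unfolding 1(1) using A_s[OF 1(2,3) x(1)] by blast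
    next
      case (2 i)
      have "tower_comp N (tower_e N i) (eg i)"
        using N 2 by (transfer fixing: N i) (simp add: quot_ideal_closed)
      from mul[OF this x(2)] show ?thesis unfolding w unfolding 2(1) using A_e[OF 2(2,3) x(1)] by blast
    qed
  qed
  have sum: "\<exists>x\<in>A N. tower_comp N x (\<Sum>w\<in>K. Poly_Mapping.single w (a w))"
    if "finite K" "\<And>w. w \<in> K \<Longrightarrow> set (letters w) \<subseteq> brauer_gens N" for K and a :: "brauer_gen fword \<Rightarrow> complex"
    using that
  proof (induction K rule: finite_induct)
    case empty
    have "tower_comp N 0 0" using N by (transfer fixing: N) (simp add: quot_ideal_closed)
    then show ?case using A_0 by auto
  next
    case (insert w K)
    then obtain x where x: "x \<in> A N" "tower_comp N x (\<Sum>w\<in>K. Poly_Mapping.single w (a w))" by auto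
    obtain y where y: "y \<in> A N" "tower_comp N y (Poly_Mapping.single w (a w))"
      using word[of "letters w" "a w"] insert.prems by auto
    have "tower_comp N (y + x) (q + p)" if "tower_comp N y q" "tower_comp N x p" for p q
      using that
    proof (transfer fixing: N p q)
      fix x y assume a: "4 \<le> N \<and> q \<in> FA N \<and> y N - q \<in> quot_ideal N" "4 \<le> N \<and> p \<in> FA N \<and> x N - p \<in> quot_ideal N"
      then show "4 \<le> N \<and> q + p \<in> FA N \<and> y N + x N - (q + p) \<in> quot_ideal N"
        using quot_ideal_closed(2)[OF N, of "y N - q" "x N - p"] by (simp add: algebra_simps)
    qed
    from this[OF y(2) x(2)] show ?case using insert x y A_add by auto
  qed
  have "p = (\<Sum>w\<in>Poly_Mapping.keys p. Poly_Mapping.single w (Poly_Mapping.lookup p w))"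
    by (rule poly_mapping_eqI) (simp add: lookup_sum lookup_single when_def in_keys_iff)
  moreover have "set (letters w) \<subseteq> brauer_gens N" if "w \<in> Poly_Mapping.keys p" for w
    using p that by (simp add: FA_def free_algebra_def)
  ultimately obtain x where x: "x \<in> A N" "tower_comp N x p"
    using sum[of "Poly_Mapping.keys p" "Poly_Mapping.lookup p"] by auto
  interpret R: free_rep tensor_scale "tensor_power N" "brauer_gens N" "eta_gen dot ax ax"
    by (rule std.free_rep_eta)
  have "tower_rep N x t = 0" if "t \<in> tensor_power N" for t
    using x(2) that 0
  proof (transfer fixing: N p t)
    fix x assume "4 \<le> N \<and> p \<in> FA N \<and> x N - p \<in> quot_ideal N" "t \<in> tensor_power N"
      "\<forall>t\<in>tensor_power N. std_eval N p t = 0"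
    then show "(if 4 \<le> N then std_eval N (x N) t else t) = 0"
      using quot_ideal_kernel[of N "x N - p" t] by simp
  qed
  then have "x = 0" using faithful[of N x] x(1) by (simp add: null_def)
  then have "tower_comp N 0 p" using x(2) by simp
  then have "0 - p \<in> quot_ideal N" by (transfer fixing: N p) auto
  then show ?thesis using quot_ideal_minus(1)[OF N, of "0 - p"] by simp
qed

theorem theorem1p7:
  fixes r :: nat
    and \<pi> :: "(complex^2^2) ncpoly set \<Rightarrow> complex^3 \<Rightarrow> complex^3"
    and \<beta> :: "complex^3 \<Rightarrow> complex^3 \<Rightarrow> complex"
    and b b' :: "3 \<Rightarrow> complex^3"
  assumes "r \<ge> 4"
    and "irreducible_Usl2_module (*s) UNIV \<pi>"
    and "invariant_form \<pi> \<beta>"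
    and "dual_bases \<beta> b b'"
  shows "a_kernel (brauer_algebra r 3) (tensor_End \<pi> r) (eta \<beta> b b' r) =
    genideal (brauer_algebra r 3) {brauer_Phi r}"
proof -
  interpret form \<beta> b b'
    using assms(3) unfolding invariant_form_def by (intro form.intro assms(4)) blast+
  have zero: "\<zero>\<^bsub>tensor_End \<pi> r\<^esub> = (\<lambda>t\<in>tensor_power r. 0)"
    by (simp add: tensor_End_def Usl2_End_def lin_End_def)
  \<comment> \<open>\<open>kernel_standard\<close> passes from \<beta> to \<open>dot\<close>, where
    \<open>std_kernel_quot_ideal\<close> and \<open>quot_ideal_kernel\<close> are the two
    inclusions.\<close>
  have ker: "eta \<beta> b b' r (brauer_class r 3 p) = \<zero>\<^bsub>tensor_End \<pi> r\<^esub> \<longleftrightarrow> p \<in> quot_ideal r" if p: "p \<in> FA r" for p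
  proof -
    have pc: "p \<in> carrier (free_algebra (brauer_gens r))" using p by (simp add: FA_def)
    have "eta \<beta> b b' r (brauer_class r 3 p) = \<zero>\<^bsub>tensor_End \<pi> r\<^esub> \<longleftrightarrow>
      (\<forall>t\<in>tensor_power r. free_eval tensor_scale (tensor_power r) (eta_gen \<beta> b b') p t = 0)"
      unfolding zero eta_lift(1)[OF pc] by (auto simp: fun_eq_iff free_eval_def)
    also have "\<dots> \<longleftrightarrow> p \<in> quot_ideal r"
      unfolding kernel_standard[OF pc]
      using std_kernel_quot_ideal[OF assms(1) p] quot_ideal_kernel[OF assms(1)] by blast
    finally show ?thesis .
  qed
  interpret I: ideal "genideal (brauer_algebra r 3) {brauer_Phi r}" "brauer_algebra r 3"
    by (rule Phi_ideal[OF assms(1)])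
  show ?thesis
    using ker I.a_subset by (auto simp: a_kernel_def' brauer_carrier quot_ideal_def)
qed

end
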